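(* Let $\mu$ be a positive finite Borel measure on the unit circle $\mathbb{T}$ and let $E$ be a Borel subset of $\mathbb{T}$. Suppose that there exists a family of open arcs $(I_n)$ of $\mathbb{T}$ such that the arcs $(\gamma I_n)$ are pairwise disjoint for some $\gamma>1$ and $$\sum_{n}|I_n|\log \frac{|I_n|}{c_{\mu}(E\cap I_n)} =-\infty .$$ Then $E$ is a uniqueness set for $\mathcal{D}(\mu)$.
   Context: $|d\zeta|$ is arc length on $\mathbb{T}$ and $|I|$ is the length of an arc $I$. For $f\in L^2(\mathbb{T})$ and $\xi\in\mathbb{T}$, the local Dirichlet integral is $$\mathcal{D}_\xi(f)=\int_{\mathbb{T}}\Big|\frac{f(\zeta)-f(\xi)}{\zeta-\xi}\Big|^2\frac{|d\zeta|}{2\pi},$$ where $f(\xi)$ is the non-tangential limit at $\xi$ of the Poisson extension of $f$ (with the standard convention $\mathcal{D}_\xi(f)=\infty$ if this limit does not exist). Put $\mathcal{D}_\mu(f)=\int_{\mathbb{T}}\mathcal{D}_\xi(f)\,d\mu(\xi)$. The harmonically weighted Dirichlet space $\mathcal{D}^h(\mu)$ is the set of $f\in L^2(\mathbb{T})$ with $\mathcal{D}_\mu(f)<\infty$, with norm $\|f\|_\mu^2=\|f\|_{L^2(\mathbb{T})}^2+\mathcal{D}_\mu(f)$, where the $L^2$ norm is taken with respect to $|d\zeta|/2\pi$. The analytic space is $\mathcal{D}(\mu)=\{f\in\mathcal{D}^h(\mu):\widehat f(n)=0 \text{ for } n<0\}$; it is contained in the Hardy space $H^2$ of the unit disc (functions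 in $H^2$ are identified with their boundary functions). The capacity associated with $\mathcal{D}(\mu)$ is $$c_\mu(E)=\inf\{\|f\|_\mu^2: f\in\mathcal{D}^h(\mu),\ |f|\ge 1 \text{ a.e. on a neighborhood of } E\}.$$ A property holds $c_\mu$-quasi-everywhere ($c_\mu$-q.e.) if it holds outside a set of $c_\mu$-capacity zero. Every $f\in\mathcal{D}(\mu)$ has non-tangential limits $f(\zeta)$ for $c_\mu$-q.e. $\zeta\in\mathbb{T}$. A set $E\subset\mathbb{T}$ is a uniqueness set for $\mathcal{D}(\mu)$ if every $f\in\mathcal{D}(\mu)$ whose non-tangential limit is $0$ $c_\mu$-q.e. on $E$ is identically $0$. For $\gamma>1$ and an arc $I=(e^{ia},e^{ib})$ (with $a<b$), $\gamma I$ is the arc $\big(e^{i(a-(\gamma-1)\frac{b-a}{2})},e^{i(b+(\gamma-1)\frac{b-a}{2})}\big)$, i.e. the arc with the same midpoint as $I$ and $\gamma$ times its length. *)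

theory Defs
  imports "HOL-Analysis.Analysis"
begin

abbreviation unit_circle :: "complex set" where
  "unit_circle \<equiv> sphere 0 1"

abbreviation circle_borel :: "complex measure" where
  "circle_borel \<equiv> restrict_space borel unit_circle"

text \<open>Normalized arc length \<open>|d\<zeta>| / 2\<pi>\<close>, the image of the uniform distribution on
  \<open>[0, 2\<pi>]\<close> under \<open>t \<mapsto> e\<^sup>i\<^sup>t\<close>.\<close>
definition circle_measure :: "complex measure" where
  "circle_measure = distr (uniform_measure lborel {0..2*pi}) circle_borel cis"

lemma measurable_cis_circle: "cis \<in> borel \<rightarrow>\<^sub>M circle_borel"
  by (intro measurable_restrict_space2 borel_measurable_continuous_onI continuous_intros) auto

lemma sets_circle_measure [simp]: "sets circle_measure = sets circle_borel"
  by (simp add: circle_measure_def)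

lemma space_circle_measure [simp]: "space circle_measure = unit_circle"
  by (simp add: circle_measure_def space_restrict_space)

lemma emeasure_circle_measure_space: "emeasure circle_measure unit_circle = 1"
proof -
  have m: "cis \<in> uniform_measure lborel {0..2*pi} \<rightarrow>\<^sub>M circle_borel"
    using measurable_cis_circle by simp
  have s: "unit_circle \<in> sets circle_borel"
    using sets.top[of circle_borel] by (simp add: space_restrict_space)
  have "emeasure circle_measure unit_circle = emeasure (uniform_measure lborel {0..2*pi}) UNIV"
    unfolding circle_measure_def by (subst emeasure_distr[OF m s]) (auto simp: vimage_def)
  also have "\<dots> = 1"
    by (subst emeasure_uniform_measure) (auto intro!: ennreal_divide_self)
  finally show ?thesis .
qed

text \<open>Elements of \<open>L\<^sup>2(\<T>)\<close> are represented by Borel functions on the circle; every class of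
  almost everywhere equal functions has such a representative. Values off the circle play no role,
  and all notions below are invariant under almost everywhere modification on the circle.\<close>
definition L2_circle :: "(complex \<Rightarrow> complex) set" where
  "L2_circle = {f \<in> borel_measurable circle_measure.
     integrable circle_measure (\<lambda>\<zeta>. (cmod (f \<zeta>))\<^sup>2)}"

definition poisson_ext :: "(complex \<Rightarrow> complex) \<Rightarrow> complex \<Rightarrow> complex" where
  "poisson_ext f z =
     (LINT \<zeta>|circle_measure. of_real ((1 - (cmod z)\<^sup>2) / (cmod (\<zeta> - z))\<^sup>2) * f \<zeta>)"

definition stolz_region :: "real \<Rightarrow> complex \<Rightarrow> complex set" where
  "stolz_region \<alpha> \<xi> = {z. cmod z < 1 \<and> cmod (z - \<xi>) < \<alpha> * (1 - cmod z)}"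

definition has_nt_limit :: "(complex \<Rightarrow> complex) \<Rightarrow> complex \<Rightarrow> complex \<Rightarrow> bool" where
  "has_nt_limit u \<xi> l \<longleftrightarrow> (\<forall>\<alpha>>1. (u \<longlongrightarrow> l) (at \<xi> within stolz_region \<alpha> \<xi>))"

text \<open>The value \<open>f(\<xi>)\<close> of a function given on the circle; meaningful only if the non-tangential
  limit exists.\<close>
definition nt_value :: "(complex \<Rightarrow> complex) \<Rightarrow> complex \<Rightarrow> complex" where
  "nt_value f \<xi> = (THE l. has_nt_limit (poisson_ext f) \<xi> l)"

definition local_dirichlet :: "complex \<Rightarrow> (complex \<Rightarrow> complex) \<Rightarrow> ennreal" where
  "local_dirichlet \<xi> f =
     (if \<exists>l. has_nt_limit (poisson_ext f) \<xi> l
      then \<integral>\<^sup>+ \<zeta>. ennreal ((cmod ((f \<zeta> - nt_value f \<xi>) / (\<zeta> - \<xi>)))\<^sup>2) \<partial>circle_measure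
      else \<infinity>)"

definition dirichlet_integral :: "complex measure \<Rightarrow> (complex \<Rightarrow> complex) \<Rightarrow> ennreal" where
  "dirichlet_integral \<mu> f = (\<integral>\<^sup>+ \<xi>. local_dirichlet \<xi> f \<partial>\<mu>)"

text \<open>The square \<open>\<parallel>f\<parallel>\<^sub>\<mu>\<^sup>2\<close> of the norm.\<close>
definition norm_sq :: "complex measure \<Rightarrow> (complex \<Rightarrow> complex) \<Rightarrow> ennreal" where
  "norm_sq \<mu> f =
     (\<integral>\<^sup>+ \<zeta>. ennreal ((cmod (f \<zeta>))\<^sup>2) \<partial>circle_measure) + dirichlet_integral \<mu> f"

definition harmonic_dirichlet_space :: "complex measure \<Rightarrow> (complex \<Rightarrow> complex) set" where
  "harmonic_dirichlet_space \<mu> = {f \<in> L2_circle. dirichlet_integral \<mu> f < \<infinity>}"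

definition fourier_coeff :: "(complex \<Rightarrow> complex) \<Rightarrow> int \<Rightarrow> complex" where
  "fourier_coeff f n = (LINT \<zeta>|circle_measure. f \<zeta> * \<zeta> powi (- n))"

definition dirichlet_space :: "complex measure \<Rightarrow> (complex \<Rightarrow> complex) set" where
  "dirichlet_space \<mu> = {f \<in> harmonic_dirichlet_space \<mu>. \<forall>n<0. fourier_coeff f n = 0}"

definition capacity :: "complex measure \<Rightarrow> complex set \<Rightarrow> ennreal" where
  "capacity \<mu> E = Inf {norm_sq \<mu> f | f. f \<in> harmonic_dirichlet_space \<mu> \<and>
     (\<exists>U. openin (top_of_set unit_circle) U \<and> E \<subseteq> U \<and>
        (AE \<zeta> in circle_measure. \<zeta> \<in> U \<longrightarrow> cmod (f \<zeta>) \<ge> 1))}"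

definition qe_on :: "complex measure \<Rightarrow> complex set \<Rightarrow> (complex \<Rightarrow> bool) \<Rightarrow> bool" where
  "qe_on \<mu> E P \<longleftrightarrow> (\<exists>N\<subseteq>unit_circle. capacity \<mu> N = 0 \<and> (\<forall>\<zeta>\<in>E - N. P \<zeta>))"

text \<open>For \<open>f\<close> in the Dirichlet space, the Poisson extension of \<open>f\<close> is the holomorphic function in
  the Hardy space of the disc with boundary function \<open>f\<close>.\<close>
definition uniqueness_set :: "complex measure \<Rightarrow> complex set \<Rightarrow> bool" where
  "uniqueness_set \<mu> E \<longleftrightarrow>
     (\<forall>f\<in>dirichlet_space \<mu>.
        qe_on \<mu> E (\<lambda>\<zeta>. has_nt_limit (poisson_ext f) \<zeta> 0) \<longrightarrow>
        (AE \<zeta> in circle_measure. f \<zeta> = 0))"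

text \<open>The arc \<open>(e\<^sup>i\<^sup>a, e\<^sup>i\<^sup>b)\<close>; its length is \<open>b - a\<close> when \<open>a < b \<le> a + 2\<pi>\<close>.\<close>
definition open_arc :: "real \<Rightarrow> real \<Rightarrow> complex set" where
  "open_arc a b = cis ` {a<..<b}"

definition dilated_arc :: "real \<Rightarrow> real \<Rightarrow> real \<Rightarrow> complex set" where
  "dilated_arc \<gamma> a b =
     open_arc (a - (\<gamma> - 1) * ((b - a) / 2)) (b + (\<gamma> - 1) * ((b - a) / 2))"

text \<open>The logarithm on \<open>[0, \<infinity>]\<close>, with \<open>log 0 = -\<infinity>\<close> and \<open>log \<infinity> = \<infinity>\<close>.\<close>
definition ext_ln :: "ennreal \<Rightarrow> ereal" where
  "ext_ln x = (if x = 0 then -\<infinity> else if x = \<infinity> then \<infinity> else ereal (ln (enn2real x)))"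

end

theory Submission
  imports Defs "HOL-Complex_Analysis.Complex_Analysis" "HOL-Probability.Probability_Measure"
begin

text \<open>Let \<open>f\<close> be in the Dirichlet space and vanish quasi-everywhere on \<open>E\<close>. With \<open>m\<close> the mean of
  \<open>\<bar>f\<bar>\<close> over an arc \<open>I\<close> and \<open>\<phi>\<close> a cutoff function that is \<open>1\<close> on \<open>I\<close> and supported in \<open>\<gamma>I\<close>,
  the function \<open>\<phi> (1 - \<bar>f\<bar> / m)\<close> is a test function for the capacity \<open>c\<close> of \<open>E \<inter> I\<close>, up to
  functions of small norm. Its norm is controlled by the part \<open>N\<close> of the energy of \<open>f\<close> that comes
  from \<open>\<gamma>I\<close>, so \<open>m\<^sup>2 c \<le> C N\<close>. The energies \<open>N\<close> of disjoint arcs have a finite sum; since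
  \<open>log x \<le> x - 1\<close>, the sum of \<open>\<bar>I\<bar> log m\<close> is at most a constant plus half the sum of
  \<open>\<bar>I\<bar> log (\<bar>I\<bar> / c)\<close>, which is \<open>-\<infinity>\<close>. By a Jensen-type inequality every Fourier
  coefficient of \<open>f\<close> is then zero.\<close>

text \<open>The Dirichlet integral is not local: cutting \<open>f\<close> off near \<open>I\<close>
  affects the quotients at every \<xi> of the circle. Therefore only \<zeta> is confined to the arc,
  while \<xi> ranges over the whole circle; for each fixed \<xi> such energies are additive in the
  arc. Seen from a distant \<xi>, the energy bounds the deviation of \<open>m\<close> from the
  modulus of \<open>f\<close> at \<xi> only up to the squared distance to the arc, and the energy of
  the cutoff decays at exactly this rate. The constant is homogeneous of degree 0 in the sizes
  involved, and \<gamma> > 1 leaves a collar proportional to the arc, so one constant serves all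
  arcs. The second obstacle is that capacity asks for a bound almost everywhere on an open
  neighbourhood, while \<open>f\<close> is only known to vanish quasi-everywhere as a non-tangential
  limit. Radial dilations, continuous and convergent in norm, bridge this gap. Higher coefficients
  are reached by multiplying \<open>f\<close> with powers of \<open>cnj \<zeta>\<close>, which
  leaves its modulus on the circle unchanged.\<close>

abbreviation "\<sigma> \<equiv> circle_measure"

abbreviation abs2 :: "complex \<Rightarrow> ennreal" where
  "abs2 z \<equiv> ennreal ((cmod z)\<^sup>2)"

section \<open>Poisson integrals on the circle\<close>

lemma measurable_circle_ident [measurable]: "(\<lambda>\<zeta>. \<zeta>) \<in> borel_measurable \<sigma>"
proof -
  have "(\<lambda>\<zeta>::complex. \<zeta>) \<in> borel_measurable circle_borel"
    by (intro measurable_restrict_space1) auto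
  then show ?thesis
    by (simp cong: measurable_cong_sets)
qed

lemma borel_measurable_circle:
  "f \<in> borel_measurable borel \<Longrightarrow> f \<in> borel_measurable \<sigma>"
  using measurable_compose[OF measurable_circle_ident] by blast

interpretation circle: prob_space \<sigma>
  by (rule prob_spaceI) (simp add: emeasure_circle_measure_space)

lemma measurable_cis_uniform [measurable]:
  "cis \<in> uniform_measure lborel {0..2*pi} \<rightarrow>\<^sub>M circle_borel"
  using measurable_cis_circle by simp

lemma measurable_circle_cis:
  assumes "f \<in> borel_measurable \<sigma>"
  shows "(\<lambda>t. f (cis t)) \<in> borel_measurable borel"
proof -
  have "f \<in> borel_measurable circle_borel"
    using assms by (simp cong: measurable_cong_sets)
  then show ?thesis
    using measurable_cis_circle by (rule measurable_compose[rotated])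
qed

lemma measurable_cnj [measurable]: "cnj \<in> borel_measurable borel"
  by (intro borel_measurable_continuous_onI continuous_intros)

lemma integral_circle:
  fixes f :: "complex \<Rightarrow> complex"
  assumes "f \<in> borel_measurable \<sigma>"
  shows "(LINT \<zeta>|\<sigma>. f \<zeta>) =
    (LINT t|lborel. indicator {0..2*pi} t *\<^sub>R f (cis t)) / (2 * pi)"
proof -
  have f: "f \<in> borel_measurable circle_borel"
    using assms by (simp cong: measurable_cong_sets)
  have m: "(\<lambda>t. f (cis t)) \<in> borel_measurable lborel"
    using measurable_circle_cis[OF assms] by simp
  have "(LINT \<zeta>|\<sigma>. f \<zeta>) = (LINT t|uniform_measure lborel {0..2*pi}. f (cis t))"
    unfolding circle_measure_def by (rule integral_distr) (use f in auto)
  also have "\<dots> = (LINT t|density lborel (\<lambda>t. ennreal (indicator {0..2*pi} t / (2*pi))). f (cis t))"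
    unfolding uniform_measure_def
    by (intro arg_cong2[where f="integral\<^sup>L"] refl density_cong)
       (auto simp: indicator_def divide_ennreal[symmetric] ennreal_1[symmetric] simp del: ennreal_1)
  also have "\<dots> = (LINT t|lborel. (indicator {0..2*pi} t / (2*pi)) *\<^sub>R f (cis t))"
    by (rule integral_density) (use m in auto)
  also have "\<dots> = (LINT t|lborel. (1 / (2*pi)) *\<^sub>R (indicator {0..2*pi} t *\<^sub>R f (cis t)))"
    by (intro Bochner_Integration.integral_cong) auto
  also have "\<dots> = (1 / (2*pi)) *\<^sub>R (LINT t|lborel. indicator {0..2*pi} t *\<^sub>R f (cis t))"
    by (rule integral_scaleR_right)
  finally show ?thesis
    by (simp add: scaleR_conv_of_real)
qed

lemma integral_circle_power:
  assumes "n > 0"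
  shows "(LINT \<zeta>|\<sigma>. \<zeta> ^ n) = 0"
proof -
  have "(\<integral>t. indicator {0..2*pi} t *\<^sub>R cis (real n * t) \<partial>lborel)
     = cis (real n * (2*pi)) / (\<i> * n) - cis (real n * 0) / (\<i> * n)"
    by (rule integral_FTC_Icc)
       (use assms in \<open>auto intro!: derivative_eq_intros continuous_intros
          simp: has_vector_derivative_def field_simps scaleR_conv_of_real\<close>)
  also have "cis (real n * (2*pi)) = 1"
    using cis_multiple_2pi[of "real n"] by (simp add: mult_ac)
  finally have "(\<integral>t. indicator {0..2*pi} t *\<^sub>R cis (real n * t) \<partial>lborel) = 0"
    by simp
  then show ?thesis
    by (subst integral_circle) (auto simp: Complex.DeMoivre)
qed

lemma integral_circle_cnj_power:
  assumes "n > 0"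
  shows "(LINT \<zeta>|\<sigma>. cnj \<zeta> ^ n) = 0"
proof -
  have "(LINT \<zeta>|\<sigma>. cnj (\<zeta> ^ n)) = cnj (LINT \<zeta>|\<sigma>. \<zeta> ^ n)"
    by (rule Bochner_Integration.integral_cnj)
  then show ?thesis using integral_circle_power[OF assms] by simp
qed

section \<open>The Poisson kernel and its series expansion\<close>

definition poisson_kernel :: "complex \<Rightarrow> complex \<Rightarrow> real" where
  "poisson_kernel z \<zeta> = (1 - (cmod z)\<^sup>2) / (cmod (\<zeta> - z))\<^sup>2"

lemma poisson_kernel_measurable [measurable]:
  "(\<lambda>\<zeta>. poisson_kernel z \<zeta>) \<in> borel_measurable borel"
  "poisson_kernel z \<in> borel_measurable \<sigma>"
  unfolding poisson_kernel_def by measurable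

lemma poisson_kernel_nonneg: "cmod z < 1 \<Longrightarrow> 0 \<le> poisson_kernel z \<zeta>"
  by (auto simp: poisson_kernel_def abs_square_le_1 less_imp_le)

lemma poisson_ext_eq: "poisson_ext f z = (LINT \<zeta>|\<sigma>. of_real (poisson_kernel z \<zeta>) * f \<zeta>)"
  by (simp add: poisson_ext_def poisson_kernel_def)

lemma poisson_kernel_bound:
  assumes "cmod z < 1" "cmod \<zeta> = 1"
  shows "poisson_kernel z \<zeta> \<le> 1 / (1 - cmod z)\<^sup>2"
proof -
  have "1 - cmod z \<le> cmod (\<zeta> - z)" using assms norm_triangle_ineq2[of \<zeta> z] by simp
  then have "(1 - cmod z)\<^sup>2 \<le> (cmod (\<zeta> - z))\<^sup>2" using assms by (intro power_mono) auto
  then show ?thesis unfolding poisson_kernel_def using assms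
    by (intro frac_le) (auto simp: abs_square_le_1)
qed

text \<open>With \<open>w = z * cnj \<zeta>\<close> one has \<open>|\<zeta> - z| = |1 - w|\<close>,
  and the kernel is \<open>(1 - |w|^2) / |1 - w|^2 = 1 + w / (1 - w) + cnj w / (1 - cnj w)\<close>;
  two geometric series give the expansion. The constant term 1 is moved to the right, so the sum
  runs over \<open>Suc n\<close>.\<close>

lemma poisson_kernel_sums:
  assumes "cmod z < 1" "cmod \<zeta> = 1"
  shows "(\<lambda>n. (z * cnj \<zeta>) ^ Suc n + (cnj z * \<zeta>) ^ Suc n) sums (of_real (poisson_kernel z \<zeta>) - 1)"
proof -
  define w where "w = z * cnj \<zeta>"
  have w: "cmod w < 1" "cmod (cnj w) < 1" using assms by (auto simp: w_def norm_mult)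
  have ne: "1 - w \<noteq> 0" "1 - cnj w \<noteq> 0" using w by auto
  have g: "(\<lambda>n. v ^ Suc n) sums (v / (1 - v))" if "cmod v < 1" for v :: complex
    using sums_mult[OF geometric_sums[OF that], of v] by simp
  have "\<zeta> - z = \<zeta> * (1 - w)"
    using complex_norm_square[of \<zeta>] assms by (simp add: w_def algebra_simps)
  then have "(cmod (\<zeta> - z))\<^sup>2 = (cmod (1 - w))\<^sup>2" by (simp add: norm_mult assms)
  moreover have "cmod z = cmod w" by (simp add: w_def norm_mult assms)
  ultimately have "complex_of_real (poisson_kernel z \<zeta>) = (1 - w * cnj w) / ((1 - w) * (1 - cnj w))"
    using complex_norm_square[of "1 - w"] complex_norm_square[of w] by (simp add: poisson_kernel_def)
  also have "\<dots> = w / (1 - w) + cnj w / (1 - cnj w) + 1"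
    using ne by (simp add: divide_simps) (simp add: algebra_simps)
  finally have "complex_of_real (poisson_kernel z \<zeta>) - 1 = w / (1 - w) + cnj w / (1 - cnj w)"
    by simp
  then show ?thesis
    using sums_add[OF g[OF w(1)] g[OF w(2)]] by (simp add: w_def)
qed

lemma integrable_circle_bounded_mult:
  fixes f g :: "complex \<Rightarrow> complex"
  assumes f: "integrable \<sigma> f" and g[measurable]: "g \<in> borel_measurable \<sigma>"
    and b: "\<And>\<zeta>. cmod \<zeta> = 1 \<Longrightarrow> cmod (g \<zeta>) \<le> C"
  shows "integrable \<sigma> (\<lambda>\<zeta>. g \<zeta> * f \<zeta>)"
proof (rule Bochner_Integration.integrable_bound)
  show "integrable \<sigma> (\<lambda>\<zeta>. C *\<^sub>R f \<zeta>)" using f by simp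
  have [measurable]: "f \<in> borel_measurable \<sigma>" using f by auto
  show "(\<lambda>\<zeta>. g \<zeta> * f \<zeta>) \<in> borel_measurable \<sigma>" by measurable
  have "cmod (g \<zeta>) * cmod (f \<zeta>) \<le> \<bar>C\<bar> * cmod (f \<zeta>)" if "cmod \<zeta> = 1" for \<zeta>
    using b[OF that] by (intro mult_right_mono) auto
  then show "AE \<zeta> in \<sigma>. norm (g \<zeta> * f \<zeta>) \<le> norm (C *\<^sub>R f \<zeta>)"
    by (intro AE_I2) (auto simp: norm_mult)
qed

text \<open>Termwise integration of the kernel expansion, dominated by
  \<open>2 * cmod z ^ Suc n * cmod (f \<zeta>)\<close>. This Fourier form later yields the
  normalization of the kernel, the analytic completion of a real function, and the vanishing of a
  function with zero coefficients.\<close>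

lemma poisson_ext_sums:
  assumes f: "integrable \<sigma> f" and z: "cmod z < 1"
  shows "(\<lambda>n. z ^ Suc n * (LINT \<zeta>|\<sigma>. cnj \<zeta> ^ Suc n * f \<zeta>)
            + cnj z ^ Suc n * (LINT \<zeta>|\<sigma>. \<zeta> ^ Suc n * f \<zeta>))
         sums (poisson_ext f z - (LINT \<zeta>|\<sigma>. f \<zeta>))"
proof -
  let ?g = "\<lambda>n \<zeta>. ((z * cnj \<zeta>) ^ Suc n + (cnj z * \<zeta>) ^ Suc n) * f \<zeta>"
  have [measurable]: "f \<in> borel_measurable \<sigma>" using f by auto
  have b: "cmod ((z * cnj \<zeta>) ^ Suc n + (cnj z * \<zeta>) ^ Suc n) \<le> 2 * cmod z ^ Suc n"
    if "cmod \<zeta> = 1" for n \<zeta>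
    using that by (intro order_trans[OF norm_triangle_ineq]) (simp add: norm_mult norm_power)
  have int: "integrable \<sigma> (?g n)" for n
    by (rule integrable_circle_bounded_mult[OF f _ b]) auto
  have sm: "summable (\<lambda>n. 2 * cmod z ^ Suc n * c)" for c
    using z by (intro summable_mult2 summable_mult summable_ignore_initial_segment[where k=1, simplified]) 
       (auto intro: summable_geometric)
  have "(\<lambda>n. LINT \<zeta>|\<sigma>. ?g n \<zeta>) sums (LINT \<zeta>|\<sigma>. (\<Sum>n. ?g n \<zeta>))"
  proof (rule sums_integral[OF int])
    have "summable (\<lambda>n. norm (?g n \<zeta>))" if "cmod \<zeta> = 1" for \<zeta>
      by (rule summable_comparison_test'[OF sm[of "cmod (f \<zeta>)"], where N=0])
         (use b[OF that] in \<open>auto simp: norm_mult intro!: mult_right_mono\<close>)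
    then show "AE \<zeta> in \<sigma>. summable (\<lambda>n. norm (?g n \<zeta>))"
      by (intro AE_I2) auto
    show "summable (\<lambda>n. LINT \<zeta>|\<sigma>. norm (?g n \<zeta>))"
    proof (rule summable_comparison_test'[OF sm[of "LINT \<zeta>|\<sigma>. cmod (f \<zeta>)"], where N=0])
      fix n
      have "(LINT \<zeta>|\<sigma>. norm (?g n \<zeta>)) \<le> (LINT \<zeta>|\<sigma>. 2 * cmod z ^ Suc n * cmod (f \<zeta>))"
        by (intro integral_mono integrable_norm int integrable_mult_right f)
           (use b in \<open>auto simp: norm_mult intro!: mult_right_mono\<close>)
      then show "norm (LINT \<zeta>|\<sigma>. norm (?g n \<zeta>)) \<le> 2 * cmod z ^ Suc n * (LINT \<zeta>|\<sigma>. cmod (f \<zeta>))"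
        by simp
    qed
  qed
  also have "(LINT \<zeta>|\<sigma>. (\<Sum>n. ?g n \<zeta>))
      = (LINT \<zeta>|\<sigma>. of_real (poisson_kernel z \<zeta>) * f \<zeta> - f \<zeta>)"
  proof (intro Bochner_Integration.integral_cong refl)
    fix \<zeta> assume "\<zeta> \<in> space \<sigma>"
    then have "cmod \<zeta> = 1" by simp
    from sums_mult2[OF poisson_kernel_sums[OF z this], of "f \<zeta>"]
    show "(\<Sum>n. ?g n \<zeta>) = of_real (poisson_kernel z \<zeta>) * f \<zeta> - f \<zeta>"
      by (simp add: sums_iff algebra_simps)
  qed
  also have "\<dots> = poisson_ext f z - (LINT \<zeta>|\<sigma>. f \<zeta>)"
    unfolding poisson_ext_eq
    by (intro Bochner_Integration.integral_diff integrable_circle_bounded_mult[OF f] f)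
       (use poisson_kernel_bound[OF z] poisson_kernel_nonneg[OF z] in auto)
  also have "(\<lambda>n. LINT \<zeta>|\<sigma>. ?g n \<zeta>) =
      (\<lambda>n. z ^ Suc n * (LINT \<zeta>|\<sigma>. cnj \<zeta> ^ Suc n * f \<zeta>)
            + cnj z ^ Suc n * (LINT \<zeta>|\<sigma>. \<zeta> ^ Suc n * f \<zeta>))"
  proof
    fix n
    have i: "integrable \<sigma> (\<lambda>\<zeta>. cnj \<zeta> ^ Suc n * f \<zeta>)"
            "integrable \<sigma> (\<lambda>\<zeta>. \<zeta> ^ Suc n * f \<zeta>)"
      by (rule integrable_circle_bounded_mult[OF f, where C=1]; auto simp: norm_mult norm_power)+
    have "(LINT \<zeta>|\<sigma>. ?g n \<zeta>) = (LINT \<zeta>|\<sigma>. 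
         z ^ Suc n * (cnj \<zeta> ^ Suc n * f \<zeta>) + cnj z ^ Suc n * (\<zeta> ^ Suc n * f \<zeta>))"
      by (intro Bochner_Integration.integral_cong refl) (simp add: algebra_simps power_mult_distrib)
    then show "(LINT \<zeta>|\<sigma>. ?g n \<zeta>) = z ^ Suc n * (LINT \<zeta>|\<sigma>. cnj \<zeta> ^ Suc n * f \<zeta>)
            + cnj z ^ Suc n * (LINT \<zeta>|\<sigma>. \<zeta> ^ Suc n * f \<zeta>)"
      using i by (simp del: power_Suc)
  qed
  finally show ?thesis .
qed

text \<open>Orthogonality of the powers leaves only the constant term; in particular the kernel has
  total mass 1.\<close>

lemma poisson_ext_const:
  assumes "cmod z < 1"
  shows "poisson_ext (\<lambda>_. c) z = c"
proof -
  have "(\<lambda>n. 0) sums (poisson_ext (\<lambda>_. c) z - c)"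
    using poisson_ext_sums[OF _ assms, of "\<lambda>_. c"]
    by (simp add: integral_circle_power[of "Suc _", simplified] integral_circle_cnj_power[of "Suc _", simplified]
        circle.prob_space[simplified])
  then show ?thesis
    using sums_0 sums_unique2 by fastforce
qed

lemma integrable_poisson_kernel:
  assumes "cmod z < 1"
  shows "integrable \<sigma> (poisson_kernel z)"
  by (rule circle.integrable_const_bound[where B="1 / (1 - cmod z)\<^sup>2"])
     (use poisson_kernel_bound[OF assms] poisson_kernel_nonneg[OF assms] in auto)

lemma integral_poisson_kernel:
  assumes "cmod z < 1"
  shows "(LINT \<zeta>|\<sigma>. poisson_kernel z \<zeta>) = 1"
proof -
  have "complex_of_real (LINT \<zeta>|\<sigma>. poisson_kernel z \<zeta>) = poisson_ext (\<lambda>_. 1) z"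
    by (simp add: poisson_ext_eq del: of_real_power)
  then show ?thesis using poisson_ext_const[OF assms, of 1] by simp
qed

lemma nn_integral_poisson_kernel:
  assumes "cmod z < 1"
  shows "(\<integral>\<^sup>+ \<zeta>. ennreal (poisson_kernel z \<zeta>) \<partial>\<sigma>) = 1"
  using nn_integral_eq_integral[OF integrable_poisson_kernel[OF assms]]
    integral_poisson_kernel[OF assms] poisson_kernel_nonneg[OF assms] by simp

section \<open>Non-tangential limits and local Dirichlet integrals\<close>

lemma emeasure_circle:
  assumes "A \<in> sets \<sigma>"
  shows "emeasure \<sigma> A = emeasure lborel ({0..2*pi} \<inter> cis -` A) / ennreal (2*pi)"
proof -
  have A: "A \<in> sets circle_borel" using assms by simp
  have v: "cis -` A \<in> sets lborel"
    using measurable_sets[OF measurable_cis_circle A] by simp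
  have "emeasure \<sigma> A = emeasure (uniform_measure lborel {0..2*pi}) (cis -` A)"
    unfolding circle_measure_def using A by (subst emeasure_distr) auto
  then show ?thesis using v by (simp add: ennreal_mult)
qed

lemma countable_cis_vimage: "countable (cis -` {\<xi>})"
proof (cases "\<exists>s. cis s = \<xi>")
  case True
  then obtain s where s: "cis s = \<xi>" by blast
  have "cis -` {\<xi>} \<subseteq> range (\<lambda>n::int. s + 2 * pi * of_int n)"
  proof
    fix t assume "t \<in> cis -` {\<xi>}"
    then have "sin t = sin s \<and> cos t = cos s" using s by (auto simp: complex_eq_iff)
    then show "t \<in> range (\<lambda>n::int. s + 2 * pi * of_int n)"
      using sin_cos_eq_iff[of t s] by auto
  qed
  then show ?thesis by (rule countable_subset) auto
next
  case False
  then have "cis -` {\<xi>} = {}" by auto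
  then show ?thesis by simp
qed

text \<open>Quotients by \<open>\<zeta> - \<xi>\<close> have the default value 0 at
  \<open>\<zeta> = \<xi>\<close>; as single points are null sets, this value does not affect any
  integral.\<close>

lemma AE_circle_neq: "AE \<zeta> in \<sigma>. \<zeta> \<noteq> \<xi>"
proof -
  have "{\<xi>} \<inter> unit_circle \<in> sets borel"
    by (intro borel_closed closed_Int) auto
  then have "{\<xi>} \<inter> unit_circle \<in> sets \<sigma>"
    by (simp add: sets_restrict_space_iff)
  moreover have "emeasure \<sigma> ({\<xi>} \<inter> unit_circle) = 0"
  proof (subst emeasure_circle)
    show "{\<xi>} \<inter> unit_circle \<in> sets \<sigma>" by fact
    have "countable ({0..2*pi} \<inter> cis -` ({\<xi>} \<inter> unit_circle))"
      by (rule countable_subset[OF _ countable_cis_vimage[of \<xi>]]) auto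
    then show "emeasure lborel ({0..2*pi} \<inter> cis -` ({\<xi>} \<inter> unit_circle)) / ennreal (2*pi) = 0"
      by (simp add: emeasure_lborel_countable)
  qed
  ultimately have "{\<xi>} \<inter> unit_circle \<in> null_sets \<sigma>" by auto
  from AE_not_in[OF this] show ?thesis
    by (rule AE_mp) (auto intro!: AE_I2)
qed

lemma Cauchy_Schwarz_nn_integral_real:
  fixes u v :: "'a \<Rightarrow> real"
  assumes [measurable]: "u \<in> borel_measurable M" "v \<in> borel_measurable M"
    and "\<And>x. x \<in> space M \<Longrightarrow> 0 \<le> u x" "\<And>x. x \<in> space M \<Longrightarrow> 0 \<le> v x"
  shows "(\<integral>\<^sup>+ x. ennreal (u x * v x) \<partial>M)\<^sup>2
    \<le> (\<integral>\<^sup>+ x. ennreal ((u x)\<^sup>2) \<partial>M) * (\<integral>\<^sup>+ x. ennreal ((v x)\<^sup>2) \<partial>M)"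
proof -
  have "(\<integral>\<^sup>+ x. ennreal (u x) * ennreal (v x) \<partial>M)\<^sup>2
    \<le> (\<integral>\<^sup>+ x. (ennreal (u x))\<^sup>2 \<partial>M) * (\<integral>\<^sup>+ x. (ennreal (v x))\<^sup>2 \<partial>M)"
    by (rule Cauchy_Schwarz_nn_integral) auto
  then show ?thesis
    by (simp add: ennreal_mult ennreal_power assms cong: nn_integral_cong)
qed

text \<open>The value \<open>l\<close> at \<xi> is a free parameter, so energies can be estimated
  before a boundary value is known. The set \<open>S\<close> restricts \<zeta> only; \<xi> may lie
  anywhere.\<close>

definition dirichlet_on :: "complex set \<Rightarrow> complex \<Rightarrow> (complex \<Rightarrow> complex) \<Rightarrow> complex \<Rightarrow> ennreal" where
  "dirichlet_on S \<xi> f l =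
     (\<integral>\<^sup>+ \<zeta>. abs2 ((f \<zeta> - l) / (\<zeta> - \<xi>)) * indicator S \<zeta> \<partial>\<sigma>)"

abbreviation "dirichlet_at \<equiv> dirichlet_on UNIV"

lemma dirichlet_at_eq:
  "dirichlet_at \<xi> f l = (\<integral>\<^sup>+ \<zeta>. abs2 ((f \<zeta> - l) / (\<zeta> - \<xi>)) \<partial>\<sigma>)"
  by (simp add: dirichlet_on_def)

lemma poisson_ext_diff:
  assumes "integrable \<sigma> f" "integrable \<sigma> g" "cmod z < 1"
  shows "poisson_ext (\<lambda>\<zeta>. f \<zeta> - g \<zeta>) z = poisson_ext f z - poisson_ext g z"
  unfolding poisson_ext_eq right_diff_distrib
  by (intro Bochner_Integration.integral_diff integrable_circle_bounded_mult assms)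
     (use poisson_kernel_bound[OF assms(3)] poisson_kernel_nonneg[OF assms(3)] in auto)

text \<open>Constants are reproduced by the Poisson integral, so \<open>l\<close> can be moved under
  the integral.\<close>

lemma norm_poisson_ext_le:
  assumes f: "integrable \<sigma> f" and z: "cmod z < 1"
  shows "ennreal (cmod (poisson_ext f z - l))
    \<le> (\<integral>\<^sup>+ \<zeta>. ennreal (poisson_kernel z \<zeta> * cmod (f \<zeta> - l)) \<partial>\<sigma>)"
proof -
  have "poisson_ext f z - l = poisson_ext (\<lambda>\<zeta>. f \<zeta> - l) z"
    using poisson_ext_diff[OF f _ z, of "\<lambda>_. l"] poisson_ext_const[OF z, of l] by simp
  also have "ennreal (cmod \<dots>) \<le>
      (\<integral>\<^sup>+ \<zeta>. ennreal (cmod (of_real (poisson_kernel z \<zeta>) * (f \<zeta> - l))) \<partial>\<sigma>)"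
    unfolding poisson_ext_eq
    by (intro integral_norm_bound_ennreal integrable_circle_bounded_mult Bochner_Integration.integrable_diff f)
       (use poisson_kernel_bound[OF z] poisson_kernel_nonneg[OF z] in auto)
  also have "\<dots> = (\<integral>\<^sup>+ \<zeta>. ennreal (poisson_kernel z \<zeta> * cmod (f \<zeta> - l)) \<partial>\<sigma>)"
    using poisson_kernel_nonneg[OF z] by (simp add: norm_mult)
  finally show ?thesis .
qed

text \<open>Cauchy-Schwarz after splitting the kernel into two square roots; the kernel has integral
  1.\<close>

lemma poisson_ext_Jensen:
  assumes f: "integrable \<sigma> f" and z: "cmod z < 1"
  shows "abs2 (poisson_ext f z - l)
    \<le> (\<integral>\<^sup>+ \<zeta>. ennreal (poisson_kernel z \<zeta> * (cmod (f \<zeta> - l))\<^sup>2) \<partial>\<sigma>)"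
proof -
  have [measurable]: "f \<in> borel_measurable \<sigma>" using f by auto
  note pos = poisson_kernel_nonneg[OF z]
  have sq: "sqrt (poisson_kernel z \<zeta>) * (sqrt (poisson_kernel z \<zeta>) * c) = poisson_kernel z \<zeta> * c" for \<zeta> c
    using pos[of \<zeta>] by (metis abs_of_nonneg mult.assoc real_sqrt_mult_self)
  have "abs2 (poisson_ext f z - l) = (ennreal (cmod (poisson_ext f z - l)))\<^sup>2"
    by (simp add: ennreal_power)
  also have "\<dots> \<le> (\<integral>\<^sup>+ \<zeta>. ennreal (poisson_kernel z \<zeta> * cmod (f \<zeta> - l)) \<partial>\<sigma>)\<^sup>2"
    by (intro power_mono norm_poisson_ext_le f z) simp
  also have "\<dots> = (\<integral>\<^sup>+ \<zeta>. ennreal (sqrt (poisson_kernel z \<zeta>) * (sqrt (poisson_kernel z \<zeta>) * cmod (f \<zeta> - l))) \<partial>\<sigma>)\<^sup>2"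
    unfolding sq ..
  also have "\<dots> \<le> (\<integral>\<^sup>+ \<zeta>. ennreal ((sqrt (poisson_kernel z \<zeta>))\<^sup>2) \<partial>\<sigma>) *
      (\<integral>\<^sup>+ \<zeta>. ennreal ((sqrt (poisson_kernel z \<zeta>) * cmod (f \<zeta> - l))\<^sup>2) \<partial>\<sigma>)"
    using pos by (intro Cauchy_Schwarz_nn_integral_real) auto
  also have "\<dots> = (\<integral>\<^sup>+ \<zeta>. ennreal (poisson_kernel z \<zeta> * (cmod (f \<zeta> - l))\<^sup>2) \<partial>\<sigma>)"
    using pos nn_integral_poisson_kernel[OF z] by (simp add: power_mult_distrib)
  finally show ?thesis .
qed

text \<open>In a Stolz angle \<open>\<bar>\<zeta> - \<xi>\<bar> \<le> (1 + \<alpha>) \<bar>\<zeta> - z\<bar>\<close>, so the Poisson kernel gains a factor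
  that vanishes at the boundary once the quotient \<open>(f \<zeta> - l) / (\<zeta> - \<xi>)\<close> is square integrable.\<close>
lemma poisson_ext_stolz:
  assumes f: "integrable \<sigma> f" and z: "z \<in> stolz_region \<alpha> \<xi>" and \<alpha>: "\<alpha> > 0"
  shows "abs2 (poisson_ext f z - l)
    \<le> ennreal ((1 + \<alpha>)\<^sup>2 * (1 - (cmod z)\<^sup>2)) * dirichlet_at \<xi> f l"
proof -
  have z1: "cmod z < 1" and z2: "cmod (z - \<xi>) < \<alpha> * (1 - cmod z)"
    using z by (auto simp: stolz_region_def)
  have [measurable]: "f \<in> borel_measurable \<sigma>" using f by auto
  note pos = poisson_kernel_nonneg[OF z1]
  have zsq: "0 \<le> 1 - (cmod z)\<^sup>2" using z1 by (simp add: abs_square_le_1 less_imp_le)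
  have "abs2 (poisson_ext f z - l) = (ennreal (cmod (poisson_ext f z - l)))\<^sup>2"
    by (simp add: ennreal_power)
  also have "\<dots> \<le> (\<integral>\<^sup>+ \<zeta>. ennreal (poisson_kernel z \<zeta> * cmod (f \<zeta> - l)) \<partial>\<sigma>)\<^sup>2"
    by (intro power_mono norm_poisson_ext_le f z1) simp
  also have "(\<integral>\<^sup>+ \<zeta>. ennreal (poisson_kernel z \<zeta> * cmod (f \<zeta> - l)) \<partial>\<sigma>)
     = (\<integral>\<^sup>+ \<zeta>. ennreal ((poisson_kernel z \<zeta> * cmod (\<zeta> - \<xi>)) * cmod ((f \<zeta> - l) / (\<zeta> - \<xi>))) \<partial>\<sigma>)"
    by (rule nn_integral_cong_AE, rule eventually_mono[OF AE_circle_neq[of \<xi>]]) (auto simp: norm_divide)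
  also have "\<dots>\<^sup>2 \<le> (\<integral>\<^sup>+ \<zeta>. ennreal ((poisson_kernel z \<zeta> * cmod (\<zeta> - \<xi>))\<^sup>2) \<partial>\<sigma>) * dirichlet_at \<xi> f l"
    unfolding dirichlet_at_eq using pos by (intro Cauchy_Schwarz_nn_integral_real) auto
  also have "\<dots> \<le> ennreal ((1 + \<alpha>)\<^sup>2 * (1 - (cmod z)\<^sup>2)) * dirichlet_at \<xi> f l"
  proof (intro mult_right_mono)
    have "(\<integral>\<^sup>+ \<zeta>. ennreal ((poisson_kernel z \<zeta> * cmod (\<zeta> - \<xi>))\<^sup>2) \<partial>\<sigma>)
      \<le> (\<integral>\<^sup>+ \<zeta>. ennreal ((1 + \<alpha>)\<^sup>2 * (1 - (cmod z)\<^sup>2)) * ennreal (poisson_kernel z \<zeta>) \<partial>\<sigma>)"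
    proof (intro nn_integral_mono)
      fix \<zeta> assume "\<zeta> \<in> space \<sigma>"
      then have \<zeta>: "cmod \<zeta> = 1" by simp
      have d: "1 - cmod z \<le> cmod (\<zeta> - z)" using norm_triangle_ineq2[of \<zeta> z] \<zeta> by simp
      then have d0: "cmod (\<zeta> - z) > 0" using z1 by linarith
      have "cmod (\<zeta> - \<xi>) \<le> cmod (\<zeta> - z) + cmod (z - \<xi>)"
        using norm_triangle_ineq[of "\<zeta> - z" "z - \<xi>"] by simp
      also have "\<dots> \<le> cmod (\<zeta> - z) + \<alpha> * cmod (\<zeta> - z)"
        using z2 d \<alpha> mult_left_mono[OF d, of \<alpha>] by linarith
      finally have "cmod (\<zeta> - \<xi>) \<le> (1 + \<alpha>) * cmod (\<zeta> - z)" by (simp add: algebra_simps)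
      then have "(cmod (\<zeta> - \<xi>))\<^sup>2 \<le> (1 + \<alpha>)\<^sup>2 * (cmod (\<zeta> - z))\<^sup>2"
        by (metis norm_ge_zero power_mono power_mult_distrib)
      then have "(poisson_kernel z \<zeta>)\<^sup>2 * (cmod (\<zeta> - \<xi>))\<^sup>2 \<le> (poisson_kernel z \<zeta>)\<^sup>2 * ((1 + \<alpha>)\<^sup>2 * (cmod (\<zeta> - z))\<^sup>2)"
        by (intro mult_left_mono) auto
      also have "\<dots> = (1 + \<alpha>)\<^sup>2 * (1 - (cmod z)\<^sup>2) * poisson_kernel z \<zeta>"
        using d0 by (simp add: poisson_kernel_def power2_eq_square)
      finally have "(poisson_kernel z \<zeta> * cmod (\<zeta> - \<xi>))\<^sup>2 \<le> (1 + \<alpha>)\<^sup>2 * (1 - (cmod z)\<^sup>2) * poisson_kernel z \<zeta>"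
        by (simp add: power_mult_distrib)
      then show "ennreal ((poisson_kernel z \<zeta> * cmod (\<zeta> - \<xi>))\<^sup>2) \<le>
        ennreal ((1 + \<alpha>)\<^sup>2 * (1 - (cmod z)\<^sup>2)) * ennreal (poisson_kernel z \<zeta>)"
        using zsq pos by (simp flip: ennreal_mult)
    qed
    also have "\<dots> = ennreal ((1 + \<alpha>)\<^sup>2 * (1 - (cmod z)\<^sup>2))"
      by (subst nn_integral_cmult) (auto simp: nn_integral_poisson_kernel[OF z1])
    finally show "(\<integral>\<^sup>+ \<zeta>. ennreal ((poisson_kernel z \<zeta> * cmod (\<zeta> - \<xi>))\<^sup>2) \<partial>\<sigma>)
      \<le> ennreal ((1 + \<alpha>)\<^sup>2 * (1 - (cmod z)\<^sup>2))" .
  qed simp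
  finally show ?thesis .
qed

text \<open>The Stolz bound carries the factor \<open>1 - (cmod z)^2\<close>, which tends to 0 at
  the boundary. Hence any \<open>l\<close> with a finite quotient integral is the non-tangential
  limit: a candidate value is verified by a norm estimate alone.\<close>

lemma has_nt_limit_if_dirichlet_finite:
  assumes f: "integrable \<sigma> f" and \<xi>: "cmod \<xi> = 1" and D: "dirichlet_at \<xi> f l < \<infinity>"
  shows "has_nt_limit (poisson_ext f) \<xi> l"
  unfolding has_nt_limit_def
proof (intro allI impI)
  fix \<alpha> :: real assume \<alpha>: "\<alpha> > 1"
  obtain K where K: "dirichlet_at \<xi> f l = ennreal K" "K \<ge> 0"
    using D by (cases "dirichlet_at \<xi> f l") auto
  have le: "cmod (poisson_ext f z - l) \<le> sqrt ((1 + \<alpha>)\<^sup>2 * (1 - (cmod z)\<^sup>2) * K)"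
    if "z \<in> stolz_region \<alpha> \<xi>" for z
  proof (rule real_le_rsqrt)
    have "0 \<le> 1 - (cmod z)\<^sup>2" using that by (auto simp: stolz_region_def abs_square_le_1)
    then have p: "0 \<le> (1 + \<alpha>)\<^sup>2 * (1 - (cmod z)\<^sup>2)" by simp
    have "abs2 (poisson_ext f z - l) \<le> ennreal ((1 + \<alpha>)\<^sup>2 * (1 - (cmod z)\<^sup>2) * K)"
      using poisson_ext_stolz[OF f that, of l] \<alpha> K(2) p unfolding K(1) ennreal_mult[OF p K(2)] by simp
    then show "(cmod (poisson_ext f z - l))\<^sup>2 \<le> (1 + \<alpha>)\<^sup>2 * (1 - (cmod z)\<^sup>2) * K"
      using p K(2) by (simp add: ennreal_le_iff)
  qed
  have "((\<lambda>z. sqrt ((1 + \<alpha>)\<^sup>2 * (1 - (cmod z)\<^sup>2) * K)) \<longlongrightarrow> sqrt ((1 + \<alpha>)\<^sup>2 * (1 - (cmod \<xi>)\<^sup>2) * K))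
      (at \<xi> within stolz_region \<alpha> \<xi>)"
    by (intro tendsto_real_sqrt tendsto_mult tendsto_diff tendsto_power tendsto_norm tendsto_ident_at tendsto_const)
  then have "((\<lambda>z. poisson_ext f z - l) \<longlongrightarrow> 0) (at \<xi> within stolz_region \<alpha> \<xi>)"
    using \<xi> le
    by (auto simp: eventually_at_filter
        intro: Lim_null_comparison[where g="\<lambda>z. sqrt ((1 + \<alpha>)\<^sup>2 * (1 - (cmod z)\<^sup>2) * K)"])
  then show "(poisson_ext f \<longlongrightarrow> l) (at \<xi> within stolz_region \<alpha> \<xi>)"
    by (simp add: LIM_zero_iff)
qed

text \<open>Since \<open>|r * \<xi> - \<xi>| = 1 - r\<close>, the radius stays inside the Stolz
  region of aperture 2.\<close>

lemma has_nt_limit_radial: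
  assumes "has_nt_limit u \<xi> l" and \<xi>: "cmod \<xi> = 1"
    and r: "\<And>k. 0 \<le> r k" "\<And>k. r k < 1" "r \<longlonglongrightarrow> 1"
  shows "(\<lambda>k. u (of_real (r k) * \<xi>)) \<longlonglongrightarrow> l"
proof -
  have u: "(u \<longlongrightarrow> l) (at \<xi> within stolz_region 2 \<xi>)"
    using assms(1) unfolding has_nt_limit_def by (elim allE[of _ 2]) simp
  have d: "cmod (of_real (r k) * \<xi> - \<xi>) = 1 - r k" for k
  proof -
    have "of_real (r k) * \<xi> - \<xi> = of_real (r k - 1) * \<xi>" by (simp add: algebra_simps)
    then have "cmod (of_real (r k) * \<xi> - \<xi>) = \<bar>r k - 1\<bar> * cmod \<xi>"
      by (metis norm_mult norm_of_real)
    then show ?thesis using \<xi> r(2)[of k] by simp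
  qed
  have s: "of_real (r k) * \<xi> \<in> stolz_region 2 \<xi>" for k
    using d[of k] \<xi> r(1,2)[of k] by (simp add: stolz_region_def norm_mult)
  have ne: "of_real (r k) * \<xi> \<noteq> \<xi>" for k
    using d[of k] r(2)[of k] by auto
  have "(\<lambda>k. of_real (r k) * \<xi>) \<longlonglongrightarrow> \<xi>"
    using tendsto_mult[OF tendsto_of_real[OF r(3)] tendsto_const[of \<xi>]] by simp
  moreover have "\<forall>\<^sub>F k in sequentially. of_real (r k) * \<xi> \<in> stolz_region 2 \<xi> \<and> of_real (r k) * \<xi> \<noteq> \<xi>"
    by (rule always_eventually) (use s ne in blast)
  ultimately have "filterlim (\<lambda>k. of_real (r k) * \<xi>) (at \<xi> within stolz_region 2 \<xi>) sequentially"
    unfolding filterlim_at by blast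
  then show ?thesis by (rule filterlim_compose[OF u])
qed

definition radius_seq :: "nat \<Rightarrow> real" where
  "radius_seq k = 1 - inverse (real (Suc k))"

lemma radius_seq: "0 \<le> radius_seq k" "radius_seq k < 1" "radius_seq \<longlonglongrightarrow> 1"
proof -
  show "0 \<le> radius_seq k" "radius_seq k < 1" by (auto simp: radius_seq_def field_simps)
  show "radius_seq \<longlonglongrightarrow> 1"
    using LIMSEQ_inverse_real_of_nat_add_minus[of 1] unfolding radius_seq_def by simp
qed

text \<open>A limit along one countable sequence of radii is total and measurable in \<xi> by
  construction. It stands in for \<open>nt_value\<close> in integrals over \<xi> and agrees with it
  wherever the non-tangential limit exists.\<close>

definition boundary_value :: "(complex \<Rightarrow> complex) \<Rightarrow> complex \<Rightarrow> complex" where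
  "boundary_value f \<xi> = lim (\<lambda>k. poisson_ext f (of_real (radius_seq k) * \<xi>))"

lemma boundary_value_eq:
  assumes "has_nt_limit (poisson_ext f) \<xi> l" "cmod \<xi> = 1"
  shows "boundary_value f \<xi> = l"
  unfolding boundary_value_def
  by (rule limI) (rule has_nt_limit_radial[OF assms radius_seq])

lemma nt_value_eq:
  assumes "has_nt_limit (poisson_ext f) \<xi> l" "cmod \<xi> = 1"
  shows "nt_value f \<xi> = l"
  unfolding nt_value_def
proof (rule the_equality)
  show "has_nt_limit (poisson_ext f) \<xi> l" by fact
  show "l' = l" if "has_nt_limit (poisson_ext f) \<xi> l'" for l'
    using boundary_value_eq[OF that assms(2)] boundary_value_eq[OF assms] by simp
qed

text \<open>If the right side is finite, \<open>l\<close> is the non-tangential limit and both sides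
  agree; otherwise the bound is trivial. Upper bounds for the energies of test functions rest on
  this, with a convenient \<open>l\<close> at each \<xi>.\<close>

lemma local_dirichlet_le:
  assumes f: "integrable \<sigma> f" and \<xi>: "cmod \<xi> = 1"
  shows "local_dirichlet \<xi> f \<le> dirichlet_at \<xi> f l"
proof (cases "dirichlet_at \<xi> f l < \<infinity>")
  case True
  from has_nt_limit_if_dirichlet_finite[OF f \<xi> True]
  have "has_nt_limit (poisson_ext f) \<xi> l" .
  with nt_value_eq[OF this \<xi>] show ?thesis
    by (auto simp: local_dirichlet_def dirichlet_at_eq)
next
  case False
  then have "dirichlet_at \<xi> f l = top"
    by (metis infinity_ennreal_def top.not_eq_extremum)
  then show ?thesis by (metis top_greatest)
qed

text \<open>Where no non-tangential limit exists, the right side is infinite for every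
  \<open>l\<close>, in agreement with the convention in \<open>local_dirichlet\<close>. This makes
  the local integral measurable in \<xi>.\<close>

lemma local_dirichlet_eq:
  assumes f: "integrable \<sigma> f" and \<xi>: "cmod \<xi> = 1"
  shows "local_dirichlet \<xi> f = dirichlet_at \<xi> f (boundary_value f \<xi>)"
proof (cases "\<exists>l. has_nt_limit (poisson_ext f) \<xi> l")
  case True
  then obtain l where "has_nt_limit (poisson_ext f) \<xi> l" by blast
  with nt_value_eq[OF this \<xi>] boundary_value_eq[OF this \<xi>] show ?thesis
    by (auto simp: local_dirichlet_def dirichlet_at_eq)
next
  case False
  then have "\<not> dirichlet_at \<xi> f (boundary_value f \<xi>) < \<infinity>"
    using has_nt_limit_if_dirichlet_finite[OF f \<xi>] by blast
  then have "dirichlet_at \<xi> f (boundary_value f \<xi>) = top"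
    by (metis infinity_ennreal_def top.not_eq_extremum)
  moreover have "local_dirichlet \<xi> f = top"
    unfolding local_dirichlet_def using False by auto
  ultimately show ?thesis by metis
qed

lemma poisson_ext_measurable:
  assumes [measurable]: "f \<in> borel_measurable \<sigma>"
  shows "poisson_ext f \<in> borel_measurable borel"
  unfolding poisson_ext_def by measurable

lemma boundary_value_measurable:
  assumes "f \<in> borel_measurable \<sigma>"
  shows "boundary_value f \<in> borel_measurable \<sigma>"
proof -
  note [measurable] = poisson_ext_measurable[OF assms]
  show ?thesis unfolding boundary_value_def by measurable
qed

lemma dirichlet_at_measurable:
  assumes [measurable]: "f \<in> borel_measurable \<sigma>" "F \<in> borel_measurable \<sigma>"
  shows "(\<lambda>\<xi>. dirichlet_at \<xi> f (F \<xi>)) \<in> borel_measurable \<sigma>"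
  unfolding dirichlet_at_eq by measurable

section \<open>Density of Lipschitz functions\<close>

lemma lipschitz_measurable_circle:
  fixes h :: "complex \<Rightarrow> complex"
  assumes "C-lipschitz_on UNIV h"
  shows "h \<in> borel_measurable \<sigma>"
  using borel_measurable_continuous_onI[OF lipschitz_on_continuous_on[OF assms]]
  by (rule borel_measurable_circle)

lemma lipschitz_bounded_circle:
  fixes h :: "complex \<Rightarrow> complex"
  assumes "C-lipschitz_on UNIV h" "cmod \<zeta> = 1"
  shows "cmod (h \<zeta>) \<le> cmod (h 0) + C"
  using lipschitz_onD[OF assms(1), of \<zeta> 0] assms(2) norm_triangle_ineq2[of "h \<zeta>" "h 0"]
  by (simp add: dist_norm)

lemma lipschitz_integrable_circle:
  fixes h :: "complex \<Rightarrow> complex"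
  assumes "C-lipschitz_on UNIV h"
  shows "integrable \<sigma> h"
  by (rule circle.integrable_const_bound[where B="cmod (h 0) + C"])
     (use lipschitz_bounded_circle[OF assms] lipschitz_measurable_circle[OF assms] in auto)

text \<open>The tents \<open>max 0 (1 - n * infdist \<zeta> K)\<close> are
  \<open>n\<close>-Lipschitz and tend to the indicator because \<open>K\<close> is closed; dominated
  convergence does the rest. The empty set is treated apart because \<open>infdist\<close> to it is
  0 by convention.\<close>

lemma lipschitz_dense_closed:
  assumes K: "closed K" and e: "(0::real) < e"
  shows "\<exists>h C. C-lipschitz_on UNIV h \<and>
    (LINT \<zeta>|\<sigma>. cmod (of_real (indicator K \<zeta>) - h \<zeta>)) < e"
proof (cases "K = {}")
  case True
  then show ?thesis using e
    by (intro exI[of _ "\<lambda>_. 0"] exI[of _ 0]) (auto intro: lipschitz_onI)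
next
  case False
  define h where "h n \<zeta> = complex_of_real (max 0 (1 - real n * infdist \<zeta> K))" for n \<zeta>
  have lip: "(real n)-lipschitz_on UNIV (h n)" for n
  proof (rule lipschitz_onI)
    fix x y :: complex
    have "\<bar>real n * infdist x K - real n * infdist y K\<bar> \<le> real n * dist x y"
      using infdist_triangle_abs[of x K y] by (metis abs_mult abs_of_nat mult_left_mono of_nat_0_le_iff right_diff_distrib)
    then show "dist (h n x) (h n y) \<le> real n * dist x y"
      unfolding h_def dist_of_real dist_real_def by linarith
  qed simp
  have [measurable]: "h n \<in> borel_measurable \<sigma>" for n
    by (rule lipschitz_measurable_circle[OF lip])
  have [measurable]: "(\<lambda>\<zeta>. complex_of_real (indicator K \<zeta>)) \<in> borel_measurable \<sigma>"
    by (rule borel_measurable_circle) (use borel_closed[OF K] in measurable)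
  have lim: "(\<lambda>n. h n \<zeta>) \<longlonglongrightarrow> of_real (indicator K \<zeta>)" for \<zeta>
  proof (cases "\<zeta> \<in> K")
    case True
    then show ?thesis by (simp add: h_def)
  next
    case nK: False
    then have d: "infdist \<zeta> K > 0"
      using in_closed_iff_infdist_zero[OF K False, of \<zeta>] infdist_nonneg[of \<zeta> K] by linarith
    obtain N :: nat where N: "inverse (infdist \<zeta> K) < real N" using reals_Archimedean2 by blast
    have "h n \<zeta> = 0" if "n \<ge> N" for n
    proof -
      have "inverse (infdist \<zeta> K) \<le> real n" using N that by linarith
      then have "1 \<le> real n * infdist \<zeta> K" using d by (simp add: field_simps)
      then show ?thesis by (simp add: h_def)
    qed
    then have "(\<lambda>n. h n \<zeta>) \<longlonglongrightarrow> 0"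
      by (intro tendsto_eventually) (auto simp: eventually_sequentially)
    then show ?thesis using nK by simp
  qed
  have "(\<lambda>n. LINT \<zeta>|\<sigma>. cmod (of_real (indicator K \<zeta>) - h n \<zeta>))
      \<longlonglongrightarrow> (LINT \<zeta>|\<sigma>. 0)"
  proof (rule integral_dominated_convergence[where w="\<lambda>_. 2"])
    show "AE \<zeta> in \<sigma>. (\<lambda>n. cmod (of_real (indicator K \<zeta>) - h n \<zeta>)) \<longlonglongrightarrow> 0"
    proof (rule AE_I2)
      fix \<zeta>
      from tendsto_norm[OF tendsto_diff[OF tendsto_const[of "complex_of_real (indicator K \<zeta>)"] lim[of \<zeta>]]]
      show "(\<lambda>n. cmod (of_real (indicator K \<zeta>) - h n \<zeta>)) \<longlonglongrightarrow> 0" by simp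
    qed
    have "cmod (of_real (indicator K \<zeta>) - h n \<zeta>) \<le> 2" for n \<zeta>
    proof -
      have "cmod (h n \<zeta>) \<le> 1" using infdist_nonneg[of \<zeta> K] by (auto simp: h_def norm_of_real)
      moreover have "cmod (of_real (indicator K \<zeta>)) \<le> 1" by (auto simp: indicator_def)
      ultimately show ?thesis using norm_triangle_ineq4[of "of_real (indicator K \<zeta>)" "h n \<zeta>"] by linarith
    qed
    then show "AE \<zeta> in \<sigma>. norm (cmod (of_real (indicator K \<zeta>) - h n \<zeta>)) \<le> 2" for n
      by simp
  qed auto
  then have "\<forall>\<^sub>F n in sequentially. (LINT \<zeta>|\<sigma>. cmod (of_real (indicator K \<zeta>) - h n \<zeta>)) < e"
    using e by (auto dest: order_tendstoD)
  then obtain n where "(LINT \<zeta>|\<sigma>. cmod (of_real (indicator K \<zeta>) - h n \<zeta>)) < e"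
    by (auto simp: eventually_sequentially)
  with lip show ?thesis by blast
qed

text \<open>Inner regularity by compact sets. The measure is first pushed to a Borel measure on the
  plane, the setting of \<open>inner_regular\<close>.\<close>

lemma lipschitz_dense_sets:
  assumes A: "A \<in> sets \<sigma>" and e: "(0::real) < e"
  shows "\<exists>h C. C-lipschitz_on UNIV h \<and>
    (LINT \<zeta>|\<sigma>. cmod (of_real (indicator A \<zeta>) - h \<zeta>)) < e"
proof -
  define N where "N = distr \<sigma> borel (\<lambda>\<zeta>. \<zeta>)"
  interpret N: prob_space N unfolding N_def by (rule circle.prob_space_distr) simp
  have sA: "A \<in> sets borel" "A \<subseteq> unit_circle" using A by (auto simp: sets_restrict_space_iff)
  have eN: "emeasure N B = emeasure \<sigma> (B \<inter> unit_circle)" if "B \<in> sets borel" for B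
    using that unfolding N_def by (subst emeasure_distr) auto
  have fin: "emeasure N B \<noteq> top" for B using N.emeasure_finite by simp
  have sup: "emeasure N A = (SUP K\<in>{K. K \<subseteq> A \<and> compact K}. emeasure N K)"
    by (rule inner_regular) (use fin in \<open>auto simp: N_def sA\<close>)
  have "\<exists>K. K \<subseteq> A \<and> compact K \<and> emeasure N A < emeasure N K + ennreal (e/2)"
  proof (rule ccontr)
    assume "\<not> ?thesis"
    then have "emeasure N K + ennreal (e/2) \<le> emeasure N A" if "K \<subseteq> A" "compact K" for K
      using that by (meson not_le)
    then have "(SUP K\<in>{K. K \<subseteq> A \<and> compact K}. emeasure N K + ennreal (e/2)) \<le> emeasure N A"
      by (intro SUP_least) auto
    also have "(SUP K\<in>{K. K \<subseteq> A \<and> compact K}. emeasure N K + ennreal (e/2)) = emeasure N A + ennreal (e/2)"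
      unfolding sup by (rule ennreal_SUP_add_left) auto
    finally have "emeasure N A + ennreal (e/2) \<le> emeasure N A" .
    then have "ennreal (circle.prob A + e/2) \<le> ennreal (circle.prob A)" if "emeasure N A = ennreal (circle.prob A)"
      using that e by (simp add: ennreal_plus)
    moreover have "emeasure N A = ennreal (circle.prob A)"
      using eN[OF sA(1)] sA(2) by (simp add: Int_absorb2 circle.emeasure_eq_measure)
    ultimately show False using e by (simp add: ennreal_le_iff)
  qed
  then obtain K where K: "K \<subseteq> A" "compact K" "emeasure N A < emeasure N K + ennreal (e/2)" by blast
  have cK: "closed K" by (rule compact_imp_closed[OF K(2)])
  obtain h C where h: "C-lipschitz_on UNIV h"
    "(LINT \<zeta>|\<sigma>. cmod (of_real (indicator K \<zeta>) - h \<zeta>)) < e / 2"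
    using lipschitz_dense_closed[OF cK, of "e/2"] e by auto
  have sK: "K \<in> sets borel" using cK by (rule borel_closed)
  then have K': "K \<in> sets \<sigma>" using K(1) sA by (auto simp: sets_restrict_space_iff)
  have eqs: "emeasure N A = emeasure \<sigma> A" "emeasure N K = emeasure \<sigma> K"
    using eN[OF sA(1)] eN[OF sK] sA(2) K(1) by (simp_all add: Int_absorb2)
  have "ennreal (circle.prob A) < ennreal (circle.prob K) + ennreal (e/2)"
    using K(3) unfolding eqs circle.emeasure_eq_measure .
  also have "\<dots> = ennreal (circle.prob K + e/2)" using e by (simp add: ennreal_plus)
  finally have m: "circle.prob A < circle.prob K + e/2" by (simp add: ennreal_less_iff)
  have [measurable]: "A \<in> sets \<sigma>" "K \<in> sets \<sigma>" by fact+
  have ii: "integrable \<sigma> (indicat_real B)" if "B \<in> sets \<sigma>" for B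
    by (rule circle.integrable_const_bound[where B=1]) (use borel_measurable_indicator[OF that] in auto)
  have hi: "integrable \<sigma> h" by (rule lipschitz_integrable_circle[OF h(1)])
  have "(LINT \<zeta>|\<sigma>. cmod (of_real (indicator A \<zeta>) - h \<zeta>))
    \<le> (LINT \<zeta>|\<sigma>. (indicator A \<zeta> - indicator K \<zeta>) + cmod (of_real (indicator K \<zeta>) - h \<zeta>))"
  proof (rule integral_mono)
    show "integrable \<sigma> (\<lambda>\<zeta>. cmod (of_real (indicator A \<zeta>) - h \<zeta>))"
      by (intro integrable_norm Bochner_Integration.integrable_diff hi integrable_of_real ii A K')
    show "integrable \<sigma> (\<lambda>\<zeta>. (indicator A \<zeta> - indicator K \<zeta>) + cmod (of_real (indicator K \<zeta>) - h \<zeta>))"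
      by (intro integrable_norm Bochner_Integration.integrable_diff Bochner_Integration.integrable_add hi integrable_of_real ii A K')
    fix \<zeta>
    show "cmod (of_real (indicator A \<zeta>) - h \<zeta>) \<le> (indicator A \<zeta> - indicator K \<zeta>) + cmod (of_real (indicator K \<zeta>) - h \<zeta>)"
      using K(1) norm_triangle_ineq[of 1 "- h \<zeta>"] by (auto simp: indicator_def)
  qed
  also have "\<dots> = (circle.prob A - circle.prob K) + (LINT \<zeta>|\<sigma>. cmod (of_real (indicator K \<zeta>) - h \<zeta>))"
  proof -
    have "(LINT \<zeta>|\<sigma>. indicator A \<zeta> - indicator K \<zeta>) = circle.prob A - circle.prob K"
      using Bochner_Integration.integral_diff[OF ii[OF A] ii[OF K']]
        Bochner_Integration.integral_indicator[of \<sigma> A] Bochner_Integration.integral_indicator[of \<sigma> K] sA(2) K(1)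
      by (simp add: Int_absorb1 Int_absorb2)
    then show ?thesis
      by (subst Bochner_Integration.integral_add)
         (intro integrable_norm Bochner_Integration.integrable_diff hi integrable_of_real ii A K' refl | simp)+
  qed
  also have "\<dots> < e" using m h(2) by simp
  finally show ?thesis using h(1) by blast
qed

text \<open>Induction over integrable functions. In the limit step the rule supplies the bound of
  the approximants by twice the limit, hence the dominating function
  \<open>3 * cmod (f \<zeta>)\<close>.\<close>

lemma lipschitz_dense_L1:
  assumes "integrable \<sigma> G" and "(0::real) < e"
  shows "\<exists>h C. C-lipschitz_on UNIV h \<and> (LINT \<zeta>|\<sigma>. cmod (G \<zeta> - h \<zeta>)) < e"
  using assms
proof (induction arbitrary: e rule: integrable_induct)
  case (base A c)
  obtain h C where h: "C-lipschitz_on UNIV h"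
    "(LINT \<zeta>|\<sigma>. cmod (of_real (indicator A \<zeta>) - h \<zeta>)) < e / (cmod c + 1)"
    using lipschitz_dense_sets[OF base(1), of "e / (cmod c + 1)"] base(3)
    by (metis add_nonneg_pos divide_pos_pos norm_ge_zero zero_less_one)
  have "(cmod c * C)-lipschitz_on UNIV (\<lambda>\<zeta>. c * h \<zeta>)"
  proof (rule lipschitz_onI)
    fix x y :: complex
    have "dist (c * h x) (c * h y) = cmod c * dist (h x) (h y)"
      by (metis dist_norm norm_mult right_diff_distrib)
    also have "\<dots> \<le> cmod c * (C * dist x y)"
      using lipschitz_onD[OF h(1), of x y] by (intro mult_left_mono) auto
    finally show "dist (c * h x) (c * h y) \<le> cmod c * C * dist x y" by (simp add: mult.assoc)
  qed (use lipschitz_on_nonneg[OF h(1)] in simp)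
  moreover have "(LINT \<zeta>|\<sigma>. cmod (indicator A \<zeta> *\<^sub>R c - c * h \<zeta>)) < e"
  proof -
    have "cmod (indicator A \<zeta> *\<^sub>R c - c * h \<zeta>) = cmod c * cmod (of_real (indicator A \<zeta>) - h \<zeta>)" for \<zeta>
    proof -
      have "indicator A \<zeta> *\<^sub>R c - c * h \<zeta> = c * (of_real (indicator A \<zeta>) - h \<zeta>)"
        by (simp add: scaleR_conv_of_real algebra_simps)
      then show ?thesis by (simp only: norm_mult)
    qed
    then have "(LINT \<zeta>|\<sigma>. cmod (indicator A \<zeta> *\<^sub>R c - c * h \<zeta>)) =
       cmod c * (LINT \<zeta>|\<sigma>. cmod (of_real (indicator A \<zeta>) - h \<zeta>))" by simp
    also have "\<dots> \<le> (cmod c + 1) * (LINT \<zeta>|\<sigma>. cmod (of_real (indicator A \<zeta>) - h \<zeta>))"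
      by (intro mult_right_mono) auto
    also have "\<dots> < e" using h(2) by (simp add: pos_less_divide_eq add_nonneg_pos mult.commute)
    finally show ?thesis .
  qed
  ultimately show ?case by blast
next
  case (add f g)
  from add.IH(1)[of "e/2"] add.prems obtain h C where h: "C-lipschitz_on UNIV h"
    "(LINT \<zeta>|\<sigma>. cmod (f \<zeta> - h \<zeta>)) < e/2" by auto
  from add.IH(2)[of "e/2"] add.prems obtain h' C' where h': "C'-lipschitz_on UNIV h'"
    "(LINT \<zeta>|\<sigma>. cmod (g \<zeta> - h' \<zeta>)) < e/2" by auto
  note i = add.hyps lipschitz_integrable_circle[OF h(1)] lipschitz_integrable_circle[OF h'(1)]
  have "(LINT \<zeta>|\<sigma>. cmod (f \<zeta> + g \<zeta> - (h \<zeta> + h' \<zeta>)))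
      \<le> (LINT \<zeta>|\<sigma>. cmod (f \<zeta> - h \<zeta>) + cmod (g \<zeta> - h' \<zeta>))"
    using i by (intro integral_mono integrable_norm Bochner_Integration.integrable_add Bochner_Integration.integrable_diff)
      (auto intro: norm_diff_triangle_ineq)
  also have "\<dots> = (LINT \<zeta>|\<sigma>. cmod (f \<zeta> - h \<zeta>)) + (LINT \<zeta>|\<sigma>. cmod (g \<zeta> - h' \<zeta>))"
    using i by (intro Bochner_Integration.integral_add integrable_norm Bochner_Integration.integrable_diff)
  also have "\<dots> < e" using h(2) h'(2) by simp
  finally show ?case using lipschitz_on_add[OF h(1) h'(1)] by blast
next
  case (lim f s)
  have [measurable]: "f \<in> borel_measurable \<sigma>" "\<And>i. s i \<in> borel_measurable \<sigma>"
    using lim.hyps by auto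
  have "(\<lambda>i. LINT \<zeta>|\<sigma>. cmod (f \<zeta> - s i \<zeta>)) \<longlonglongrightarrow> (LINT \<zeta>|\<sigma>. 0)"
  proof (rule integral_dominated_convergence[where w="\<lambda>\<zeta>. 3 * cmod (f \<zeta>)"])
    show "AE \<zeta> in \<sigma>. (\<lambda>i. cmod (f \<zeta> - s i \<zeta>)) \<longlonglongrightarrow> 0"
    proof (rule AE_I2)
      fix \<zeta> assume "\<zeta> \<in> space \<sigma>"
      from tendsto_norm[OF tendsto_diff[OF tendsto_const[of "f \<zeta>"] lim.hyps(2)[OF this]]]
      show "(\<lambda>i. cmod (f \<zeta> - s i \<zeta>)) \<longlonglongrightarrow> 0" by simp
    qed
    show "AE \<zeta> in \<sigma>. norm (cmod (f \<zeta> - s i \<zeta>)) \<le> 3 * cmod (f \<zeta>)" for i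
    proof (rule AE_I2)
      fix \<zeta> assume "\<zeta> \<in> space \<sigma>"
      from lim.hyps(3)[OF this, of i] norm_triangle_ineq4[of "f \<zeta>" "s i \<zeta>"]
      show "norm (cmod (f \<zeta> - s i \<zeta>)) \<le> 3 * cmod (f \<zeta>)" by simp
    qed
    show "integrable \<sigma> (\<lambda>\<zeta>. 3 * cmod (f \<zeta>))" using lim.hyps(4) by auto
  qed auto
  then have "\<forall>\<^sub>F i in sequentially. (LINT \<zeta>|\<sigma>. cmod (f \<zeta> - s i \<zeta>)) < e/2"
    using lim.prems by (auto dest!: order_tendstoD(2)[where a="e/2"])
  then obtain i where i: "(LINT \<zeta>|\<sigma>. cmod (f \<zeta> - s i \<zeta>)) < e/2"
    by (auto simp: eventually_sequentially)
  from lim.IH[of "e/2" i] lim.prems obtain h C where h: "C-lipschitz_on UNIV h"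
    "(LINT \<zeta>|\<sigma>. cmod (s i \<zeta> - h \<zeta>)) < e/2" by auto
  note int = lim.hyps(1,4) lipschitz_integrable_circle[OF h(1)]
  have "(LINT \<zeta>|\<sigma>. cmod (f \<zeta> - h \<zeta>))
      \<le> (LINT \<zeta>|\<sigma>. cmod (f \<zeta> - s i \<zeta>) + cmod (s i \<zeta> - h \<zeta>))"
  proof (intro integral_mono integrable_norm Bochner_Integration.integrable_add Bochner_Integration.integrable_diff int)
    fix \<zeta> show "cmod (f \<zeta> - h \<zeta>) \<le> cmod (f \<zeta> - s i \<zeta>) + cmod (s i \<zeta> - h \<zeta>)"
      using norm_triangle_ineq[of "f \<zeta> - s i \<zeta>" "s i \<zeta> - h \<zeta>"] by simp
  qed
  also have "\<dots> = (LINT \<zeta>|\<sigma>. cmod (f \<zeta> - s i \<zeta>)) + (LINT \<zeta>|\<sigma>. cmod (s i \<zeta> - h \<zeta>))"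
    by (intro Bochner_Integration.integral_add integrable_norm Bochner_Integration.integrable_diff int)
  also have "\<dots> < e" using h(2) i by simp
  finally show ?case using h(1) by blast
qed

lemma L2_circle_integrable:
  assumes "f \<in> L2_circle"
  shows "integrable \<sigma> f" "f \<in> borel_measurable \<sigma>"
    "integrable \<sigma> (\<lambda>\<zeta>. (cmod (f \<zeta>))\<^sup>2)"
proof -
  show m: "f \<in> borel_measurable \<sigma>" and i: "integrable \<sigma> (\<lambda>\<zeta>. (cmod (f \<zeta>))\<^sup>2)"
    using assms by (auto simp: L2_circle_def)
  show "integrable \<sigma> f"
  proof (rule Bochner_Integration.integrable_bound)
    show "integrable \<sigma> (\<lambda>\<zeta>. 1 + (cmod (f \<zeta>))\<^sup>2)" using i by auto
    have "norm (f \<zeta>) \<le> norm (1 + (cmod (f \<zeta>))\<^sup>2)" for \<zeta>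
    proof -
      have a: "2 * cmod (f \<zeta>) \<le> 1 + (cmod (f \<zeta>))\<^sup>2"
        using sum_squares_bound[of 1 "cmod (f \<zeta>)"] by simp
      have b: "0 \<le> cmod (f \<zeta>)" by simp
      from a b have "cmod (f \<zeta>) \<le> 1 + (cmod (f \<zeta>))\<^sup>2" by linarith
      then show ?thesis by simp
    qed
    then show "AE \<zeta> in \<sigma>. norm (f \<zeta>) \<le> norm (1 + (cmod (f \<zeta>))\<^sup>2)" by simp
  qed (rule m)
qed

lemma L2_circle_iff:
  "f \<in> L2_circle \<longleftrightarrow> f \<in> borel_measurable \<sigma> \<and>
     (\<integral>\<^sup>+ \<zeta>. abs2 (f \<zeta>) \<partial>\<sigma>) < \<infinity>"
  by (auto simp: L2_circle_def integrable_iff_bounded)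

text \<open>Boundedness turns closeness in L1 into closeness in L2: \<open>G\<close> is truncated,
  the truncation is approximated in L1, and the approximant is projected to the same ball.\<close>

lemma lipschitz_dense_L2:
  assumes G: "G \<in> L2_circle" and e: "(0::real) < e"
  shows "\<exists>h C. C-lipschitz_on UNIV h \<and>
    (\<integral>\<^sup>+ \<zeta>. abs2 (G \<zeta> - h \<zeta>) \<partial>\<sigma>) < ennreal e"
proof -
  note Gi = L2_circle_integrable[OF G]
  have [measurable]: "G \<in> borel_measurable \<sigma>" by fact
  define T where "T n \<zeta> = (if cmod (G \<zeta>) \<le> real n then G \<zeta> else 0)" for n \<zeta>
  have [measurable]: "T n \<in> borel_measurable \<sigma>" for n unfolding T_def by measurable
  have "(\<lambda>n. LINT \<zeta>|\<sigma>. (cmod (G \<zeta> - T n \<zeta>))\<^sup>2) \<longlonglongrightarrow> (LINT \<zeta>|\<sigma>. 0)"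
  proof (rule integral_dominated_convergence[where w="\<lambda>\<zeta>. (cmod (G \<zeta>))\<^sup>2"])
    have "(\<lambda>n. (cmod (G \<zeta> - T n \<zeta>))\<^sup>2) \<longlonglongrightarrow> 0" for \<zeta>
    proof (rule tendsto_eventually)
      obtain N :: nat where "cmod (G \<zeta>) \<le> real N" using real_arch_simple by blast
      then have "\<forall>n\<ge>N. (cmod (G \<zeta> - T n \<zeta>))\<^sup>2 = 0" by (auto simp: T_def)
      then show "\<forall>\<^sub>F n in sequentially. (cmod (G \<zeta> - T n \<zeta>))\<^sup>2 = 0" 
        unfolding eventually_sequentially by blast
    qed
    then show "AE \<zeta> in \<sigma>. (\<lambda>n. (cmod (G \<zeta> - T n \<zeta>))\<^sup>2) \<longlonglongrightarrow> 0" by simp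
    show "AE \<zeta> in \<sigma>. norm ((cmod (G \<zeta> - T n \<zeta>))\<^sup>2) \<le> (cmod (G \<zeta>))\<^sup>2" for n
      by (intro AE_I2) (auto simp: T_def)
  qed (use Gi in auto)
  then have "\<forall>\<^sub>F n in sequentially. (LINT \<zeta>|\<sigma>. (cmod (G \<zeta> - T n \<zeta>))\<^sup>2) < e/4"
    using e by (auto dest!: order_tendstoD(2)[where a="e/4"])
  then obtain n where n: "(LINT \<zeta>|\<sigma>. (cmod (G \<zeta> - T n \<zeta>))\<^sup>2) < e/4"
    by (auto simp: eventually_sequentially)
  define M where "M = real n"
  have M0: "M \<ge> 0" by (simp add: M_def)
  have Tb: "cmod (T n \<zeta>) \<le> M" for \<zeta> by (auto simp: T_def M_def)
  have Ti: "integrable \<sigma> (T n)"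
    by (rule circle.integrable_const_bound[where B=M]) (use Tb in auto)
  \<comment> \<open>The tolerance compensates the factor \<open>4 * (M + 1)\<close> in
    \<open>pt\<close> and leaves \<open>e / 2\<close>; \<open>M + 1\<close> instead of
    \<open>M\<close> keeps the divisor positive.\<close>
  obtain h0 C where h0: "C-lipschitz_on UNIV h0"
    "(LINT \<zeta>|\<sigma>. cmod (T n \<zeta> - h0 \<zeta>)) < e / (8 * (M + 1))"
    using lipschitz_dense_L1[OF Ti, of "e / (8 * (M + 1))"] e M0 by auto
  \<comment> \<open>Projection to the ball is 1-Lipschitz and fixes the values of
    \<open>T n\<close>, so the error does not grow while \<open>h\<close> becomes bounded by
    \<open>M\<close>.\<close>
  define h where "h \<zeta> = closest_point (cball 0 M) (h0 \<zeta>)" for \<zeta>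
  have cp: "dist (closest_point (cball 0 M) x) (closest_point (cball 0 M) y) \<le> dist x y" for x y :: complex
    by (rule closest_point_lipschitz) (use M0 in auto)
  have lip: "C-lipschitz_on UNIV h"
  proof (rule lipschitz_onI)
    fix x y show "dist (h x) (h y) \<le> C * dist x y"
      using cp[of "h0 x" "h0 y"] lipschitz_onD[OF h0(1), of x y] by (simp add: h_def)
  qed (rule lipschitz_on_nonneg[OF h0(1)])
  have hb: "cmod (h \<zeta>) \<le> M" for \<zeta>
    using closest_point_in_set[of "cball 0 M" "h0 \<zeta>"] M0 by (simp add: h_def)
  have hT: "cmod (T n \<zeta> - h \<zeta>) \<le> cmod (T n \<zeta> - h0 \<zeta>)" for \<zeta>
    using cp[of "T n \<zeta>" "h0 \<zeta>"] closest_point_self[of "T n \<zeta>" "cball 0 M"] Tb[of \<zeta>]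
    by (simp add: h_def dist_norm)
  have pt: "(cmod (G \<zeta> - h \<zeta>))\<^sup>2 \<le> 2 * (cmod (G \<zeta> - T n \<zeta>))\<^sup>2 + 4 * (M + 1) * cmod (T n \<zeta> - h0 \<zeta>)" for \<zeta>
  proof -
    have "cmod (G \<zeta> - h \<zeta>) \<le> cmod (G \<zeta> - T n \<zeta>) + cmod (T n \<zeta> - h \<zeta>)"
      using norm_triangle_ineq[of "G \<zeta> - T n \<zeta>" "T n \<zeta> - h \<zeta>"] by simp
    then have "(cmod (G \<zeta> - h \<zeta>))\<^sup>2 \<le> (cmod (G \<zeta> - T n \<zeta>) + cmod (T n \<zeta> - h \<zeta>))\<^sup>2"
      by (intro power_mono) auto
    also have "\<dots> \<le> 2 * (cmod (G \<zeta> - T n \<zeta>))\<^sup>2 + 2 * (cmod (T n \<zeta> - h \<zeta>))\<^sup>2"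
      using sum_squares_bound[of "cmod (G \<zeta> - T n \<zeta>)" "cmod (T n \<zeta> - h \<zeta>)"] by (simp add: power2_sum)
    also have "(cmod (T n \<zeta> - h \<zeta>))\<^sup>2 \<le> (2 * (M + 1)) * cmod (T n \<zeta> - h0 \<zeta>)"
      unfolding power2_eq_square
      using norm_triangle_ineq4[of "T n \<zeta>" "h \<zeta>"] Tb[of \<zeta>] hb[of \<zeta>] hT[of \<zeta>] M0
      by (intro mult_mono) auto
    finally show ?thesis by (simp add: algebra_simps)
  qed
  have [measurable]: "h \<in> borel_measurable \<sigma>" "h0 \<in> borel_measurable \<sigma>"
    using lipschitz_measurable_circle lip h0(1) by blast+
  have i1: "integrable \<sigma> (\<lambda>\<zeta>. (cmod (G \<zeta> - T n \<zeta>))\<^sup>2)"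
    by (rule Bochner_Integration.integrable_bound[OF Gi(3)]) (auto simp: T_def)
  have i2: "integrable \<sigma> (\<lambda>\<zeta>. cmod (T n \<zeta> - h0 \<zeta>))"
    by (intro integrable_norm Bochner_Integration.integrable_diff Ti lipschitz_integrable_circle[OF h0(1)])
  have "(\<integral>\<^sup>+ \<zeta>. abs2 (G \<zeta> - h \<zeta>) \<partial>\<sigma>)
    \<le> (\<integral>\<^sup>+ \<zeta>. ennreal (2 * (cmod (G \<zeta> - T n \<zeta>))\<^sup>2 + 4 * (M + 1) * cmod (T n \<zeta> - h0 \<zeta>)) \<partial>\<sigma>)"
    by (intro nn_integral_mono ennreal_leI pt)
  also have "\<dots> = ennreal (LINT \<zeta>|\<sigma>. 2 * (cmod (G \<zeta> - T n \<zeta>))\<^sup>2 + 4 * (M + 1) * cmod (T n \<zeta> - h0 \<zeta>))"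
    using M0 i1 i2 by (intro nn_integral_eq_integral) auto
  also have "(LINT \<zeta>|\<sigma>. 2 * (cmod (G \<zeta> - T n \<zeta>))\<^sup>2 + 4 * (M + 1) * cmod (T n \<zeta> - h0 \<zeta>))
    = 2 * (LINT \<zeta>|\<sigma>. (cmod (G \<zeta> - T n \<zeta>))\<^sup>2) + 4 * (M + 1) * (LINT \<zeta>|\<sigma>. cmod (T n \<zeta> - h0 \<zeta>))"
    using i1 i2 by simp
  also have "ennreal \<dots> < ennreal e"
  proof -
    have "4 * (M + 1) * (LINT \<zeta>|\<sigma>. cmod (T n \<zeta> - h0 \<zeta>)) < 4 * (M + 1) * (e / (8 * (M + 1)))"
      using h0(2) M0 by (intro mult_strict_left_mono) auto
    also have "\<dots> = e/2" using M0 by (simp add: field_simps)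
    finally show ?thesis using n e by (intro ennreal_lessI) auto
  qed
  finally show ?thesis using lip by blast
qed

section \<open>Dilations\<close>

interpretation circle2: pair_sigma_finite \<sigma> \<sigma> ..

definition dilate :: "real \<Rightarrow> (complex \<Rightarrow> complex) \<Rightarrow> complex \<Rightarrow> complex" where
  "dilate r f \<zeta> = poisson_ext f (of_real r * \<zeta>)"

lemma dilate_measurable:
  assumes "f \<in> borel_measurable \<sigma>"
  shows "dilate r f \<in> borel_measurable \<sigma>"
proof -
  note [measurable] = poisson_ext_measurable[OF assms]
  show ?thesis unfolding dilate_def by measurable
qed

lemma poisson_kernel_sym:
  assumes "cmod \<zeta> = 1" "cmod \<eta> = 1"
  shows "poisson_kernel (of_real r * \<zeta>) \<eta> = poisson_kernel (of_real r * \<eta>) \<zeta>"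
proof -
  have "cmod (\<eta> - of_real r * \<zeta>) = cmod (\<zeta> - of_real r * \<eta>)"
  proof -
    have "(cmod (\<eta> - of_real r * \<zeta>))\<^sup>2 = (cmod \<eta>)\<^sup>2 + r\<^sup>2 * (cmod \<zeta>)\<^sup>2 - 2 * r * Re (\<eta> * cnj \<zeta>)"
         "(cmod (\<zeta> - of_real r * \<eta>))\<^sup>2 = (cmod \<zeta>)\<^sup>2 + r\<^sup>2 * (cmod \<eta>)\<^sup>2 - 2 * r * Re (\<eta> * cnj \<zeta>)"
      unfolding cmod_power2 by (simp_all add: power2_eq_square algebra_simps)
    then have "(cmod (\<eta> - of_real r * \<zeta>))\<^sup>2 = (cmod (\<zeta> - of_real r * \<eta>))\<^sup>2"
      using assms by simp
    then show ?thesis by (simp add: power2_eq_iff_nonneg)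
  qed
  then show ?thesis using assms by (simp add: poisson_kernel_def norm_mult)
qed

lemma poisson_kernel_measurable_pair [measurable]:
  "(\<lambda>(z, \<zeta>). poisson_kernel z \<zeta>) \<in> borel_measurable (borel \<Otimes>\<^sub>M borel)"
  unfolding poisson_kernel_def by measurable

text \<open>On the circle the kernel is symmetric in \<zeta> and \<eta>, so by Fubini it may be
  integrated in \<zeta> first, where its integral is 1.\<close>

lemma nn_integral_poisson_average:
  assumes r: "0 \<le> r" "r < 1" and [measurable]: "g \<in> borel_measurable \<sigma>"
  shows "(\<integral>\<^sup>+ \<zeta>. \<integral>\<^sup>+ \<eta>. ennreal (poisson_kernel (of_real r * \<zeta>) \<eta>) * g \<eta> \<partial>\<sigma> \<partial>\<sigma>)
    = (\<integral>\<^sup>+ \<eta>. g \<eta> \<partial>\<sigma>)"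
proof -
  have "(\<integral>\<^sup>+ \<zeta>. \<integral>\<^sup>+ \<eta>. ennreal (poisson_kernel (of_real r * \<zeta>) \<eta>) * g \<eta> \<partial>\<sigma> \<partial>\<sigma>)
    = (\<integral>\<^sup>+ \<eta>. \<integral>\<^sup>+ \<zeta>. ennreal (poisson_kernel (of_real r * \<zeta>) \<eta>) * g \<eta> \<partial>\<sigma> \<partial>\<sigma>)"
    by (rule circle2.Fubini') measurable
  also have "\<dots> = (\<integral>\<^sup>+ \<eta>. \<integral>\<^sup>+ \<zeta>. ennreal (poisson_kernel (of_real r * \<eta>) \<zeta>) * g \<eta> \<partial>\<sigma> \<partial>\<sigma>)"
    by (intro nn_integral_cong) (simp add: poisson_kernel_sym)
  also have "\<dots> = (\<integral>\<^sup>+ \<eta>. g \<eta> \<partial>\<sigma>)"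
  proof (intro nn_integral_cong)
    fix \<eta> assume "\<eta> \<in> space \<sigma>"
    then have "cmod (of_real r * \<eta>) < 1" using r by (simp add: norm_mult)
    then show "(\<integral>\<^sup>+ \<zeta>. ennreal (poisson_kernel (of_real r * \<eta>) \<zeta>) * g \<eta> \<partial>\<sigma>) = g \<eta>"
      by (subst nn_integral_multc) (auto simp: nn_integral_poisson_kernel)
  qed
  finally show ?thesis .
qed

text \<open>With \<open>A\<close> and \<open>B\<close> the distances of \<eta> from
  \<open>r * \<xi>\<close> and \<open>r * \<zeta>\<close>,
  \<open>p - q = s * (A - B) * (A + B) / (A^2 * B^2)\<close>. Here \<open>|A - B|\<close> is at most
  \<open>|\<zeta> - \<xi>|\<close>, and \<open>|\<eta> - \<xi>| \<le> 2 * A\<close> cancels a factor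
  \<open>A^2\<close>. The constant 8 = 2 * 4 comes from
  \<open>(A + B)^2 \<le> 2 * (A^2 + B^2)\<close> and from \<open>(2 * A)^2\<close>. The factor
  \<open>p\<close> on the right is kept for a later division.\<close>

lemma poisson_kernel_diff_le:
  assumes r: "0 \<le> r" "r < 1" and u: "cmod \<zeta> = 1" "cmod \<xi> = 1" "cmod \<eta> = 1"
  defines "p \<equiv> poisson_kernel (of_real r * \<zeta>) \<eta>" and "q \<equiv> poisson_kernel (of_real r * \<xi>) \<eta>"
  shows "((p - q) * cmod (\<eta> - \<xi>))\<^sup>2 \<le> 8 * (cmod (\<zeta> - \<xi>))\<^sup>2 * (p * (p + q))"
proof -
  define A where "A = cmod (\<eta> - of_real r * \<xi>)"
  define B where "B = cmod (\<eta> - of_real r * \<zeta>)"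
  define s where "s = 1 - r\<^sup>2"
  have s: "s > 0" using r by (simp add: s_def abs_square_less_1)
  have AB: "A \<ge> 1 - r" "B \<ge> 1 - r"
    using norm_triangle_ineq2[of \<eta> "of_real r * \<xi>"] norm_triangle_ineq2[of \<eta> "of_real r * \<zeta>"] u r
    by (simp_all add: A_def B_def norm_mult)
  then have pos: "A > 0" "B > 0" using r by auto
  have pq: "p = s / B\<^sup>2" "q = s / A\<^sup>2"
    using u r by (simp_all add: p_def q_def poisson_kernel_def A_def B_def s_def norm_mult)
  have "cmod (\<eta> - \<xi>) \<le> A + cmod (of_real r * \<xi> - \<xi>)"
    using norm_triangle_ineq[of "\<eta> - of_real r * \<xi>" "of_real r * \<xi> - \<xi>"] by (simp add: A_def)
  also have "cmod (of_real r * \<xi> - \<xi>) = 1 - r"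
  proof -
    have "of_real r * \<xi> - \<xi> = of_real (r - 1) * \<xi>" by (simp add: algebra_simps)
    then have "cmod (of_real r * \<xi> - \<xi>) = \<bar>r - 1\<bar> * cmod \<xi>" by (metis norm_mult norm_of_real)
    then show ?thesis using u r by simp
  qed
  finally have eta: "cmod (\<eta> - \<xi>) \<le> 2 * A" using AB by linarith
  have "\<bar>A - B\<bar> \<le> cmod (of_real r * \<zeta> - of_real r * \<xi>)"
    using norm_triangle_ineq3[of "\<eta> - of_real r * \<xi>" "\<eta> - of_real r * \<zeta>"] by (simp add: A_def B_def)
  also have "\<dots> = r * cmod (\<zeta> - \<xi>)"
    using r by (metis abs_of_nonneg norm_mult norm_of_real right_diff_distrib)
  also have "\<dots> \<le> 1 * cmod (\<zeta> - \<xi>)" using r by (intro mult_right_mono) auto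
  finally have dAB: "(A - B)\<^sup>2 \<le> (cmod (\<zeta> - \<xi>))\<^sup>2"
    by (metis abs_ge_zero mult_1 power2_abs power_mono)
  have "p - q = s * (A - B) * (A + B) / (A\<^sup>2 * B\<^sup>2)"
    unfolding pq using pos by (simp add: field_simps power2_eq_square)
  then have "((p - q) * cmod (\<eta> - \<xi>))\<^sup>2
    = s\<^sup>2 / (A\<^sup>2 * B\<^sup>2)\<^sup>2 * ((A - B)\<^sup>2 * ((A + B)\<^sup>2 * (cmod (\<eta> - \<xi>))\<^sup>2))"
    by (simp add: power_mult_distrib power_divide)
  also have "\<dots> \<le> s\<^sup>2 / (A\<^sup>2 * B\<^sup>2)\<^sup>2 * ((cmod (\<zeta> - \<xi>))\<^sup>2 * ((2 * (A\<^sup>2 + B\<^sup>2)) * (2 * A)\<^sup>2))"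
  proof (intro mult_left_mono mult_mono dAB)
    show "(A + B)\<^sup>2 \<le> 2 * (A\<^sup>2 + B\<^sup>2)"
      using sum_squares_bound[of A B] by (simp add: power2_sum)
    show "(cmod (\<eta> - \<xi>))\<^sup>2 \<le> (2 * A)\<^sup>2" using eta by (intro power_mono) auto
  qed auto
  also have "\<dots> = 8 * (cmod (\<zeta> - \<xi>))\<^sup>2 * (p * (p + q))"
    unfolding pq using pos by (simp add: divide_simps power2_eq_square) (simp add: algebra_simps)
  finally show ?thesis .
qed

text \<open>Both kernels have integral 1, so \<open>f\<close> may be replaced by
  \<open>f - l\<close>. Cauchy-Schwarz separates the kernel difference divided by
  \<open>sqrt p\<close> from the quotient of \<open>f\<close> multiplied by \<open>sqrt p\<close>;
  the square of the first factor integrates to at most \<open>8 * 2 * |\<zeta> - \<xi>|^2\<close>,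
  the 2 being the mass of \<open>p + q\<close>.\<close>

lemma dilate_diff_le:
  assumes f: "integrable \<sigma> f" and r: "0 \<le> r" "r < 1"
    and u: "cmod \<zeta> = 1" "cmod \<xi> = 1"
  shows "abs2 (dilate r f \<zeta> - dilate r f \<xi>) \<le> ennreal (16 * (cmod (\<zeta> - \<xi>))\<^sup>2) *
    (\<integral>\<^sup>+ \<eta>. ennreal (poisson_kernel (of_real r * \<zeta>) \<eta>) *
        abs2 ((f \<eta> - l) / (\<eta> - \<xi>)) \<partial>\<sigma>)"
proof -
  define p where "p \<eta> = poisson_kernel (of_real r * \<zeta>) \<eta>" for \<eta>
  define q where "q \<eta> = poisson_kernel (of_real r * \<xi>) \<eta>" for \<eta>
  have z: "cmod (of_real r * \<zeta>) < 1" "cmod (of_real r * \<xi>) < 1" using u r by (auto simp: norm_mult)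
  have [measurable]: "f \<in> borel_measurable \<sigma>" using f by auto
  have [measurable]: "p \<in> borel_measurable \<sigma>" "q \<in> borel_measurable \<sigma>"
    unfolding p_def q_def by measurable
  have ppos: "p \<eta> > 0" if "cmod \<eta> = 1" for \<eta>
  proof -
    have "\<eta> \<noteq> of_real r * \<zeta>" using that u r by (auto simp: norm_mult)
    then show ?thesis using z(1) u r by (simp add: p_def poisson_kernel_def norm_mult abs_square_less_1)
  qed
  have qpos: "q \<eta> \<ge> 0" for \<eta> using poisson_kernel_nonneg[OF z(2)] by (simp add: q_def)
  define w where "w \<eta> = cmod ((f \<eta> - l) / (\<eta> - \<xi>))" for \<eta>
  have [measurable]: "w \<in> borel_measurable \<sigma>" unfolding w_def by measurable
  have fi: "integrable \<sigma> (\<lambda>\<eta>. f \<eta> - l)" using f by auto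
  have ib: "integrable \<sigma> (\<lambda>\<eta>. of_real (p \<eta>) * (f \<eta> - l))"
           "integrable \<sigma> (\<lambda>\<eta>. of_real (q \<eta>) * (f \<eta> - l))"
    unfolding p_def q_def
    by (intro integrable_circle_bounded_mult[OF fi];
        use poisson_kernel_bound[OF z(1)] poisson_kernel_nonneg[OF z(1)]
            poisson_kernel_bound[OF z(2)] poisson_kernel_nonneg[OF z(2)] in auto)+
  have "dilate r f \<zeta> - dilate r f \<xi> = poisson_ext (\<lambda>\<eta>. f \<eta> - l) (of_real r * \<zeta>) - poisson_ext (\<lambda>\<eta>. f \<eta> - l) (of_real r * \<xi>)"
    using poisson_ext_diff[OF f _ z(1), of "\<lambda>_. l"] poisson_ext_diff[OF f _ z(2), of "\<lambda>_. l"] z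
    by (simp add: dilate_def poisson_ext_const)
  also have "\<dots> = (LINT \<eta>|\<sigma>. of_real (p \<eta>) * (f \<eta> - l) - of_real (q \<eta>) * (f \<eta> - l))"
    unfolding poisson_ext_eq using ib by (simp add: p_def q_def)
  finally have "ennreal (cmod (dilate r f \<zeta> - dilate r f \<xi>)) \<le>
     (\<integral>\<^sup>+ \<eta>. ennreal (cmod (of_real (p \<eta>) * (f \<eta> - l) - of_real (q \<eta>) * (f \<eta> - l))) \<partial>\<sigma>)"
    using integral_norm_bound_ennreal[OF Bochner_Integration.integrable_diff[OF ib]] by simp
  also have "\<dots> = (\<integral>\<^sup>+ \<eta>. ennreal ((\<bar>p \<eta> - q \<eta>\<bar> * cmod (\<eta> - \<xi>) / sqrt (p \<eta>)) * (sqrt (p \<eta>) * w \<eta>)) \<partial>\<sigma>)"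
  proof (rule nn_integral_cong_AE, rule AE_mp[OF AE_circle_neq[of \<xi>]], rule AE_I2, rule impI)
    fix \<eta> assume "\<eta> \<in> space \<sigma>" "\<eta> \<noteq> \<xi>"
    then have ne: "cmod (\<eta> - \<xi>) \<noteq> 0" "sqrt (p \<eta>) \<noteq> 0" using ppos[of \<eta>] by auto
    have "of_real (p \<eta>) * (f \<eta> - l) - of_real (q \<eta>) * (f \<eta> - l) = of_real (p \<eta> - q \<eta>) * (f \<eta> - l)"
      by (simp add: algebra_simps)
    then have "cmod (of_real (p \<eta>) * (f \<eta> - l) - of_real (q \<eta>) * (f \<eta> - l)) = \<bar>p \<eta> - q \<eta>\<bar> * cmod (f \<eta> - l)"
      by (metis norm_mult norm_of_real)
    also have "\<dots> = (\<bar>p \<eta> - q \<eta>\<bar> * cmod (\<eta> - \<xi>) / sqrt (p \<eta>)) * (sqrt (p \<eta>) * w \<eta>)"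
      using ne by (simp add: w_def norm_divide)
    finally show "ennreal (cmod (of_real (p \<eta>) * (f \<eta> - l) - of_real (q \<eta>) * (f \<eta> - l))) =
      ennreal ((\<bar>p \<eta> - q \<eta>\<bar> * cmod (\<eta> - \<xi>) / sqrt (p \<eta>)) * (sqrt (p \<eta>) * w \<eta>))" by simp
  qed
  finally have 1: "ennreal (cmod (dilate r f \<zeta> - dilate r f \<xi>)) \<le> \<dots>" .
  have "abs2 (dilate r f \<zeta> - dilate r f \<xi>) = (ennreal (cmod (dilate r f \<zeta> - dilate r f \<xi>)))\<^sup>2"
    by (simp add: ennreal_power)
  also have "\<dots> \<le> (\<integral>\<^sup>+ \<eta>. ennreal ((\<bar>p \<eta> - q \<eta>\<bar> * cmod (\<eta> - \<xi>) / sqrt (p \<eta>)) * (sqrt (p \<eta>) * w \<eta>)) \<partial>\<sigma>)\<^sup>2"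
    by (rule power_mono[OF 1]) simp
  also have "\<dots> \<le> (\<integral>\<^sup>+ \<eta>. ennreal ((\<bar>p \<eta> - q \<eta>\<bar> * cmod (\<eta> - \<xi>) / sqrt (p \<eta>))\<^sup>2) \<partial>\<sigma>) *
      (\<integral>\<^sup>+ \<eta>. ennreal ((sqrt (p \<eta>) * w \<eta>)\<^sup>2) \<partial>\<sigma>)"
  proof (rule Cauchy_Schwarz_nn_integral_real)
    fix \<eta> assume "\<eta> \<in> space \<sigma>"
    then have "p \<eta> > 0" using ppos by simp
    then show "0 \<le> \<bar>p \<eta> - q \<eta>\<bar> * cmod (\<eta> - \<xi>) / sqrt (p \<eta>)" "0 \<le> sqrt (p \<eta>) * w \<eta>"
      by (auto simp: w_def)
  qed auto
  also have "(\<integral>\<^sup>+ \<eta>. ennreal ((sqrt (p \<eta>) * w \<eta>)\<^sup>2) \<partial>\<sigma>) =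
      (\<integral>\<^sup>+ \<eta>. ennreal (p \<eta>) * ennreal ((w \<eta>)\<^sup>2) \<partial>\<sigma>)"
    using ppos by (intro nn_integral_cong) (auto simp: power_mult_distrib ennreal_mult less_imp_le)
  also have "(\<integral>\<^sup>+ \<eta>. ennreal ((\<bar>p \<eta> - q \<eta>\<bar> * cmod (\<eta> - \<xi>) / sqrt (p \<eta>))\<^sup>2) \<partial>\<sigma>)
     \<le> (\<integral>\<^sup>+ \<eta>. ennreal (8 * (cmod (\<zeta> - \<xi>))\<^sup>2) * (ennreal (p \<eta>) + ennreal (q \<eta>)) \<partial>\<sigma>)"
  proof (rule nn_integral_mono)
    fix \<eta> assume "\<eta> \<in> space \<sigma>"
    then have \<eta>: "cmod \<eta> = 1" and p0: "p \<eta> > 0" using ppos by auto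
    have "(\<bar>p \<eta> - q \<eta>\<bar> * cmod (\<eta> - \<xi>) / sqrt (p \<eta>))\<^sup>2 = ((p \<eta> - q \<eta>) * cmod (\<eta> - \<xi>))\<^sup>2 / p \<eta>"
      using p0 by (simp add: power_divide power_mult_distrib)
    also have "\<dots> \<le> 8 * (cmod (\<zeta> - \<xi>))\<^sup>2 * (p \<eta> * (p \<eta> + q \<eta>)) / p \<eta>"
      using poisson_kernel_diff_le[OF r u \<eta>] p0 unfolding p_def q_def by (intro divide_right_mono) auto
    also have "\<dots> = 8 * (cmod (\<zeta> - \<xi>))\<^sup>2 * (p \<eta> + q \<eta>)" using p0 by simp
    finally have "ennreal ((\<bar>p \<eta> - q \<eta>\<bar> * cmod (\<eta> - \<xi>) / sqrt (p \<eta>))\<^sup>2)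
      \<le> ennreal (8 * (cmod (\<zeta> - \<xi>))\<^sup>2 * (p \<eta> + q \<eta>))" by (rule ennreal_leI)
    also have "\<dots> = ennreal (8 * (cmod (\<zeta> - \<xi>))\<^sup>2) * ennreal (p \<eta> + q \<eta>)"
      using p0 qpos[of \<eta>] by (intro ennreal_mult) auto
    also have "ennreal (p \<eta> + q \<eta>) = ennreal (p \<eta>) + ennreal (q \<eta>)"
      using p0 qpos[of \<eta>] by (intro ennreal_plus) auto
    finally show "ennreal ((\<bar>p \<eta> - q \<eta>\<bar> * cmod (\<eta> - \<xi>) / sqrt (p \<eta>))\<^sup>2)
      \<le> ennreal (8 * (cmod (\<zeta> - \<xi>))\<^sup>2) * (ennreal (p \<eta>) + ennreal (q \<eta>))" .
  qed
  also have "\<dots> = ennreal (8 * (cmod (\<zeta> - \<xi>))\<^sup>2) * ((\<integral>\<^sup>+ \<eta>. ennreal (p \<eta>) \<partial>\<sigma>) + (\<integral>\<^sup>+ \<eta>. ennreal (q \<eta>) \<partial>\<sigma>))"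
    by (subst nn_integral_cmult; (subst nn_integral_add)?) auto
  also have "(\<integral>\<^sup>+ \<eta>. ennreal (p \<eta>) \<partial>\<sigma>) + (\<integral>\<^sup>+ \<eta>. ennreal (q \<eta>) \<partial>\<sigma>) = ennreal 2"
    using nn_integral_poisson_kernel[OF z(1)] nn_integral_poisson_kernel[OF z(2)]
    by (simp add: p_def q_def)
  also have "ennreal (8 * (cmod (\<zeta> - \<xi>))\<^sup>2) * ennreal 2 = ennreal (8 * (cmod (\<zeta> - \<xi>))\<^sup>2 * 2)"
    by (rule ennreal_mult[symmetric]) auto
  finally show ?thesis by (simp add: p_def w_def mult_right_mono)
qed

section \<open>Convergence of dilations in norm\<close>

lemma norm_add_sq_le: "(cmod (x + y))\<^sup>2 \<le> 2 * ((cmod x)\<^sup>2 + (cmod y)\<^sup>2)"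
proof -
  have "(cmod (x + y))\<^sup>2 \<le> (cmod x + cmod y)\<^sup>2" by (intro power_mono norm_triangle_ineq) auto
  then show ?thesis using sum_squares_bound[of "cmod x" "cmod y"] by (simp add: power2_sum)
qed

lemma nn_integral_add_sq_le:
  fixes F G :: "'a \<Rightarrow> complex"
  assumes [measurable]: "F \<in> borel_measurable M" "G \<in> borel_measurable M"
  shows "(\<integral>\<^sup>+ x. abs2 (F x + G x) \<partial>M)
    \<le> 2 * ((\<integral>\<^sup>+ x. abs2 (F x) \<partial>M) + (\<integral>\<^sup>+ x. abs2 (G x) \<partial>M))"
proof -
  have "(\<integral>\<^sup>+ x. abs2 (F x + G x) \<partial>M)
    \<le> (\<integral>\<^sup>+ x. ennreal 2 * (abs2 (F x) + abs2 (G x)) \<partial>M)"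
  proof (rule nn_integral_mono)
    fix x
    have "abs2 (F x + G x) \<le> ennreal (2 * ((cmod (F x))\<^sup>2 + (cmod (G x))\<^sup>2))"
      by (intro ennreal_leI norm_add_sq_le)
    also have "\<dots> = ennreal 2 * (abs2 (F x) + abs2 (G x))"
      by (subst ennreal_mult) (auto simp: ennreal_plus)
    finally show "abs2 (F x + G x) \<le> ennreal 2 * (abs2 (F x) + abs2 (G x))" .
  qed
  also have "\<dots> = 2 * ((\<integral>\<^sup>+ x. abs2 (F x) \<partial>M) + (\<integral>\<^sup>+ x. abs2 (G x) \<partial>M))"
    by (subst nn_integral_cmult; (subst nn_integral_add)?) auto
  finally show ?thesis .
qed

lemma nn_integral_add3_sq_le:
  fixes F G H :: "'a \<Rightarrow> complex"
  assumes [measurable]: "F \<in> borel_measurable M" "G \<in> borel_measurable M" "H \<in> borel_measurable M"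
  shows "(\<integral>\<^sup>+ x. abs2 (F x + G x + H x) \<partial>M)
    \<le> 4 * ((\<integral>\<^sup>+ x. abs2 (F x) \<partial>M) + (\<integral>\<^sup>+ x. abs2 (G x) \<partial>M)
      + (\<integral>\<^sup>+ x. abs2 (H x) \<partial>M))" (is "_ \<le> 4 * (?F + ?G + ?H)")
proof -
  have "(\<integral>\<^sup>+ x. abs2 (F x + G x + H x) \<partial>M)
    \<le> 2 * ((\<integral>\<^sup>+ x. abs2 (F x + G x) \<partial>M) + ?H)"
    by (rule nn_integral_add_sq_le) auto
  also have "\<dots> \<le> 2 * (2 * (?F + ?G) + ?H)"
    by (intro mult_left_mono add_right_mono nn_integral_add_sq_le) auto
  also have "\<dots> \<le> 2 * (2 * (?F + ?G) + (?H + ?H))"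
    by (intro mult_left_mono add_left_mono) auto
  also have "\<dots> = 2 * (2 * (?F + ?G) + 2 * ?H)"
    by (simp add: mult_2)
  also have "\<dots> = (2 * 2) * (?F + ?G + ?H)" by (simp only: distrib_left mult.assoc)
  finally show ?thesis by simp
qed

text \<open>A scheme for limits proved by approximation: \<open>e\<close> bounds the approximation
  errors and \<open>X\<close> is the contribution of the regular approximant. The 4 comes from
  squaring a sum of three terms; 100 is slack that covers the factors 8 and 68 of the two
  applications.\<close>

lemma tendsto_zero_ennreal_approx:
  fixes D :: "nat \<Rightarrow> ennreal"
  assumes "\<And>e::real. e > 0 \<Longrightarrow> \<exists>X. X \<longlonglongrightarrow> 0 \<and> (\<forall>k. D k \<le> ennreal (100 * e) + 4 * X k)"
  shows "D \<longlonglongrightarrow> 0"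
proof (rule order_tendstoI)
  fix a :: ennreal assume a: "0 < a"
  obtain b :: real where b: "0 < b" "ennreal b \<le> a"
  proof (cases a)
    case (real r)
    then show ?thesis using a that[of r] by (auto simp: ennreal_less_zero_iff)
  next
    case top
    then show ?thesis using that[of 1] by simp
  qed
  obtain X where X: "X \<longlonglongrightarrow> 0" "\<And>k. D k \<le> ennreal (100 * (b/400)) + 4 * X k"
    using assms[of "b/400"] b(1) by auto
  have "\<forall>\<^sub>F k in sequentially. X k < ennreal (b/8)"
    using b(1) by (intro order_tendstoD(2)[OF X(1)]) (simp add: ennreal_less_zero_iff)
  then show "\<forall>\<^sub>F k in sequentially. D k < a"
  proof eventually_elim
    case (elim k)
    have "D k \<le> ennreal (b/4) + 4 * X k" using X(2)[of k] by simp
    also have "4 * X k \<le> ennreal 4 * ennreal (b/8)" using elim by (intro mult_mono) auto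
    also have "ennreal 4 * ennreal (b/8) = ennreal (b/2)"
      using b(1) by (subst ennreal_mult[symmetric]) auto
    also have "ennreal (b/4) + ennreal (b/2) = ennreal (b/4 + b/2)"
      using b(1) by (intro ennreal_plus[symmetric]) auto
    also have "\<dots> < ennreal b" using b(1) by (intro ennreal_lessI) auto
    finally show ?case using b(2) by simp
  qed
qed auto

lemma ennreal_quotient_le:
  assumes "ennreal (x\<^sup>2) \<le> ennreal (16 * d\<^sup>2) * Y" and "d > 0" "x \<ge> 0"
  shows "ennreal ((x / d)\<^sup>2) \<le> 16 * Y"
proof -
  have "ennreal ((x / d)\<^sup>2) = ennreal (1 / d\<^sup>2) * ennreal (x\<^sup>2)"
    using assms(2) by (subst ennreal_mult[symmetric]) (auto simp: power_divide)
  also have "\<dots> \<le> ennreal (1 / d\<^sup>2) * (ennreal (16 * d\<^sup>2) * Y)"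
    by (intro mult_left_mono assms) auto
  also have "\<dots> = ennreal (1 / d\<^sup>2 * (16 * d\<^sup>2)) * Y"
    using assms(2) by (subst ennreal_mult) (auto simp: mult.assoc)
  also have "1 / d\<^sup>2 * (16 * d\<^sup>2) = 16" using assms(2) by simp
  finally show ?thesis by simp
qed

lemma dilate_quotient_le:
  assumes f: "integrable \<sigma> f" and r: "0 \<le> r" "r < 1"
    and u: "cmod \<zeta> = 1" "cmod \<xi> = 1"
  shows "abs2 ((dilate r f \<zeta> - dilate r f \<xi>) / (\<zeta> - \<xi>)) \<le> 16 *
    (\<integral>\<^sup>+ \<eta>. ennreal (poisson_kernel (of_real r * \<zeta>) \<eta>) *
        abs2 ((f \<eta> - l) / (\<eta> - \<xi>)) \<partial>\<sigma>)"
proof (cases "\<zeta> = \<xi>")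
  case False
  then show ?thesis
    using ennreal_quotient_le[OF dilate_diff_le[OF f r u, of l]] by (simp add: norm_divide)
qed simp

text \<open>The quotient of the dilation is bounded by a kernel average of the quotient of
  \<open>f\<close>, and integration in \<zeta> undoes the average. The constant 16 does not depend
  on \<open>r\<close>, as the dominated convergence below requires.\<close>

lemma dirichlet_at_dilate_le:
  assumes f: "integrable \<sigma> f" and r: "0 \<le> r" "r < 1" and \<xi>: "cmod \<xi> = 1"
  shows "dirichlet_at \<xi> (dilate r f) (dilate r f \<xi>) \<le> 16 * dirichlet_at \<xi> f l"
proof -
  have [measurable]: "f \<in> borel_measurable \<sigma>" using f by auto
  have "dirichlet_at \<xi> (dilate r f) (dilate r f \<xi>) \<le> (\<integral>\<^sup>+ \<zeta>. 16 *
    (\<integral>\<^sup>+ \<eta>. ennreal (poisson_kernel (of_real r * \<zeta>) \<eta>) *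
        abs2 ((f \<eta> - l) / (\<eta> - \<xi>)) \<partial>\<sigma>) \<partial>\<sigma>)"
    unfolding dirichlet_at_eq using dilate_quotient_le[OF f r _ \<xi>] by (intro nn_integral_mono) auto
  also have "\<dots> = 16 * (\<integral>\<^sup>+ \<zeta>.
    (\<integral>\<^sup>+ \<eta>. ennreal (poisson_kernel (of_real r * \<zeta>) \<eta>) *
        abs2 ((f \<eta> - l) / (\<eta> - \<xi>)) \<partial>\<sigma>) \<partial>\<sigma>)"
    by (rule nn_integral_cmult) measurable
  also have "\<dots> = 16 * dirichlet_at \<xi> f l"
    unfolding dirichlet_at_eq by (subst nn_integral_poisson_average[OF r]) auto
  finally show ?thesis .
qed

lemma L2_norm_dilate_le:
  assumes f: "integrable \<sigma> f" and r: "0 \<le> r" "r < 1"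
  shows "(\<integral>\<^sup>+ \<zeta>. abs2 (dilate r f \<zeta>) \<partial>\<sigma>)
    \<le> (\<integral>\<^sup>+ \<zeta>. abs2 (f \<zeta>) \<partial>\<sigma>)"
proof -
  have [measurable]: "f \<in> borel_measurable \<sigma>" using f by auto
  have "(\<integral>\<^sup>+ \<zeta>. abs2 (dilate r f \<zeta>) \<partial>\<sigma>)
    \<le> (\<integral>\<^sup>+ \<zeta>. \<integral>\<^sup>+ \<eta>. ennreal (poisson_kernel (of_real r * \<zeta>) \<eta>) * abs2 (f \<eta>)
      \<partial>\<sigma> \<partial>\<sigma>)"
  proof (rule nn_integral_mono)
    fix \<zeta> assume "\<zeta> \<in> space \<sigma>"
    then have z: "cmod (of_real r * \<zeta>) < 1" using r by (simp add: norm_mult)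
    show "abs2 (dilate r f \<zeta>) \<le> (\<integral>\<^sup>+ \<eta>. ennreal (poisson_kernel (of_real r * \<zeta>) \<eta>) * abs2 (f \<eta>)
      \<partial>\<sigma>)"
      using poisson_ext_Jensen[OF f z, of 0] poisson_kernel_nonneg[OF z]
      by (simp add: dilate_def ennreal_mult)
  qed
  also have "\<dots> = (\<integral>\<^sup>+ \<zeta>. abs2 (f \<zeta>) \<partial>\<sigma>)"
    by (rule nn_integral_poisson_average[OF r]) auto
  finally show ?thesis .
qed

lemma dilate_diff:
  assumes "integrable \<sigma> f" "integrable \<sigma> g" "0 \<le> r" "r < 1" "cmod \<zeta> = 1"
  shows "dilate r (\<lambda>\<zeta>. f \<zeta> - g \<zeta>) \<zeta> = dilate r f \<zeta> - dilate r g \<zeta>"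
  unfolding dilate_def using assms by (intro poisson_ext_diff) (auto simp: norm_mult)

lemma dirichlet_at_bounded_quotient:
  assumes "\<And>\<eta>. cmod \<eta> = 1 \<Longrightarrow> cmod (f \<eta> - l) \<le> K * cmod (\<eta> - \<xi>)"
  shows "dirichlet_at \<xi> f l \<le> ennreal (K\<^sup>2)"
proof -
  have "dirichlet_at \<xi> f l \<le> (\<integral>\<^sup>+ \<eta>. ennreal (K\<^sup>2) \<partial>\<sigma>)"
    unfolding dirichlet_at_eq
  proof (rule nn_integral_mono)
    fix \<eta> assume "\<eta> \<in> space \<sigma>"
    then have "cmod ((f \<eta> - l) / (\<eta> - \<xi>)) \<le> \<bar>K\<bar>"
      using assms[of \<eta>] order_trans[OF _ mult_right_mono[OF abs_ge_self[of K], of "cmod (\<eta> - \<xi>)"], of "cmod (f \<eta> - l)"]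
      by (cases "\<eta> = \<xi>") (auto simp: norm_divide divide_le_eq)
    then show "abs2 ((f \<eta> - l) / (\<eta> - \<xi>)) \<le> ennreal (K\<^sup>2)"
      by (intro ennreal_leI) (metis norm_ge_zero power2_abs power_mono)
  qed
  then show ?thesis by (simp add: emeasure_circle_measure_space)
qed

text \<open>A Lipschitz condition at the single point \<xi> makes the quotient bounded, so
  \<open>f \<xi>\<close> is the non-tangential limit there.\<close>

lemma dilate_tendsto:
  assumes f: "integrable \<sigma> f" and K: "\<And>\<eta>. cmod \<eta> = 1 \<Longrightarrow> cmod (f \<eta> - f \<xi>) \<le> K * cmod (\<eta> - \<xi>)"
    and \<xi>: "cmod \<xi> = 1" and r: "\<And>k. 0 \<le> r k" "\<And>k. r k < 1" "r \<longlonglongrightarrow> 1"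
  shows "(\<lambda>k. dilate (r k) f \<xi>) \<longlonglongrightarrow> f \<xi>"
proof -
  have "dirichlet_at \<xi> f (f \<xi>) < \<infinity>"
    using dirichlet_at_bounded_quotient[OF K] by (simp add: order_le_less_trans)
  from has_nt_limit_radial[OF has_nt_limit_if_dirichlet_finite[OF f \<xi> this] \<xi> r]
  show ?thesis by (simp add: dilate_def)
qed

lemma norm_dilate_le:
  assumes f: "integrable \<sigma> f" and H: "\<And>\<zeta>. cmod \<zeta> = 1 \<Longrightarrow> cmod (f \<zeta>) \<le> H"
    and r: "0 \<le> r" "r < 1" and \<zeta>: "cmod \<zeta> = 1"
  shows "cmod (dilate r f \<zeta>) \<le> H"
proof -
  have z: "cmod (of_real r * \<zeta>) < 1" using \<zeta> r by (simp add: norm_mult)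
  have "ennreal (cmod (dilate r f \<zeta>)) \<le> (\<integral>\<^sup>+ \<eta>. ennreal (poisson_kernel (of_real r * \<zeta>) \<eta> * cmod (f \<eta>)) \<partial>\<sigma>)"
    using norm_poisson_ext_le[OF f z, of 0] by (simp add: dilate_def)
  also have "\<dots> \<le> (\<integral>\<^sup>+ \<eta>. ennreal (poisson_kernel (of_real r * \<zeta>) \<eta>) * ennreal H \<partial>\<sigma>)"
    using poisson_kernel_nonneg[OF z] H
    by (intro nn_integral_mono) (auto simp: ennreal_mult''[symmetric] order_trans[OF norm_ge_zero H] intro!: ennreal_leI mult_left_mono)
  also have "\<dots> = ennreal H"
    by (subst nn_integral_multc) (auto simp: nn_integral_poisson_kernel[OF z])
  finally show ?thesis using order_trans[OF norm_ge_zero H[OF \<zeta>]] by (simp add: ennreal_le_iff)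
qed

text \<open>Dilations contract the L2 norm, so Lipschitz functions suffice; for them the convergence
  is pointwise and bounded.\<close>

lemma dilate_tendsto_L2:
  assumes f: "f \<in> L2_circle" and r: "\<And>k. 0 \<le> r k" "\<And>k. r k < 1" "r \<longlonglongrightarrow> 1"
  shows "(\<lambda>k. \<integral>\<^sup>+ \<zeta>. abs2 (dilate (r k) f \<zeta> - f \<zeta>) \<partial>\<sigma>) \<longlonglongrightarrow> 0"
proof (rule tendsto_zero_ennreal_approx)
  fix e :: real assume e: "e > 0"
  note fi = L2_circle_integrable[OF f]
  have [measurable]: "f \<in> borel_measurable \<sigma>" by fact
  obtain h C where h: "C-lipschitz_on UNIV h"
    "(\<integral>\<^sup>+ \<zeta>. abs2 (f \<zeta> - h \<zeta>) \<partial>\<sigma>) < ennreal e"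
    using lipschitz_dense_L2[OF f e] by blast
  note hi = lipschitz_integrable_circle[OF h(1)]
  have [measurable]: "h \<in> borel_measurable \<sigma>" using hi by auto
  note [measurable] = dilate_measurable
  define H where "H = cmod (h 0) + C"
  have H: "cmod (h \<zeta>) \<le> H" if "cmod \<zeta> = 1" for \<zeta>
    using lipschitz_bounded_circle[OF h(1) that] by (simp add: H_def)
  have fh: "integrable \<sigma> (\<lambda>\<zeta>. f \<zeta> - h \<zeta>)" using fi hi by auto
  define X where "X k = (\<integral>\<^sup>+ \<zeta>. abs2 (dilate (r k) h \<zeta> - h \<zeta>) \<partial>\<sigma>)" for k
  have dh: "cmod (dilate (r k) h \<zeta>) \<le> H" if "cmod \<zeta> = 1" for k \<zeta>
    by (rule norm_dilate_le[OF hi H r(1,2) that])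
  have "X \<longlonglongrightarrow> (\<integral>\<^sup>+ \<zeta>. 0 \<partial>\<sigma>)"
    unfolding X_def
  proof (rule nn_integral_dominated_convergence[where w="\<lambda>_. ennreal ((2 * H)\<^sup>2)"])
    show "AE \<zeta> in \<sigma>. abs2 (dilate (r k) h \<zeta> - h \<zeta>) \<le> ennreal ((2 * H)\<^sup>2)" for k
    proof (rule AE_I2)
      fix \<zeta> assume "\<zeta> \<in> space \<sigma>"
      then have "cmod (dilate (r k) h \<zeta> - h \<zeta>) \<le> 2 * H"
        using dh[of \<zeta> k] H[of \<zeta>] norm_triangle_ineq4[of "dilate (r k) h \<zeta>" "h \<zeta>"] by simp
      then show "abs2 (dilate (r k) h \<zeta> - h \<zeta>) \<le> ennreal ((2 * H)\<^sup>2)"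
        by (intro ennreal_leI power_mono) auto
    qed
    show "AE \<zeta> in \<sigma>. (\<lambda>k. abs2 (dilate (r k) h \<zeta> - h \<zeta>)) \<longlonglongrightarrow> 0"
    proof (rule AE_I2)
      fix \<zeta> assume "\<zeta> \<in> space \<sigma>"
      then have "(\<lambda>k. dilate (r k) h \<zeta>) \<longlonglongrightarrow> h \<zeta>"
        using lipschitz_onD[OF h(1)] by (intro dilate_tendsto[OF hi _ _ r, where K=C]) (auto simp: dist_norm)
      then have "(\<lambda>k. (cmod (dilate (r k) h \<zeta> - h \<zeta>))\<^sup>2) \<longlonglongrightarrow> (cmod (h \<zeta> - h \<zeta>))\<^sup>2"
        by (intro tendsto_power tendsto_norm tendsto_diff tendsto_const)
      then show "(\<lambda>k. abs2 (dilate (r k) h \<zeta> - h \<zeta>)) \<longlonglongrightarrow> 0"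
        using tendsto_ennrealI by fastforce
    qed
  qed (auto simp: emeasure_circle_measure_space ennreal_mult_less_top)
  then have X0: "X \<longlonglongrightarrow> 0" by simp
  moreover have "(\<integral>\<^sup>+ \<zeta>. abs2 (dilate (r k) f \<zeta> - f \<zeta>) \<partial>\<sigma>) \<le> ennreal (100 * e) + 4 * X k" for k
  proof -
    have "(\<integral>\<^sup>+ \<zeta>. abs2 (dilate (r k) f \<zeta> - f \<zeta>) \<partial>\<sigma>) =
      (\<integral>\<^sup>+ \<zeta>. abs2 (dilate (r k) (\<lambda>\<zeta>. f \<zeta> - h \<zeta>) \<zeta> + (dilate (r k) h \<zeta> - h \<zeta>) + (h \<zeta> - f \<zeta>)) \<partial>\<sigma>)"
      by (intro nn_integral_cong) (simp add: dilate_diff[OF fi(1) hi r(1,2)])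
    also have "\<dots> \<le> 4 * ((\<integral>\<^sup>+ \<zeta>. abs2 (dilate (r k) (\<lambda>\<zeta>. f \<zeta> - h \<zeta>) \<zeta>) \<partial>\<sigma>)
       + X k + (\<integral>\<^sup>+ \<zeta>. abs2 (h \<zeta> - f \<zeta>) \<partial>\<sigma>))"
      unfolding X_def by (rule nn_integral_add3_sq_le) measurable
    also have "\<dots> \<le> 4 * (ennreal e + X k + ennreal e)"
      using L2_norm_dilate_le[OF fh r(1)[of k] r(2)[of k]] h(2)
      by (intro mult_left_mono add_mono) (auto simp: norm_minus_commute[of "h _"])
    also have "\<dots> = ennreal 4 * (ennreal e + ennreal e) + 4 * X k"
      by (simp add: distrib_left add_ac)
    also have "ennreal 4 * (ennreal e + ennreal e) = ennreal (4 * (e + e))"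
    proof -
      have "ennreal (4 * (e + e)) = ennreal 4 * ennreal (e + e)" using e by (intro ennreal_mult) auto
      also have "ennreal (e + e) = ennreal e + ennreal e" using e by (intro ennreal_plus) auto
      finally show ?thesis by (rule sym)
    qed
    also have "ennreal (4 * (e + e)) \<le> ennreal (100 * e)" using e by (intro ennreal_leI) auto
    finally show ?thesis by (auto intro: add_right_mono)
  qed
  ultimately show "\<exists>X. X \<longlonglongrightarrow> 0 \<and> (\<forall>k. (\<integral>\<^sup>+ \<zeta>. abs2 (dilate (r k) f \<zeta> - f \<zeta>) \<partial>\<sigma>)
      \<le> ennreal (100 * e) + 4 * X k)" by blast
qed

text \<open>The approximation takes place at the level of quotients: a Lipschitz \<open>h\<close>
  close to \<open>(f - l) / (\<zeta> - \<xi>)\<close> in L2 gives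
  \<open>f' = l + (\<eta> - \<xi>) * h \<eta>\<close>, which has bounded quotients and the exact
  value \<open>l\<close> at \<xi>. The remainder \<open>f - f'\<close> is controlled uniformly in
  \<open>k\<close> by the factor 16.\<close>

lemma dilate_tendsto_dirichlet_at:
  assumes f: "f \<in> L2_circle" and \<xi>: "cmod \<xi> = 1" and D: "dirichlet_at \<xi> f l < \<infinity>"
    and r: "\<And>k. 0 \<le> r k" "\<And>k. r k < 1" "r \<longlonglongrightarrow> 1"
  shows "(\<lambda>k. dirichlet_at \<xi> (\<lambda>\<zeta>. dilate (r k) f \<zeta> - f \<zeta>) (dilate (r k) f \<xi> - l)) \<longlonglongrightarrow> 0"
proof (rule tendsto_zero_ennreal_approx)
  fix e :: real assume e: "e > 0"
  note fi = L2_circle_integrable[OF f]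
  have [measurable]: "f \<in> borel_measurable \<sigma>" by fact
  have "(\<lambda>\<zeta>. (f \<zeta> - l) / (\<zeta> - \<xi>)) \<in> L2_circle"
    using D by (simp add: L2_circle_iff dirichlet_at_eq)
  then obtain h C where h: "C-lipschitz_on UNIV h"
    "(\<integral>\<^sup>+ \<zeta>. abs2 ((f \<zeta> - l) / (\<zeta> - \<xi>) - h \<zeta>) \<partial>\<sigma>) < ennreal e"
    using lipschitz_dense_L2[OF _ e] by blast
  note hi = lipschitz_integrable_circle[OF h(1)]
  have [measurable]: "h \<in> borel_measurable \<sigma>" using hi by auto
  note [measurable] = dilate_measurable
  define H where "H = cmod (h 0) + C"
  have H: "cmod (h \<zeta>) \<le> H" if "cmod \<zeta> = 1" for \<zeta>
    using lipschitz_bounded_circle[OF h(1) that] by (simp add: H_def)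
  define f' where "f' \<eta> = l + (\<eta> - \<xi>) * h \<eta>" for \<eta>
  have f'l: "f' \<xi> = l" by (simp add: f'_def)
  have [measurable]: "f' \<in> borel_measurable \<sigma>" unfolding f'_def by measurable
  have f'i: "integrable \<sigma> f'"
  proof (rule circle.integrable_const_bound[where B="cmod l + 2 * H"])
    have "cmod (f' \<zeta>) \<le> cmod l + 2 * H" if "cmod \<zeta> = 1" for \<zeta>
    proof -
      have "cmod (f' \<zeta>) \<le> cmod l + cmod (\<zeta> - \<xi>) * cmod (h \<zeta>)"
        unfolding f'_def using norm_triangle_ineq[of l "(\<zeta> - \<xi>) * h \<zeta>"] by (simp add: norm_mult)
      also have "cmod (\<zeta> - \<xi>) * cmod (h \<zeta>) \<le> 2 * H"
        using norm_triangle_ineq4[of \<zeta> \<xi>] that \<xi> H[OF that] by (intro mult_mono) auto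
      finally show ?thesis by simp
    qed
    then show "AE \<zeta> in \<sigma>. norm (f' \<zeta>) \<le> cmod l + 2 * H"
      by (intro AE_I2) auto
  qed measurable
  have f'lip: "cmod (f' \<eta> - f' \<zeta>) \<le> (2 * C + H) * cmod (\<eta> - \<zeta>)" if "cmod \<zeta> = 1" "cmod \<eta> = 1" for \<zeta> \<eta>
  proof -
    have "f' \<eta> - f' \<zeta> = (\<eta> - \<xi>) * (h \<eta> - h \<zeta>) + (\<eta> - \<zeta>) * h \<zeta>" by (simp add: f'_def algebra_simps)
    then have "cmod (f' \<eta> - f' \<zeta>) \<le> cmod (\<eta> - \<xi>) * cmod (h \<eta> - h \<zeta>) + cmod (\<eta> - \<zeta>) * cmod (h \<zeta>)"
      using norm_triangle_ineq[of "(\<eta> - \<xi>) * (h \<eta> - h \<zeta>)" "(\<eta> - \<zeta>) * h \<zeta>"] by (simp add: norm_mult)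
    also have "\<dots> \<le> 2 * (C * cmod (\<eta> - \<zeta>)) + cmod (\<eta> - \<zeta>) * H"
      using norm_triangle_ineq4[of \<eta> \<xi>] that \<xi> H[OF that(1)] lipschitz_onD[OF h(1), of \<eta> \<zeta>]
      by (intro add_mono mult_mono) (auto simp: dist_norm)
    finally show ?thesis by (simp add: algebra_simps)
  qed
  have f'q: "cmod ((f' \<eta> - l) / (\<eta> - \<xi>)) \<le> H" if "cmod \<eta> = 1" for \<eta>
    using H[OF that] order_trans[OF norm_ge_zero H[OF that]] by (cases "\<eta> = \<xi>") (auto simp: f'_def)
  have ff': "integrable \<sigma> (\<lambda>\<zeta>. f \<zeta> - f' \<zeta>)" using fi f'i by auto
  have Dff': "dirichlet_at \<xi> (\<lambda>\<zeta>. f \<zeta> - f' \<zeta>) 0 \<le> ennreal e"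
  proof -
    have "dirichlet_at \<xi> (\<lambda>\<zeta>. f \<zeta> - f' \<zeta>) 0 =
      (\<integral>\<^sup>+ \<zeta>. abs2 ((f \<zeta> - l) / (\<zeta> - \<xi>) - h \<zeta>) \<partial>\<sigma>)"
      unfolding dirichlet_at_eq
    proof (rule nn_integral_cong_AE, rule eventually_mono[OF AE_circle_neq[of \<xi>]])
      fix \<zeta> assume "\<zeta> \<noteq> \<xi>"
      then have "(f \<zeta> - f' \<zeta> - 0) / (\<zeta> - \<xi>) = (f \<zeta> - l) / (\<zeta> - \<xi>) - h \<zeta>"
        by (simp add: f'_def divide_simps)
      then show "abs2 ((f \<zeta> - f' \<zeta> - 0) / (\<zeta> - \<xi>)) =
        abs2 ((f \<zeta> - l) / (\<zeta> - \<xi>) - h \<zeta>)" by simp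
    qed
    then show ?thesis using h(2) by simp
  qed
  define F2 where "F2 k \<zeta> = (dilate (r k) f' \<zeta> - f' \<zeta> - (dilate (r k) f' \<xi> - l)) / (\<zeta> - \<xi>)" for k \<zeta>
  have [measurable]: "F2 k \<in> borel_measurable \<sigma>" for k unfolding F2_def by measurable
  define X where "X k = (\<integral>\<^sup>+ \<zeta>. abs2 (F2 k \<zeta>) \<partial>\<sigma>)" for k
  \<comment> \<open>34 = 2 * (16 + 1): the square of the dilated quotient is at most 16 times a
    kernel average of \<open>H^2\<close>, that of the original one at most
    \<open>H^2\<close>.\<close>
  have F2b: "(cmod (F2 k \<zeta>))\<^sup>2 \<le> 34 * H\<^sup>2" if \<zeta>: "cmod \<zeta> = 1" for k \<zeta>
  proof -
    have z: "cmod (of_real (r k) * \<zeta>) < 1" using \<zeta> r by (simp add: norm_mult)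
    have "abs2 ((dilate (r k) f' \<zeta> - dilate (r k) f' \<xi>) / (\<zeta> - \<xi>)) \<le> 16 *
      (\<integral>\<^sup>+ \<eta>. ennreal (poisson_kernel (of_real (r k) * \<zeta>) \<eta>) *
        abs2 ((f' \<eta> - l) / (\<eta> - \<xi>)) \<partial>\<sigma>)"
      by (rule dilate_quotient_le[OF f'i r(1) r(2) \<zeta> \<xi>])
    also have "\<dots> \<le> 16 * (\<integral>\<^sup>+ \<eta>. ennreal (poisson_kernel (of_real (r k) * \<zeta>) \<eta>) * ennreal (H\<^sup>2) \<partial>\<sigma>)"
      using f'q by (intro mult_left_mono nn_integral_mono ennreal_leI power_mono) auto
    also have "(\<integral>\<^sup>+ \<eta>. ennreal (poisson_kernel (of_real (r k) * \<zeta>) \<eta>) * ennreal (H\<^sup>2) \<partial>\<sigma>) = ennreal (H\<^sup>2)"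
      by (subst nn_integral_multc) (auto simp: nn_integral_poisson_kernel[OF z])
    also have "16 * ennreal (H\<^sup>2) = ennreal (16 * H\<^sup>2)"
      by (subst ennreal_mult) auto
    finally have 1: "(cmod ((dilate (r k) f' \<zeta> - dilate (r k) f' \<xi>) / (\<zeta> - \<xi>)))\<^sup>2 \<le> 16 * H\<^sup>2"
      by (simp add: ennreal_le_iff)
    have "F2 k \<zeta> = (dilate (r k) f' \<zeta> - dilate (r k) f' \<xi>) / (\<zeta> - \<xi>) + - ((f' \<zeta> - l) / (\<zeta> - \<xi>))"
      unfolding F2_def by (simp add: diff_divide_distrib)
    then have "(cmod (F2 k \<zeta>))\<^sup>2 \<le> 2 * ((cmod ((dilate (r k) f' \<zeta> - dilate (r k) f' \<xi>) / (\<zeta> - \<xi>)))\<^sup>2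
        + (cmod ((f' \<zeta> - l) / (\<zeta> - \<xi>)))\<^sup>2)"
      using norm_add_sq_le[of "(dilate (r k) f' \<zeta> - dilate (r k) f' \<xi>) / (\<zeta> - \<xi>)" "- ((f' \<zeta> - l) / (\<zeta> - \<xi>))"]
      by (simp only: norm_minus_cancel)
    also have "(cmod ((f' \<zeta> - l) / (\<zeta> - \<xi>)))\<^sup>2 \<le> H\<^sup>2" using f'q[OF \<zeta>] by (intro power_mono) auto
    finally show ?thesis using 1 by simp
  qed
  have "X \<longlonglongrightarrow> (\<integral>\<^sup>+ \<zeta>. 0 \<partial>\<sigma>)"
    unfolding X_def
  proof (rule nn_integral_dominated_convergence[where w="\<lambda>_. ennreal (34 * H\<^sup>2)"])
    show "AE \<zeta> in \<sigma>. abs2 (F2 k \<zeta>) \<le> ennreal (34 * H\<^sup>2)" for k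
      using F2b by (intro AE_I2 ennreal_leI) auto
    have lim: "(\<lambda>k. dilate (r k) f' \<zeta>) \<longlonglongrightarrow> f' \<zeta>" if "cmod \<zeta> = 1" for \<zeta>
      by (rule dilate_tendsto[OF f'i f'lip[OF that] that r])
    show "AE \<zeta> in \<sigma>. (\<lambda>k. abs2 (F2 k \<zeta>)) \<longlonglongrightarrow> 0"
    proof (rule AE_I2)
      fix \<zeta> assume "\<zeta> \<in> space \<sigma>"
      then have \<zeta>: "cmod \<zeta> = 1" by simp
      have "(\<lambda>k. (cmod (F2 k \<zeta>))\<^sup>2) \<longlonglongrightarrow> 0"
      proof (cases "\<zeta> = \<xi>")
        case False
        have "(\<lambda>k. (cmod (F2 k \<zeta>))\<^sup>2) \<longlonglongrightarrow> (cmod ((f' \<zeta> - f' \<zeta> - (f' \<xi> - l)) / (\<zeta> - \<xi>)))\<^sup>2"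
          unfolding F2_def using False
          by (intro tendsto_power tendsto_norm tendsto_divide tendsto_diff tendsto_const lim \<zeta> \<xi>) auto
        then show ?thesis by (simp add: f'l)
      qed (simp add: F2_def)
      then show "(\<lambda>k. abs2 (F2 k \<zeta>)) \<longlonglongrightarrow> 0"
        using tendsto_ennrealI by fastforce
    qed
  qed (auto simp: emeasure_circle_measure_space ennreal_mult_less_top)
  then have X0: "X \<longlonglongrightarrow> 0" by simp
  moreover have "dirichlet_at \<xi> (\<lambda>\<zeta>. dilate (r k) f \<zeta> - f \<zeta>) (dilate (r k) f \<xi> - l) \<le> ennreal (100 * e) + 4 * X k" for k
  proof -
    let ?g = "\<lambda>\<zeta>. f \<zeta> - f' \<zeta>"
    have "dirichlet_at \<xi> (\<lambda>\<zeta>. dilate (r k) f \<zeta> - f \<zeta>) (dilate (r k) f \<xi> - l) =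
      (\<integral>\<^sup>+ \<zeta>. abs2 ((dilate (r k) ?g \<zeta> - dilate (r k) ?g \<xi>) / (\<zeta> - \<xi>) + F2 k \<zeta> + (0 - ?g \<zeta>) / (\<zeta> - \<xi>)) \<partial>\<sigma>)"
      unfolding dirichlet_at_eq F2_def add_divide_distrib[symmetric]
      by (intro nn_integral_cong) (simp add: dilate_diff[OF fi(1) f'i r(1,2)] \<xi> algebra_simps)
    also have "\<dots> \<le> 4 * ((\<integral>\<^sup>+ \<zeta>. abs2 ((dilate (r k) ?g \<zeta> - dilate (r k) ?g \<xi>) / (\<zeta> - \<xi>)) \<partial>\<sigma>)
       + X k + (\<integral>\<^sup>+ \<zeta>. abs2 ((0 - ?g \<zeta>) / (\<zeta> - \<xi>)) \<partial>\<sigma>))"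
      unfolding X_def by (rule nn_integral_add3_sq_le) measurable
    also have "(\<integral>\<^sup>+ \<zeta>. abs2 ((dilate (r k) ?g \<zeta> - dilate (r k) ?g \<xi>) / (\<zeta> - \<xi>)) \<partial>\<sigma>)
        = dirichlet_at \<xi> (dilate (r k) ?g) (dilate (r k) ?g \<xi>)"
      by (simp add: dirichlet_at_eq)
    also have "(\<integral>\<^sup>+ \<zeta>. abs2 ((0 - ?g \<zeta>) / (\<zeta> - \<xi>)) \<partial>\<sigma>) = dirichlet_at \<xi> ?g 0"
      by (simp add: dirichlet_at_eq norm_divide norm_minus_commute)
    also have "4 * (dirichlet_at \<xi> (dilate (r k) ?g) (dilate (r k) ?g \<xi>) + X k + dirichlet_at \<xi> ?g 0)
        \<le> 4 * (16 * ennreal e + X k + ennreal e)"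
      using order_trans[OF dirichlet_at_dilate_le[OF ff' r(1)[of k] r(2)[of k] \<xi>, of 0] mult_left_mono[OF Dff']] Dff'
      by (intro mult_left_mono add_mono order_refl) auto
    also have "\<dots> = ennreal 4 * (ennreal 16 * ennreal e + ennreal e) + 4 * X k"
      by (simp add: distrib_left add_ac)
    also have "ennreal 4 * (ennreal 16 * ennreal e + ennreal e) = ennreal (4 * (16 * e + e))"
    proof -
      have "ennreal (4 * (16 * e + e)) = ennreal 4 * ennreal (16 * e + e)" using e by (intro ennreal_mult) auto
      also have "ennreal (16 * e + e) = ennreal (16 * e) + ennreal e" using e by (intro ennreal_plus) auto
      also have "ennreal (16 * e) = ennreal 16 * ennreal e" using e by (intro ennreal_mult) auto
      finally show ?thesis by (rule sym)
    qed
    also have "ennreal (4 * (16 * e + e)) \<le> ennreal (100 * e)" using e by (intro ennreal_leI) auto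
    finally show ?thesis by (auto intro: add_right_mono)
  qed
  ultimately show "\<exists>X. X \<longlonglongrightarrow> 0 \<and> (\<forall>k. dirichlet_at \<xi> (\<lambda>\<zeta>. dilate (r k) f \<zeta> - f \<zeta>) (dilate (r k) f \<xi> - l)
      \<le> ennreal (100 * e) + 4 * X k)" by blast
qed

lemma dirichlet_at_diff_le:
  assumes [measurable]: "f \<in> borel_measurable \<sigma>" "g \<in> borel_measurable \<sigma>"
  shows "dirichlet_at \<xi> (\<lambda>\<zeta>. f \<zeta> - g \<zeta>) (l - m) \<le> 2 * (dirichlet_at \<xi> f l + dirichlet_at \<xi> g m)"
proof -
  have "dirichlet_at \<xi> (\<lambda>\<zeta>. f \<zeta> - g \<zeta>) (l - m) =
    (\<integral>\<^sup>+ \<zeta>. abs2 ((f \<zeta> - l) / (\<zeta> - \<xi>) + (m - g \<zeta>) / (\<zeta> - \<xi>)) \<partial>\<sigma>)"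
    unfolding dirichlet_at_eq add_divide_distrib[symmetric] by (simp add: algebra_simps)
  also have "\<dots> \<le> 2 * ((\<integral>\<^sup>+ \<zeta>. abs2 ((f \<zeta> - l) / (\<zeta> - \<xi>)) \<partial>\<sigma>)
      + (\<integral>\<^sup>+ \<zeta>. abs2 ((m - g \<zeta>) / (\<zeta> - \<xi>)) \<partial>\<sigma>))"
    by (rule nn_integral_add_sq_le) auto
  finally show ?thesis by (simp add: dirichlet_at_eq norm_divide norm_minus_commute)
qed

lemma dilate_L2:
  assumes f: "f \<in> L2_circle" and r: "0 \<le> r" "r < 1"
  shows "dilate r f \<in> L2_circle"
proof -
  note fi = L2_circle_integrable[OF f]
  show ?thesis
    using L2_norm_dilate_le[OF fi(1) r] dilate_measurable[OF fi(2)] f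
    by (auto simp: L2_circle_iff intro: order_le_less_trans)
qed

lemma L2_circle_diff:
  assumes f: "f \<in> L2_circle" and g: "g \<in> L2_circle"
  shows "(\<lambda>\<zeta>. f \<zeta> - g \<zeta>) \<in> L2_circle"
proof -
  have [measurable]: "f \<in> borel_measurable \<sigma>" "g \<in> borel_measurable \<sigma>"
    using L2_circle_integrable assms by auto
  have "(\<integral>\<^sup>+ \<zeta>. abs2 (f \<zeta> - g \<zeta>) \<partial>\<sigma>)
    \<le> 2 * ((\<integral>\<^sup>+ \<zeta>. abs2 (f \<zeta>) \<partial>\<sigma>) + (\<integral>\<^sup>+ \<zeta>. abs2 (- g \<zeta>) \<partial>\<sigma>))"
    using nn_integral_add_sq_le[of f \<sigma> "\<lambda>\<zeta>. - g \<zeta>"] by simp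
  also have "\<dots> < \<infinity>" using assms by (auto simp: L2_circle_iff ennreal_mult_less_top)
  finally show ?thesis by (simp add: L2_circle_iff)
qed

context
  fixes \<mu> :: "complex measure"
  assumes sets_\<mu>: "sets \<mu> = sets circle_borel"
begin

lemma space_mu: "space \<mu> = unit_circle"
  using sets_eq_imp_space_eq[OF sets_\<mu>] by (simp add: space_restrict_space)

lemma measurable_mu_iff: "f \<in> borel_measurable \<mu> \<longleftrightarrow> f \<in> borel_measurable \<sigma>"
  by (rule arg_cong[where f="\<lambda>S. f \<in> S"], rule measurable_cong_sets) (simp_all add: sets_\<mu>)

lemma dirichlet_integral_le:
  assumes "integrable \<sigma> f"
  shows "dirichlet_integral \<mu> f \<le> (\<integral>\<^sup>+ \<xi>. dirichlet_at \<xi> f (F \<xi>) \<partial>\<mu>)"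
  unfolding dirichlet_integral_def
  using local_dirichlet_le[OF assms] by (intro nn_integral_mono) (auto simp: space_mu)

lemma dirichlet_integral_eq:
  assumes "integrable \<sigma> f"
  shows "dirichlet_integral \<mu> f = (\<integral>\<^sup>+ \<xi>. dirichlet_at \<xi> f (boundary_value f \<xi>) \<partial>\<mu>)"
  unfolding dirichlet_integral_def
  using local_dirichlet_eq[OF assms] by (intro nn_integral_cong) (auto simp: space_mu)

text \<open>At \<mu>-almost every \<xi> the local energy of \<open>f\<close> is finite and those of
  the differences tend to 0; they are dominated by 34 = 2 * (16 + 1) times the local energy of
  \<open>f\<close>. The candidate value of the difference at \<xi> is
  \<open>dilate (r k) f \<xi> - F \<xi>\<close>.\<close>

lemma dilate_tendsto_norm_sq:
  assumes f: "f \<in> harmonic_dirichlet_space \<mu>"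
    and r: "\<And>k. 0 \<le> r k" "\<And>k. r k < 1" "r \<longlonglongrightarrow> 1"
  shows "(\<lambda>k. norm_sq \<mu> (\<lambda>\<zeta>. dilate (r k) f \<zeta> - f \<zeta>)) \<longlonglongrightarrow> 0"
proof -
  have fL: "f \<in> L2_circle" and fin: "dirichlet_integral \<mu> f < \<infinity>"
    using f by (auto simp: harmonic_dirichlet_space_def)
  note fi = L2_circle_integrable[OF fL]
  have [measurable]: "f \<in> borel_measurable \<sigma>" by fact
  note [measurable] = dilate_measurable
  define F where "F = boundary_value f"
  have [measurable]: "F \<in> borel_measurable \<sigma>"
    unfolding F_def by (rule boundary_value_measurable) measurable
  have Dm: "(\<lambda>\<xi>. dirichlet_at \<xi> f (F \<xi>)) \<in> borel_measurable \<mu>"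
    unfolding measurable_mu_iff by (rule dirichlet_at_measurable) measurable
  have Dr: "(\<lambda>\<xi>. dirichlet_at \<xi> (\<lambda>\<zeta>. dilate (r k) f \<zeta> - f \<zeta>) (dilate (r k) f \<xi> - F \<xi>)) \<in> borel_measurable \<mu>" for k
    unfolding measurable_mu_iff by (rule dirichlet_at_measurable) measurable
  have fin': "(\<integral>\<^sup>+ \<xi>. dirichlet_at \<xi> f (F \<xi>) \<partial>\<mu>) < \<infinity>"
    using fin dirichlet_integral_eq[OF fi(1)] by (simp add: F_def)
  have AE: "AE \<xi> in \<mu>. dirichlet_at \<xi> f (F \<xi>) < \<infinity>"
    using nn_integral_PInf_AE[OF Dm] fin' by (auto simp: less_top elim!: eventually_mono)
  have "(\<lambda>k. \<integral>\<^sup>+ \<xi>. dirichlet_at \<xi> (\<lambda>\<zeta>. dilate (r k) f \<zeta> - f \<zeta>) (dilate (r k) f \<xi> - F \<xi>) \<partial>\<mu>)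
    \<longlonglongrightarrow> (\<integral>\<^sup>+ \<xi>. 0 \<partial>\<mu>)"
  proof (rule nn_integral_dominated_convergence[where w="\<lambda>\<xi>. 34 * dirichlet_at \<xi> f (F \<xi>)"])
    show "AE \<xi> in \<mu>. dirichlet_at \<xi> (\<lambda>\<zeta>. dilate (r k) f \<zeta> - f \<zeta>) (dilate (r k) f \<xi> - F \<xi>)
      \<le> 34 * dirichlet_at \<xi> f (F \<xi>)" for k
    proof (rule AE_I2)
      fix \<xi> assume "\<xi> \<in> space \<mu>"
      then have \<xi>: "cmod \<xi> = 1" by (simp add: space_mu)
      have "dirichlet_at \<xi> (\<lambda>\<zeta>. dilate (r k) f \<zeta> - f \<zeta>) (dilate (r k) f \<xi> - F \<xi>)
        \<le> 2 * (dirichlet_at \<xi> (dilate (r k) f) (dilate (r k) f \<xi>) + dirichlet_at \<xi> f (F \<xi>))"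
        by (rule dirichlet_at_diff_le) measurable
      also have "\<dots> \<le> 2 * (16 * dirichlet_at \<xi> f (F \<xi>) + 1 * dirichlet_at \<xi> f (F \<xi>))"
        using dirichlet_at_dilate_le[OF fi(1) r(1) r(2) \<xi>] by (intro mult_left_mono add_mono) auto
      also have "\<dots> = 34 * dirichlet_at \<xi> f (F \<xi>)"
        unfolding distrib_right[symmetric] mult.assoc[symmetric] by simp
      finally show "dirichlet_at \<xi> (\<lambda>\<zeta>. dilate (r k) f \<zeta> - f \<zeta>) (dilate (r k) f \<xi> - F \<xi>)
        \<le> 34 * dirichlet_at \<xi> f (F \<xi>)" .
    qed
    show "AE \<xi> in \<mu>. (\<lambda>k. dirichlet_at \<xi> (\<lambda>\<zeta>. dilate (r k) f \<zeta> - f \<zeta>) (dilate (r k) f \<xi> - F \<xi>)) \<longlonglongrightarrow> 0"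
      using AE AE_space
    proof eventually_elim
      case (elim \<xi>)
      then show ?case using dilate_tendsto_dirichlet_at[OF fL _ _ r, of \<xi> "F \<xi>"] by (simp add: space_mu)
    qed
    show "(\<integral>\<^sup>+ \<xi>. 34 * dirichlet_at \<xi> f (F \<xi>) \<partial>\<mu>) < \<infinity>"
      using fin' Dm by (subst nn_integral_cmult) (auto simp: ennreal_mult_less_top)
    show "(\<lambda>\<xi>. 34 * dirichlet_at \<xi> f (F \<xi>)) \<in> borel_measurable \<mu>" using Dm by measurable
  qed (use Dr in auto)
  then have lim: "(\<lambda>k. (\<integral>\<^sup>+ \<zeta>. abs2 (dilate (r k) f \<zeta> - f \<zeta>) \<partial>\<sigma>) +
     (\<integral>\<^sup>+ \<xi>. dirichlet_at \<xi> (\<lambda>\<zeta>. dilate (r k) f \<zeta> - f \<zeta>) (dilate (r k) f \<xi> - F \<xi>) \<partial>\<mu>)) \<longlonglongrightarrow> 0 + 0"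
    by (intro tendsto_add dilate_tendsto_L2[OF fL r]) simp
  have le: "norm_sq \<mu> (\<lambda>\<zeta>. dilate (r k) f \<zeta> - f \<zeta>) \<le> (\<integral>\<^sup>+ \<zeta>. abs2 (dilate (r k) f \<zeta> - f \<zeta>) \<partial>\<sigma>) +
     (\<integral>\<^sup>+ \<xi>. dirichlet_at \<xi> (\<lambda>\<zeta>. dilate (r k) f \<zeta> - f \<zeta>) (dilate (r k) f \<xi> - F \<xi>) \<partial>\<mu>)" for k
    unfolding norm_sq_def
    by (intro add_left_mono dirichlet_integral_le L2_circle_integrable(1) L2_circle_diff dilate_L2 fL r)
  show ?thesis
    by (rule tendsto_sandwich[OF _ _ tendsto_const lim[simplified]]) (use le in \<open>auto intro!: always_eventually\<close>)
qed

end

section \<open>Capacity of a countable union\<close>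

lemma AE_nn_integral_finite:
  assumes "f \<in> borel_measurable M" "(\<integral>\<^sup>+ x. f x \<partial>M) < \<infinity>"
  shows "AE x in M. f x < \<infinity>"
  using nn_integral_PInf_AE[OF assms(1)] assms(2) by (auto simp: less_top elim!: eventually_mono)

text \<open>A supremum is 1-Lipschitz for the uniform distance. It is formed in
  \<open>ennreal\<close>, where it always exists and stays measurable; finiteness permits the return
  to real numbers by \<open>enn2real\<close>.\<close>

lemma enn2real_SUP_diff_le:
  fixes a b :: "nat \<Rightarrow> real"
  assumes a: "\<And>k. 0 \<le> a k" "(SUP k. ennreal (a k)) < \<infinity>"
    and b: "\<And>k. 0 \<le> b k" "(SUP k. ennreal (b k)) < \<infinity>"
    and s: "\<And>k. \<bar>a k - b k\<bar> \<le> s"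
  shows "\<bar>enn2real (SUP k. ennreal (a k)) - enn2real (SUP k. ennreal (b k))\<bar> \<le> s"
proof -
  have s0: "0 \<le> s" using s[of 0] by simp
  have le: "enn2real (SUP k. ennreal (u k)) \<le> enn2real (SUP k. ennreal (v k)) + s"
    if u: "\<And>k. 0 \<le> u k" and v: "\<And>k. 0 \<le> v k" "(SUP k. ennreal (v k)) < \<infinity>" and uv: "\<And>k. u k \<le> v k + s"
    for u v :: "nat \<Rightarrow> real"
  proof -
    have "(SUP k. ennreal (u k)) \<le> (SUP k. ennreal (v k)) + ennreal s"
    proof (rule SUP_least)
      fix k
      have "ennreal (u k) \<le> ennreal (v k + s)" by (intro ennreal_leI uv)
      also have "\<dots> = ennreal (v k) + ennreal s" using v s0 by (intro ennreal_plus) auto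
      also have "\<dots> \<le> (SUP k. ennreal (v k)) + ennreal s" by (intro add_right_mono SUP_upper) auto
      finally show "ennreal (u k) \<le> (SUP k. ennreal (v k)) + ennreal s" .
    qed
    also have "\<dots> = ennreal (enn2real (SUP k. ennreal (v k)) + s)"
      using v(2) s0 by (subst ennreal_plus) (auto simp: less_top)
    finally show ?thesis
      using s0 by (intro enn2real_leI) auto
  qed
  have ab: "a k \<le> b k + s" "b k \<le> a k + s" for k using s[of k] by (auto simp: abs_le_iff)
  have "enn2real (SUP k. ennreal (a k)) \<le> enn2real (SUP k. ennreal (b k)) + s"
    by (rule le) (use a(1) b ab in auto)
  moreover have "enn2real (SUP k. ennreal (b k)) \<le> enn2real (SUP k. ennreal (a k)) + s"
    by (rule le) (use b(1) a ab in auto)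
  ultimately show ?thesis by linarith
qed

text \<open>Square summability supplies a uniform bound and a finite supremum at once; it is applied
  to values as well as to quotients.\<close>

lemma sum_sq_finite_bound:
  fixes a :: "nat \<Rightarrow> real"
  assumes "(\<Sum>k. ennreal ((a k)\<^sup>2)) < \<infinity>" "\<And>k. 0 \<le> a k"
  obtains T where "0 \<le> T" "(\<Sum>k. ennreal ((a k)\<^sup>2)) = ennreal T" "\<And>k. a k \<le> sqrt T"
    "(SUP k. ennreal (a k)) < \<infinity>"
proof -
  define T where "T = enn2real (\<Sum>k. ennreal ((a k)\<^sup>2))"
  have "ennreal (enn2real (\<Sum>k. ennreal ((a k)\<^sup>2))) = (\<Sum>k. ennreal ((a k)\<^sup>2))"
    using assms(1) unfolding infinity_ennreal_def by (rule ennreal_enn2real)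
  then have T: "0 \<le> T" "(\<Sum>k. ennreal ((a k)\<^sup>2)) = ennreal T"
    by (simp_all only: T_def enn2real_nonneg)
  have le: "a k \<le> sqrt T" for k
  proof (rule real_le_rsqrt)
    have "ennreal ((a k)\<^sup>2) \<le> (\<Sum>k. ennreal ((a k)\<^sup>2))"
      using sum_le_suminf[of "\<lambda>k. ennreal ((a k)\<^sup>2)" "{k}"] by (simp del: suminf_ennreal)
    then show "(a k)\<^sup>2 \<le> T" unfolding T(2) by (simp add: ennreal_le_iff[OF T(1)])
  qed
  have "(SUP k. ennreal (a k)) \<le> ennreal (sqrt T)"
    by (intro SUP_least ennreal_leI le)
  also have "\<dots> < \<infinity>" by simp
  finally show ?thesis by (rule that[OF T le])
qed

context
  fixes \<mu> :: "complex measure"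
  assumes sets_\<mu>: "sets \<mu> = sets circle_borel"
begin

text \<open>The test function is \<open>sup\<^sub>k \<bar>f\<^sub>k\<bar>\<close>; its Dirichlet quotients are dominated by the
  \<open>\<ell>\<^sup>2\<close>-norms of those of the \<open>f\<^sub>k\<close>.\<close>
lemma capacity_le_suminf:
  assumes f: "\<And>k. f k \<in> harmonic_dirichlet_space \<mu>"
    and U: "openin (top_of_set unit_circle) U" "E \<subseteq> U"
    and cover: "AE \<zeta> in \<sigma>. \<zeta> \<in> U \<longrightarrow> (\<exists>k. 1 \<le> cmod (f k \<zeta>))"
  shows "capacity \<mu> E \<le> (\<Sum>k. norm_sq \<mu> (f k))"
proof (cases "(\<Sum>k. norm_sq \<mu> (f k)) < \<infinity>")
  case False
  then have "(\<Sum>k. norm_sq \<mu> (f k)) = top" by (metis infinity_ennreal_def top.not_eq_extremum)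
  then show ?thesis by (metis top_greatest)
next
  case True
  have fL: "f k \<in> L2_circle" for k using f[of k] by (simp add: harmonic_dirichlet_space_def)
  note fi = L2_circle_integrable(1)[OF fL] and fm [measurable] = L2_circle_integrable(2)[OF fL]
  \<comment> \<open>\<open>enn2real\<close> sends an infinite supremum to 0; this can occur only
    where \<open>S\<close> is infinite, which is a null set in the case at hand.\<close>
  define w where "w \<zeta> = complex_of_real (enn2real (SUP k. ennreal (cmod (f k \<zeta>))))" for \<zeta>
  define S where "S \<zeta> = (\<Sum>k. abs2 (f k \<zeta>))" for \<zeta>
  have [measurable]: "w \<in> borel_measurable \<sigma>" "S \<in> borel_measurable \<sigma>"
    unfolding w_def S_def by measurable
  have S: "(\<integral>\<^sup>+ \<zeta>. S \<zeta> \<partial>\<sigma>) = (\<Sum>k. \<integral>\<^sup>+ \<zeta>. abs2 (f k \<zeta>) \<partial>\<sigma>)"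
    unfolding S_def by (rule nn_integral_suminf) measurable
  have split: "(\<Sum>k. norm_sq \<mu> (f k)) = (\<integral>\<^sup>+ \<zeta>. S \<zeta> \<partial>\<sigma>) + (\<Sum>k. dirichlet_integral \<mu> (f k))"
    unfolding norm_sq_def S by (rule suminf_add[symmetric]) auto
  have Sfin: "(\<integral>\<^sup>+ \<zeta>. S \<zeta> \<partial>\<sigma>) < \<infinity>"
    using True unfolding split by simp
  then have AES: "AE \<zeta> in \<sigma>. S \<zeta> < \<infinity>"
    by (intro AE_nn_integral_finite) auto
  have wS: "abs2 (w \<zeta>) \<le> S \<zeta>" for \<zeta>
  proof (cases "S \<zeta> < \<infinity>")
    case True
    then obtain T where T: "0 \<le> T" "S \<zeta> = ennreal T" "\<And>k. cmod (f k \<zeta>) \<le> sqrt T"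
      "(SUP k. ennreal (cmod (f k \<zeta>))) < \<infinity>"
      unfolding S_def by (rule sum_sq_finite_bound) auto
    \<comment> \<open>Comparison with the zero sequence turns the Lipschitz property of the supremum
      into a bound for its size.\<close>
    have "\<bar>enn2real (SUP k. ennreal (cmod (f k \<zeta>))) - enn2real (SUP k::nat. ennreal 0)\<bar> \<le> sqrt T"
      using T by (intro enn2real_SUP_diff_le) auto
    then have "cmod (w \<zeta>) \<le> sqrt T" by (simp add: w_def)
    then have "(cmod (w \<zeta>))\<^sup>2 \<le> (sqrt T)\<^sup>2" by (intro power_mono) auto
    then show ?thesis using T by (simp add: ennreal_leI)
  next
    case False
    then have "S \<zeta> = top" by (metis infinity_ennreal_def top.not_eq_extremum)
    then show ?thesis by simp
  qed
  have wL2: "(\<integral>\<^sup>+ \<zeta>. abs2 (w \<zeta>) \<partial>\<sigma>) \<le> (\<integral>\<^sup>+ \<zeta>. S \<zeta> \<partial>\<sigma>)"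
    by (intro nn_integral_mono wS)
  have wL: "w \<in> L2_circle"
    using order_le_less_trans[OF wL2 Sfin] by (simp add: L2_circle_iff)
  define L where "L \<xi> = complex_of_real (enn2real (SUP k. ennreal (cmod (boundary_value (f k) \<xi>))))" for \<xi>
  have Dw: "dirichlet_at \<xi> w (L \<xi>) \<le> (\<Sum>k. dirichlet_at \<xi> (f k) (boundary_value (f k) \<xi>))" for \<xi>
  proof (cases "(\<Sum>k. dirichlet_at \<xi> (f k) (boundary_value (f k) \<xi>)) < \<infinity>")
    case False
    then have "(\<Sum>k. dirichlet_at \<xi> (f k) (boundary_value (f k) \<xi>)) = top" by (metis infinity_ennreal_def top.not_eq_extremum)
    then show ?thesis by (metis top_greatest)
  next
    case fin: True
    define l where "l k = boundary_value (f k) \<xi>" for k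
    define q where "q k \<zeta> = cmod ((f k \<zeta> - l k) / (\<zeta> - \<xi>))" for k \<zeta>
    have [measurable]: "q k \<in> borel_measurable \<sigma>" for k unfolding q_def by measurable
    have Q: "(\<integral>\<^sup>+ \<zeta>. (\<Sum>k. ennreal ((q k \<zeta>)\<^sup>2)) \<partial>\<sigma>) = (\<Sum>k. dirichlet_at \<xi> (f k) (boundary_value (f k) \<xi>))"
      unfolding dirichlet_at_eq q_def l_def by (rule nn_integral_suminf) measurable
    have AEQ: "AE \<zeta> in \<sigma>. (\<Sum>k. ennreal ((q k \<zeta>)\<^sup>2)) < \<infinity>"
    proof (rule AE_nn_integral_finite)
      show "(\<integral>\<^sup>+ \<zeta>. (\<Sum>k. ennreal ((q k \<zeta>)\<^sup>2)) \<partial>\<sigma>) < \<infinity>" unfolding Q by (rule fin)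
    qed measurable
    have fq: "\<bar>cmod (f k \<zeta>) - cmod (l k)\<bar> \<le> q k \<zeta> * cmod (\<zeta> - \<xi>)" if "\<zeta> \<noteq> \<xi>" for k \<zeta>
      using norm_triangle_ineq3[of "f k \<zeta>" "l k"] that by (simp add: q_def norm_divide)
    have "AE \<zeta> in \<sigma>. S \<zeta> < \<infinity> \<and> (\<Sum>k. ennreal ((q k \<zeta>)\<^sup>2)) < \<infinity> \<and> \<zeta> \<noteq> \<xi>"
      using AES AEQ AE_circle_neq[of \<xi>] by eventually_elim auto
    \<comment> \<open>A single point at which both square sums are finite bounds all boundary
      values: \<open>cmod (l k)\<close> is at most \<open>cmod (f k \<zeta>0)\<close> plus the
      quotient there times the distance to \<xi>.\<close>
    then obtain \<zeta>0 where z0: "S \<zeta>0 < \<infinity>" "(\<Sum>k. ennreal ((q k \<zeta>0)\<^sup>2)) < \<infinity>" "\<zeta>0 \<noteq> \<xi>"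
      using eventually_happens'[OF circle.ae_filter_bot] by blast
    obtain T where T: "\<And>k. cmod (f k \<zeta>0) \<le> sqrt T"
      using z0(1) unfolding S_def by (rule sum_sq_finite_bound) auto
    obtain T' where T': "\<And>k. q k \<zeta>0 \<le> sqrt T'"
      using z0(2) by (rule sum_sq_finite_bound) (auto simp: q_def)
    have "cmod (l k) \<le> sqrt T + sqrt T' * cmod (\<zeta>0 - \<xi>)" for k
      using fq[OF z0(3), of k] T[of k] mult_right_mono[OF T'[of k], of "cmod (\<zeta>0 - \<xi>)"] by (auto simp: abs_le_iff)
    then have "(SUP k. ennreal (cmod (l k))) \<le> ennreal (sqrt T + sqrt T' * cmod (\<zeta>0 - \<xi>))"
      by (intro SUP_least ennreal_leI)
    then have lfin: "(SUP k. ennreal (cmod (l k))) < \<infinity>" by (simp add: order_le_less_trans)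
    have "dirichlet_at \<xi> w (L \<xi>) \<le> (\<integral>\<^sup>+ \<zeta>. (\<Sum>k. ennreal ((q k \<zeta>)\<^sup>2)) \<partial>\<sigma>)"
      unfolding dirichlet_at_eq
    proof (rule nn_integral_mono_AE)
      show "AE \<zeta> in \<sigma>. abs2 ((w \<zeta> - L \<xi>) / (\<zeta> - \<xi>)) \<le> (\<Sum>k. ennreal ((q k \<zeta>)\<^sup>2))"
        using AES AEQ AE_circle_neq[of \<xi>]
      proof eventually_elim
        case (elim \<zeta>)
        obtain A where A: "(SUP k. ennreal (cmod (f k \<zeta>))) < \<infinity>"
          using elim(1) unfolding S_def by (rule sum_sq_finite_bound) auto
        obtain T where T: "0 \<le> T" "(\<Sum>k. ennreal ((q k \<zeta>)\<^sup>2)) = ennreal T" "\<And>k. q k \<zeta> \<le> sqrt T"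
          using elim(2) by (rule sum_sq_finite_bound) (auto simp: q_def)
        have "\<bar>enn2real (SUP k. ennreal (cmod (f k \<zeta>))) - enn2real (SUP k. ennreal (cmod (l k)))\<bar> \<le> sqrt T * cmod (\<zeta> - \<xi>)"
        proof (rule enn2real_SUP_diff_le)
          show "\<bar>cmod (f k \<zeta>) - cmod (l k)\<bar> \<le> sqrt T * cmod (\<zeta> - \<xi>)" for k
            using fq[OF elim(3), of k] mult_right_mono[OF T(3)[of k], of "cmod (\<zeta> - \<xi>)"] by auto
        qed (use A lfin in auto)
        then have "cmod (w \<zeta> - L \<xi>) \<le> sqrt T * cmod (\<zeta> - \<xi>)"
          unfolding w_def L_def l_def by (metis norm_of_real of_real_diff)
        then have "cmod ((w \<zeta> - L \<xi>) / (\<zeta> - \<xi>)) \<le> sqrt T"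
          using elim(3) by (simp add: norm_divide divide_le_eq)
        then have "(cmod ((w \<zeta> - L \<xi>) / (\<zeta> - \<xi>)))\<^sup>2 \<le> (sqrt T)\<^sup>2" by (intro power_mono) auto
        then show ?case using T by (simp add: ennreal_leI)
      qed
    qed
    then show ?thesis unfolding Q .
  qed
  have "dirichlet_integral \<mu> w \<le> (\<integral>\<^sup>+ \<xi>. dirichlet_at \<xi> w (L \<xi>) \<partial>\<mu>)"
    by (rule dirichlet_integral_le[OF sets_\<mu> L2_circle_integrable(1)[OF wL]])
  also have "\<dots> \<le> (\<integral>\<^sup>+ \<xi>. (\<Sum>k. dirichlet_at \<xi> (f k) (boundary_value (f k) \<xi>)) \<partial>\<mu>)"
    by (intro nn_integral_mono Dw)
  also have "\<dots> = (\<Sum>k. \<integral>\<^sup>+ \<xi>. dirichlet_at \<xi> (f k) (boundary_value (f k) \<xi>) \<partial>\<mu>)"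
    unfolding measurable_mu_iff[OF sets_\<mu>]
    by (rule nn_integral_suminf)
       (use dirichlet_at_measurable[OF fm boundary_value_measurable[OF fm]] in \<open>simp add: measurable_mu_iff[OF sets_\<mu>]\<close>)
  also have "\<dots> = (\<Sum>k. dirichlet_integral \<mu> (f k))"
    by (simp add: dirichlet_integral_eq[OF sets_\<mu> fi])
  finally have wD: "dirichlet_integral \<mu> w \<le> (\<Sum>k. dirichlet_integral \<mu> (f k))" .
  have wn: "norm_sq \<mu> w \<le> (\<Sum>k. norm_sq \<mu> (f k))"
    unfolding split unfolding norm_sq_def by (intro add_mono wL2 wD)
  have "dirichlet_integral \<mu> w \<le> norm_sq \<mu> w" by (simp add: norm_sq_def)
  then have "w \<in> harmonic_dirichlet_space \<mu>"
    using wL wn True by (auto simp: harmonic_dirichlet_space_def)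
  moreover have "AE \<zeta> in \<sigma>. \<zeta> \<in> U \<longrightarrow> cmod (w \<zeta>) \<ge> 1"
    using AES cover
  proof eventually_elim
    case (elim \<zeta>)
    show ?case
    proof
      assume "\<zeta> \<in> U"
      then obtain k where k: "1 \<le> cmod (f k \<zeta>)" using elim(2) by blast
      obtain A where A: "(SUP k. ennreal (cmod (f k \<zeta>))) < \<infinity>"
        using elim(1) unfolding S_def by (rule sum_sq_finite_bound) auto
      have "ennreal 1 \<le> (SUP k. ennreal (cmod (f k \<zeta>)))"
        using k by (intro SUP_upper2[of k]) (auto intro: ennreal_leI)
      then have "enn2real (ennreal 1) \<le> enn2real (SUP k. ennreal (cmod (f k \<zeta>)))"
        using A by (intro enn2real_mono) auto
      then show "cmod (w \<zeta>) \<ge> 1" by (simp add: w_def)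
    qed
  qed
  ultimately have "capacity \<mu> E \<le> norm_sq \<mu> w"
    unfolding capacity_def using U by (intro Inf_lower) blast
  then show ?thesis using wn by (rule order_trans)
qed

end

section \<open>Localization to an arc\<close>

text \<open>The comparison point \<open>z = (1 - t) * c\<close> has distance \<open>t\<close> from
  the circle: \<open>|\<zeta> - z|^2 \<le> 2 * (|\<zeta> - c|^2 + t^2)\<close> and
  \<open>1 - |z|^2 = t * (2 - t) \<ge> t\<close>. The known mass 1 of the kernel then evaluates
  integrals over chords.\<close>

lemma inverse_chord_le_poisson_kernel:
  assumes c: "cmod c = 1" and \<zeta>: "cmod \<zeta> = 1" and t: "0 < t" "t \<le> 1"
  shows "1 / ((cmod (\<zeta> - c))\<^sup>2 + t\<^sup>2) \<le> 2 / t * poisson_kernel (of_real (1 - t) * c) \<zeta>"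
proof -
  define z where "z = of_real (1 - t) * c"
  have nz: "cmod z = 1 - t" using c t unfolding z_def norm_mult norm_of_real by simp
  have zp: "cmod (\<zeta> - z) > 0"
    using norm_triangle_ineq2[of \<zeta> z] nz \<zeta> t by auto
  have "\<zeta> - z = (\<zeta> - c) + of_real t * c" by (simp add: z_def algebra_simps)
  moreover have "cmod (of_real t * c) = t" using c t by (simp add: norm_mult)
  ultimately have "(cmod (\<zeta> - z))\<^sup>2 \<le> 2 * ((cmod (\<zeta> - c))\<^sup>2 + t\<^sup>2)"
    using norm_add_sq_le[of "\<zeta> - c" "of_real t * c"] by metis
  then have "1 / ((cmod (\<zeta> - c))\<^sup>2 + t\<^sup>2) \<le> 2 / (cmod (\<zeta> - z))\<^sup>2"
    using zp t by (simp add: divide_simps add_nonneg_pos)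
  also have "\<dots> \<le> 2 / t * (t * (2 - t)) / (cmod (\<zeta> - z))\<^sup>2"
    using t by (intro divide_right_mono) (auto simp: field_simps)
  also have "\<dots> = 2 / t * poisson_kernel z \<zeta>"
    unfolding poisson_kernel_def nz by (simp add: power2_eq_square algebra_simps)
  finally show ?thesis by (simp add: z_def)
qed

lemma nn_integral_inverse_chord_le:
  assumes c: "cmod c = 1" and t: "0 < t" "t \<le> 1"
  shows "(\<integral>\<^sup>+ \<zeta>. ennreal (1 / ((cmod (\<zeta> - c))\<^sup>2 + t\<^sup>2)) \<partial>\<sigma>) \<le> ennreal (2 / t)"
proof -
  have z: "cmod (of_real (1 - t) * c) < 1" using c t unfolding norm_mult norm_of_real by simp
  have "(\<integral>\<^sup>+ \<zeta>. ennreal (1 / ((cmod (\<zeta> - c))\<^sup>2 + t\<^sup>2)) \<partial>\<sigma>)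
    \<le> (\<integral>\<^sup>+ \<zeta>. ennreal (2 / t) * ennreal (poisson_kernel (of_real (1 - t) * c) \<zeta>) \<partial>\<sigma>)"
  proof (rule nn_integral_mono)
    fix \<zeta> assume "\<zeta> \<in> space \<sigma>"
    then have "ennreal (1 / ((cmod (\<zeta> - c))\<^sup>2 + t\<^sup>2)) \<le> ennreal (2 / t * poisson_kernel (of_real (1 - t) * c) \<zeta>)"
      using inverse_chord_le_poisson_kernel[OF c _ t] by (intro ennreal_leI) auto
    also have "\<dots> = ennreal (2 / t) * ennreal (poisson_kernel (of_real (1 - t) * c) \<zeta>)"
      using t poisson_kernel_nonneg[OF z] by (intro ennreal_mult) auto
    finally show "ennreal (1 / ((cmod (\<zeta> - c))\<^sup>2 + t\<^sup>2)) \<le>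
      ennreal (2 / t) * ennreal (poisson_kernel (of_real (1 - t) * c) \<zeta>)" .
  qed
  also have "\<dots> = ennreal (2 / t)"
    by (subst nn_integral_cmult) (auto simp: nn_integral_poisson_kernel[OF z] simp del: of_real_diff)
  finally show ?thesis .
qed

text \<open>A chordal disc, not intersected with the circle: the estimates only involve norms, and
  integrals over \<sigma> see only its trace on the circle. \<open>open_arc_eq\<close> identifies
  this trace with an arc for suitable radii.\<close>

definition arc_nhd :: "complex \<Rightarrow> real \<Rightarrow> complex set" where
  "arc_nhd c t = {\<zeta>. cmod (\<zeta> - c) < t}"

lemma arc_nhd_measurable [measurable]: "arc_nhd c t \<in> sets borel"
  unfolding arc_nhd_def by measurable

lemma indicator_arc_nhd_measurable [measurable]:
  "(\<lambda>\<zeta>. indicator (arc_nhd c t) \<zeta> :: ennreal) \<in> borel_measurable \<sigma>"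
  "(\<lambda>\<zeta>. indicator (arc_nhd c t) \<zeta> :: real) \<in> borel_measurable \<sigma>"
  by (rule borel_measurable_circle; measurable)+

text \<open>On the arc the chord integrand with parameter \<open>t\<close> is at least
  \<open>1 / (2 * t^2)\<close>, and \<open>2 * t^2 * (2 / t) = 4 * t\<close>. For
  \<open>t > 1\<close> the total mass 1 is already smaller.\<close>

lemma nn_integral_arc_nhd_le:
  assumes c: "cmod c = 1" and t: "0 < t"
  shows "(\<integral>\<^sup>+ \<zeta>. indicator (arc_nhd c t) \<zeta> \<partial>\<sigma>) \<le> ennreal (4 * t)"
proof (cases "t \<le> 1")
  case True
  have "(\<integral>\<^sup>+ \<zeta>. indicator (arc_nhd c t) \<zeta> \<partial>\<sigma>)
    \<le> (\<integral>\<^sup>+ \<zeta>. ennreal (2 * t\<^sup>2) * ennreal (1 / ((cmod (\<zeta> - c))\<^sup>2 + t\<^sup>2)) \<partial>\<sigma>)"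
  proof (rule nn_integral_mono)
    fix \<zeta>
    have "1 \<le> 2 * t\<^sup>2 * (1 / ((cmod (\<zeta> - c))\<^sup>2 + t\<^sup>2))" if "cmod (\<zeta> - c) < t"
    proof -
      have "(cmod (\<zeta> - c))\<^sup>2 \<le> t\<^sup>2" using that by (intro power_mono) auto
      then show ?thesis using t by (simp add: divide_simps add_nonneg_pos)
    qed
    then show "indicator (arc_nhd c t) \<zeta> \<le> ennreal (2 * t\<^sup>2) * ennreal (1 / ((cmod (\<zeta> - c))\<^sup>2 + t\<^sup>2))"
      by (subst ennreal_mult[symmetric]) (auto simp: arc_nhd_def indicator_def simp del: ennreal_1 simp flip: ennreal_1 intro!: ennreal_leI)
  qed
  also have "\<dots> = ennreal (2 * t\<^sup>2) * (\<integral>\<^sup>+ \<zeta>. ennreal (1 / ((cmod (\<zeta> - c))\<^sup>2 + t\<^sup>2)) \<partial>\<sigma>)"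
    by (rule nn_integral_cmult) measurable
  also have "\<dots> \<le> ennreal (2 * t\<^sup>2) * ennreal (2 / t)"
    by (intro mult_left_mono nn_integral_inverse_chord_le c t True) auto
  also have "\<dots> = ennreal (4 * t)"
    using t by (subst ennreal_mult[symmetric]) (auto simp: power2_eq_square)
  finally show ?thesis .
next
  case False
  have "(\<integral>\<^sup>+ \<zeta>. indicator (arc_nhd c t) \<zeta> \<partial>\<sigma>) \<le> (\<integral>\<^sup>+ \<zeta>. 1 \<partial>\<sigma>)"
    by (intro nn_integral_mono) (auto simp: indicator_def)
  also have "\<dots> = ennreal 1" by (simp add: emeasure_circle_measure_space)
  also have "\<dots> \<le> ennreal (4 * t)" using False by (intro ennreal_leI) auto
  finally show ?thesis .
qed

section \<open>Cutoff functions and their energy\<close>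

definition cutoff :: "complex \<Rightarrow> real \<Rightarrow> real \<Rightarrow> complex \<Rightarrow> real" where
  "cutoff c \<rho> d \<zeta> = max 0 (min 1 ((\<rho> + d - cmod (\<zeta> - c)) / d))"

lemma cutoff_measurable [measurable]: "cutoff c \<rho> d \<in> borel_measurable \<sigma>"
  unfolding cutoff_def by measurable

lemma cutoff_bounds: "0 \<le> cutoff c \<rho> d \<zeta>" "cutoff c \<rho> d \<zeta> \<le> 1"
  by (auto simp: cutoff_def)

lemma cutoff_eq_1: "d > 0 \<Longrightarrow> cmod (\<zeta> - c) \<le> \<rho> \<Longrightarrow> cutoff c \<rho> d \<zeta> = 1"
  by (auto simp: cutoff_def min_def max_def divide_simps split: if_splits)

lemma cutoff_eq_0: "d > 0 \<Longrightarrow> cmod (\<zeta> - c) \<ge> \<rho> + d \<Longrightarrow> cutoff c \<rho> d \<zeta> = 0"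
  by (auto simp: cutoff_def min_def max_def divide_simps split: if_splits)

lemma cutoff_lipschitz:
  assumes d: "d > 0"
  shows "\<bar>cutoff c \<rho> d \<zeta> - cutoff c \<rho> d \<xi>\<bar> \<le> cmod (\<zeta> - \<xi>) / d"
proof -
  have "\<bar>cutoff c \<rho> d \<zeta> - cutoff c \<rho> d \<xi>\<bar>
    \<le> \<bar>(\<rho> + d - cmod (\<zeta> - c)) / d - (\<rho> + d - cmod (\<xi> - c)) / d\<bar>"
    unfolding cutoff_def by linarith
  also have "\<dots> = \<bar>cmod (\<zeta> - c) - cmod (\<xi> - c)\<bar> / d"
    using d by (simp add: diff_divide_distrib[symmetric] abs_minus_commute)
  also have "\<dots> \<le> cmod (\<zeta> - \<xi>) / d"
    using norm_triangle_ineq3[of "\<zeta> - c" "\<xi> - c"] d by (intro divide_right_mono) auto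
  finally show ?thesis .
qed

text \<open>The difference quotient \<open>q\<close> of the cutoff is at most \<open>1 / d\<close>
  and at most \<open>1 / |\<zeta> - \<xi>|\<close>. Together,
  \<open>q^2 * (|\<zeta> - \<xi>|^2 + d^2) \<le> 2\<close>, which is the chord integrand with
  parameter \<open>d\<close>.\<close>

lemma dirichlet_at_cutoff_le:
  assumes \<xi>: "cmod \<xi> = 1" and d: "0 < d" "d \<le> 1"
  shows "dirichlet_at \<xi> (\<lambda>\<zeta>. of_real (cutoff c \<rho> d \<zeta>)) (of_real (cutoff c \<rho> d \<xi>)) \<le> ennreal (4 / d)"
proof -
  have "dirichlet_at \<xi> (\<lambda>\<zeta>. of_real (cutoff c \<rho> d \<zeta>)) (of_real (cutoff c \<rho> d \<xi>))
    \<le> (\<integral>\<^sup>+ \<zeta>. ennreal 2 * ennreal (1 / ((cmod (\<zeta> - \<xi>))\<^sup>2 + d\<^sup>2)) \<partial>\<sigma>)"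
    unfolding dirichlet_at_eq
  proof (rule nn_integral_mono)
    fix \<zeta>
    define q where "q = cmod ((of_real (cutoff c \<rho> d \<zeta>) - of_real (cutoff c \<rho> d \<xi>)) / (\<zeta> - \<xi>))"
    have q: "q = \<bar>cutoff c \<rho> d \<zeta> - cutoff c \<rho> d \<xi>\<bar> / cmod (\<zeta> - \<xi>)"
      unfolding q_def norm_divide by (metis norm_of_real of_real_diff)
    have q0: "q \<ge> 0" by (simp add: q_def)
    have "q * d \<le> 1" unfolding q
      using cutoff_lipschitz[OF d(1), of c \<rho> \<zeta> \<xi>] d by (cases "\<zeta> = \<xi>") (auto simp: field_simps)
    then have 1: "(q * d)\<^sup>2 \<le> 1" using q0 d by (intro power_le_one) auto
    have "q * cmod (\<zeta> - \<xi>) \<le> 1" unfolding q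
      using cutoff_bounds[of c \<rho> d \<zeta>] cutoff_bounds[of c \<rho> d \<xi>] by (cases "\<zeta> = \<xi>") auto
    then have 2: "(q * cmod (\<zeta> - \<xi>))\<^sup>2 \<le> 1" using q0 by (intro power_le_one) auto
    have "q\<^sup>2 * ((cmod (\<zeta> - \<xi>))\<^sup>2 + d\<^sup>2) \<le> 2"
      using 1 2 by (simp add: power_mult_distrib algebra_simps)
    then have "q\<^sup>2 \<le> 2 * (1 / ((cmod (\<zeta> - \<xi>))\<^sup>2 + d\<^sup>2))"
      using d by (simp add: pos_le_divide_eq add_nonneg_pos)
    then have "ennreal (q\<^sup>2) \<le> ennreal (2 * (1 / ((cmod (\<zeta> - \<xi>))\<^sup>2 + d\<^sup>2)))" by (rule ennreal_leI)
    also have "\<dots> = ennreal 2 * ennreal (1 / ((cmod (\<zeta> - \<xi>))\<^sup>2 + d\<^sup>2))"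
      by (intro ennreal_mult) auto
    finally show "abs2 ((of_real (cutoff c \<rho> d \<zeta>) - of_real (cutoff c \<rho> d \<xi>)) / (\<zeta> - \<xi>))
      \<le> ennreal 2 * ennreal (1 / ((cmod (\<zeta> - \<xi>))\<^sup>2 + d\<^sup>2))" by (simp add: q_def)
  qed
  also have "\<dots> = ennreal 2 * (\<integral>\<^sup>+ \<zeta>. ennreal (1 / ((cmod (\<zeta> - \<xi>))\<^sup>2 + d\<^sup>2)) \<partial>\<sigma>)"
    by (rule nn_integral_cmult) measurable
  also have "\<dots> \<le> ennreal 2 * ennreal (2 / d)"
    by (intro mult_left_mono nn_integral_inverse_chord_le \<xi> d) auto
  also have "\<dots> = ennreal (4 / d)"
    using d by (subst ennreal_mult[symmetric]) auto
  finally show ?thesis .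
qed

text \<open>The weight is the factor lost when the mean over the arc is compared with the value at
  \<xi>. Near the arc the unweighted bound \<open>4 / d\<close> suffices. Far away the cutoff
  vanishes at \<xi>, so the integrand lives on the supporting arc and decays like the inverse square
  of the distance, which the weight cancels.\<close>

lemma dirichlet_at_cutoff_weighted:
  assumes c: "cmod c = 1" and \<xi>: "cmod \<xi> = 1" and d: "0 < d" "d \<le> 1" and \<rho>: "0 < \<rho>"
  shows "ennreal ((cmod (\<xi> - c) + \<rho>)\<^sup>2) *
      dirichlet_at \<xi> (\<lambda>\<zeta>. of_real (cutoff c \<rho> d \<zeta>)) (of_real (cutoff c \<rho> d \<xi>))
    \<le> ennreal (16 * (\<rho> + d) ^ 3 / d\<^sup>2)"
proof -
  define e where "e = cmod (\<xi> - c)"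
  define D where "D = dirichlet_at \<xi> (\<lambda>\<zeta>. of_real (cutoff c \<rho> d \<zeta>)) (of_real (cutoff c \<rho> d \<xi>))"
  have e0: "e \<ge> 0" by (simp add: e_def)
  have "ennreal ((e + \<rho>)\<^sup>2) * D \<le> ennreal (16 * (\<rho> + d) ^ 3 / d\<^sup>2)"
  proof (cases "e < \<rho> + 2 * d")
    case True
    have "ennreal ((e + \<rho>)\<^sup>2) * D \<le> ennreal ((2 * (\<rho> + d))\<^sup>2) * ennreal (4 / d)"
      unfolding D_def using True e0 \<rho> d
      by (intro mult_mono dirichlet_at_cutoff_le[OF \<xi> d] ennreal_leI power_mono) auto
    also have "\<dots> = ennreal ((2 * (\<rho> + d))\<^sup>2 * (4 / d))"
      using d by (intro ennreal_mult[symmetric]) auto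
    also have "\<dots> \<le> ennreal (16 * (\<rho> + d) ^ 3 / d\<^sup>2)"
    proof (rule ennreal_leI)
      have "(2 * (\<rho> + d))\<^sup>2 * (4 / d) = 16 * (\<rho> + d)\<^sup>2 / d"
        unfolding power_mult_distrib by simp
      also have "\<dots> = 16 * (\<rho> + d)\<^sup>2 * d / d\<^sup>2" using d by (simp add: power2_eq_square)
      also have "\<dots> \<le> 16 * (\<rho> + d)\<^sup>2 * (\<rho> + d) / d\<^sup>2"
        using \<rho> d by (intro divide_right_mono mult_left_mono) auto
      finally show "(2 * (\<rho> + d))\<^sup>2 * (4 / d) \<le> 16 * (\<rho> + d) ^ 3 / d\<^sup>2"
        by (simp add: power3_eq_cube power2_eq_square mult.assoc)
    qed
    finally show ?thesis .
  next
    case False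
    \<comment> \<open>\<open>K\<close> bounds \<open>1 / |\<zeta> - \<xi>|^2\<close> on the support;
      multiplication by \<open>(e + \<rho>)^2\<close> removes its dependence on \<xi>.\<close>
    define K where "K = (2 * (\<rho> + d) / (d * (e + \<rho>)))\<^sup>2"
    have "D \<le> (\<integral>\<^sup>+ \<zeta>. ennreal K * indicator (arc_nhd c (\<rho> + d)) \<zeta> \<partial>\<sigma>)"
      unfolding D_def dirichlet_at_eq
    proof (rule nn_integral_mono)
      fix \<zeta>
      have \<phi>\<xi>: "cutoff c \<rho> d \<xi> = 0" using False d by (intro cutoff_eq_0) (auto simp: e_def)
      show "abs2 ((of_real (cutoff c \<rho> d \<zeta>) - of_real (cutoff c \<rho> d \<xi>)) / (\<zeta> - \<xi>))
        \<le> ennreal K * indicator (arc_nhd c (\<rho> + d)) \<zeta>"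
      proof (cases "\<zeta> \<in> arc_nhd c (\<rho> + d)")
        case True
        then have lt: "cmod (\<zeta> - c) < \<rho> + d" by (simp add: arc_nhd_def)
        have "e \<le> cmod (\<zeta> - \<xi>) + cmod (\<zeta> - c)"
          using norm_triangle_ineq[of "\<xi> - \<zeta>" "\<zeta> - c"] by (simp add: e_def norm_minus_commute)
        then have far: "e - \<rho> - d \<le> cmod (\<zeta> - \<xi>)" using lt by linarith
        \<comment> \<open>The difference of the two sides factors as
          \<open>(2 * \<rho> + d) * (e - \<rho> - 2 * d)\<close>; this is the reason for the
          threshold \<open>\<rho> + 2 * d\<close> in the case split.\<close>
        have "d * (e + \<rho>) \<le> 2 * (\<rho> + d) * (e - \<rho> - d)"
        proof -
          have "2 * (\<rho> + d) * (e - \<rho> - d) - d * (e + \<rho>) = (2 * \<rho> + d) * (e - \<rho> - 2 * d)"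
            by (simp add: algebra_simps power2_eq_square)
          moreover have "0 \<le> (2 * \<rho> + d) * (e - \<rho> - 2 * d)" using False \<rho> d by (intro mult_nonneg_nonneg) auto
          ultimately show ?thesis by linarith
        qed
        also have "\<dots> \<le> 2 * (\<rho> + d) * cmod (\<zeta> - \<xi>)" using far \<rho> d by (intro mult_left_mono) auto
        finally have m: "d * (e + \<rho>) \<le> 2 * (\<rho> + d) * cmod (\<zeta> - \<xi>)" .
        have pos: "0 < d * (e + \<rho>)" using d e0 \<rho> by simp
        then have "0 < 2 * (\<rho> + d) * cmod (\<zeta> - \<xi>)" using m by linarith
        then have nz: "cmod (\<zeta> - \<xi>) > 0" using \<rho> d by (simp add: zero_less_mult_iff)
        have "cmod ((of_real (cutoff c \<rho> d \<zeta>) - of_real (cutoff c \<rho> d \<xi>)) / (\<zeta> - \<xi>)) \<le> 1 / cmod (\<zeta> - \<xi>)"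
          using cutoff_bounds[of c \<rho> d \<zeta>] nz by (simp add: \<phi>\<xi> norm_divide divide_right_mono)
        also have "\<dots> \<le> 2 * (\<rho> + d) / (d * (e + \<rho>))"
          using m pos nz by (simp add: divide_simps mult.commute)
        finally have "(cmod ((of_real (cutoff c \<rho> d \<zeta>) - of_real (cutoff c \<rho> d \<xi>)) / (\<zeta> - \<xi>)))\<^sup>2 \<le> K"
          unfolding K_def by (intro power_mono) auto
        then show ?thesis using True by (simp add: ennreal_leI)
      next
        case False
        then have "cutoff c \<rho> d \<zeta> = 0" using d by (intro cutoff_eq_0) (auto simp: arc_nhd_def)
        then show ?thesis by (simp add: \<phi>\<xi>)
      qed
    qed
    also have "\<dots> = ennreal K * (\<integral>\<^sup>+ \<zeta>. indicator (arc_nhd c (\<rho> + d)) \<zeta> \<partial>\<sigma>)"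
      by (rule nn_integral_cmult) measurable
    also have "\<dots> \<le> ennreal K * ennreal (4 * (\<rho> + d))"
      using \<rho> d by (intro mult_left_mono nn_integral_arc_nhd_le[OF c]) auto
    finally have "ennreal ((e + \<rho>)\<^sup>2) * D \<le> ennreal ((e + \<rho>)\<^sup>2) * (ennreal K * ennreal (4 * (\<rho> + d)))"
      by (rule mult_left_mono) simp
    also have "\<dots> = ennreal ((e + \<rho>)\<^sup>2 * (K * (4 * (\<rho> + d))))"
      using \<rho> d by (subst ennreal_mult[symmetric]; (subst ennreal_mult[symmetric])?) (auto simp: K_def)
    also have "(e + \<rho>)\<^sup>2 * (K * (4 * (\<rho> + d))) = 16 * (\<rho> + d) ^ 3 / d\<^sup>2"
    proof -
      have "e + \<rho> \<noteq> 0" using e0 \<rho> by linarith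
      then show ?thesis
        unfolding K_def using d by (simp add: divide_simps) (simp add: power2_eq_square power3_eq_cube algebra_simps)
    qed
    finally show ?thesis .
  qed
  then show ?thesis by (simp add: e_def D_def)
qed

section \<open>Means of the modulus over an arc\<close>

definition circle_mean :: "complex set \<Rightarrow> (complex \<Rightarrow> complex) \<Rightarrow> real" where
  "circle_mean I f = (LINT \<zeta>|\<sigma>. indicator I \<zeta> * cmod (f \<zeta>)) / measure \<sigma> I"

lemma integrable_indicator_norm:
  assumes f: "integrable \<sigma> f" and I: "I \<in> sets \<sigma>"
  shows "integrable \<sigma> (\<lambda>\<zeta>. indicator I \<zeta> * cmod (f \<zeta>))"
  using integrable_mult_indicator[OF I integrable_norm[OF f]] by simp

lemma circle_mean_nonneg: "circle_mean I f \<ge> 0"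
  unfolding circle_mean_def by (intro divide_nonneg_nonneg Bochner_Integration.integral_nonneg) auto

lemma nn_integral_indicator_circle:
  assumes I: "I \<in> sets \<sigma>"
  shows "(\<integral>\<^sup>+ \<zeta>. ennreal (indicator I \<zeta>) \<partial>\<sigma>) = ennreal (measure \<sigma> I)"
proof -
  have "(\<integral>\<^sup>+ \<zeta>. ennreal (indicator I \<zeta>) \<partial>\<sigma>) = (\<integral>\<^sup>+ \<zeta>. indicator I \<zeta> \<partial>\<sigma>)"
    by (intro nn_integral_cong) (auto simp: indicator_def)
  also have "\<dots> = emeasure \<sigma> I" using I by (rule nn_integral_indicator)
  finally show ?thesis by (simp add: circle.emeasure_eq_measure)
qed

text \<open>Cauchy-Schwarz on \<open>I\<close> together with
  \<open>||f| - |l|| \<le> |f - l|\<close>: the square of an average is at most the average of the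
  square.\<close>

lemma circle_mean_deviation:
  assumes f: "integrable \<sigma> f" and I: "I \<in> sets \<sigma>" and p: "measure \<sigma> I > 0"
  shows "ennreal (measure \<sigma> I * (circle_mean I f - cmod l)\<^sup>2)
    \<le> (\<integral>\<^sup>+ \<zeta>. ennreal (indicator I \<zeta> * (cmod (f \<zeta> - l))\<^sup>2) \<partial>\<sigma>)" (is "_ \<le> ?Y")
proof -
  define p where "p = measure \<sigma> I"
  define \<kappa> where "\<kappa> = circle_mean I f - cmod l"
  have p0: "p > 0" using p by (simp add: p_def)
  have [measurable]: "f \<in> borel_measurable \<sigma>" "(\<lambda>\<zeta>. indicator I \<zeta> :: real) \<in> borel_measurable \<sigma>"
    using f borel_measurable_indicator[OF I] by auto
  have il: "integrable \<sigma> (\<lambda>\<zeta>. indicator I \<zeta> * cmod l)"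
    using integrable_indicator_norm[OF _ I, of "\<lambda>_. l"] by simp
  have ll: "(LINT \<zeta>|\<sigma>. indicator I \<zeta> * cmod l) = p * cmod l"
  proof -
    have "(LINT \<zeta>|\<sigma>. indicator I \<zeta>) = p"
      using Bochner_Integration.integral_indicator[of \<sigma> I] sets.sets_into_space[OF I]
      by (simp add: p_def Int_absorb2)
    then show ?thesis by simp
  qed
  have "p * \<kappa> = (LINT \<zeta>|\<sigma>. indicator I \<zeta> * cmod (f \<zeta>)) - (LINT \<zeta>|\<sigma>. indicator I \<zeta> * cmod l)"
    unfolding ll \<kappa>_def circle_mean_def using p0 by (simp add: p_def[symmetric] algebra_simps)
  also have "\<dots> = (LINT \<zeta>|\<sigma>. indicator I \<zeta> * cmod (f \<zeta>) - indicator I \<zeta> * cmod l)"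
    by (rule Bochner_Integration.integral_diff[symmetric, OF integrable_indicator_norm[OF f I] il])
  finally have "ennreal (norm (p * \<kappa>)) \<le> (\<integral>\<^sup>+ \<zeta>. ennreal (norm (indicator I \<zeta> * cmod (f \<zeta>) - indicator I \<zeta> * cmod l)) \<partial>\<sigma>)"
    using integral_norm_bound_ennreal[OF Bochner_Integration.integrable_diff[OF integrable_indicator_norm[OF f I] il]] by simp
  also have "\<dots> \<le> (\<integral>\<^sup>+ \<zeta>. ennreal (indicator I \<zeta> * (indicator I \<zeta> * cmod (f \<zeta> - l))) \<partial>\<sigma>)"
    using norm_triangle_ineq3[of "f _" l]
    by (intro nn_integral_mono ennreal_leI) (auto simp: indicator_def)
  finally have "(ennreal (norm (p * \<kappa>)))\<^sup>2 \<le> (\<integral>\<^sup>+ \<zeta>. ennreal (indicator I \<zeta> * (indicator I \<zeta> * cmod (f \<zeta> - l))) \<partial>\<sigma>)\<^sup>2"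
    by (intro power_mono) auto
  also have "\<dots> \<le> (\<integral>\<^sup>+ \<zeta>. ennreal ((indicator I \<zeta>)\<^sup>2) \<partial>\<sigma>) * (\<integral>\<^sup>+ \<zeta>. ennreal ((indicator I \<zeta> * cmod (f \<zeta> - l))\<^sup>2) \<partial>\<sigma>)"
    by (rule Cauchy_Schwarz_nn_integral_real) auto
  also have "(\<integral>\<^sup>+ \<zeta>. ennreal ((indicator I \<zeta>)\<^sup>2) \<partial>\<sigma>) = ennreal p"
  proof -
    have "(\<integral>\<^sup>+ \<zeta>. ennreal ((indicator I \<zeta>)\<^sup>2) \<partial>\<sigma>) = (\<integral>\<^sup>+ \<zeta>. ennreal (indicator I \<zeta>) \<partial>\<sigma>)"
      by (intro nn_integral_cong) (auto simp: indicator_def)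
    then show ?thesis using nn_integral_indicator_circle[OF I] by (simp add: p_def)
  qed
  also have "(\<integral>\<^sup>+ \<zeta>. ennreal ((indicator I \<zeta> * cmod (f \<zeta> - l))\<^sup>2) \<partial>\<sigma>) = ?Y"
    by (intro nn_integral_cong) (auto simp: indicator_def)
  finally have le: "ennreal ((p * \<kappa>)\<^sup>2) \<le> ennreal p * ?Y"
    by (simp add: ennreal_power)
  have "ennreal (p * \<kappa>\<^sup>2) = ennreal (1/p) * ennreal ((p * \<kappa>)\<^sup>2)"
  proof -
    have "ennreal (1/p) * ennreal ((p * \<kappa>)\<^sup>2) = ennreal (1/p * (p * \<kappa>)\<^sup>2)"
      using p0 by (intro ennreal_mult[symmetric]) auto
    also have "1/p * (p * \<kappa>)\<^sup>2 = p * \<kappa>\<^sup>2" using p0 by (simp add: power2_eq_square)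
    finally show ?thesis by (rule sym)
  qed
  also have "\<dots> \<le> ennreal (1/p) * (ennreal p * ?Y)" by (intro mult_left_mono le) auto
  also have "\<dots> = ?Y"
    using p0 by (simp add: mult.assoc[symmetric] ennreal_mult[symmetric])
  finally show ?thesis by (simp add: p_def \<kappa>_def)
qed

lemma dirichlet_on_mono: "A \<subseteq> B \<Longrightarrow> dirichlet_on A \<xi> f l \<le> dirichlet_on B \<xi> f l"
  unfolding dirichlet_on_def by (intro nn_integral_mono mult_left_mono) (auto simp: indicator_def)

lemma dirichlet_on_Int_circle: "dirichlet_on (A \<inter> unit_circle) \<xi> f l = dirichlet_on A \<xi> f l"
  unfolding dirichlet_on_def by (rule nn_integral_cong) (simp add: indicator_def)

text \<open>For \<zeta> in \<open>I\<close> the distance to \<xi> is at most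
  \<open>|\<xi> - c| + \<rho>\<close>, so the quotient controls \<open>f - l\<close>. The growth of
  the factor with the distance of \<xi> is compensated by
  \<open>dirichlet_at_cutoff_weighted\<close>.\<close>

lemma circle_mean_deviation_dirichlet:
  assumes f: "integrable \<sigma> f" and I: "I \<in> sets \<sigma>" and p: "measure \<sigma> I > 0"
    and sub: "\<And>\<zeta>. \<zeta> \<in> I \<Longrightarrow> cmod (\<zeta> - c) \<le> \<rho>"
  shows "ennreal (measure \<sigma> I * (circle_mean I f - cmod l)\<^sup>2)
    \<le> ennreal ((cmod (\<xi> - c) + \<rho>)\<^sup>2) * dirichlet_on I \<xi> f l"
proof -
  have [measurable]: "f \<in> borel_measurable \<sigma>" "(\<lambda>\<zeta>. indicator I \<zeta> :: real) \<in> borel_measurable \<sigma>"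
    "(\<lambda>\<zeta>. indicator I \<zeta> :: ennreal) \<in> borel_measurable \<sigma>"
    using f borel_measurable_indicator[OF I] by auto
  have "ennreal (measure \<sigma> I * (circle_mean I f - cmod l)\<^sup>2)
    \<le> (\<integral>\<^sup>+ \<zeta>. ennreal (indicator I \<zeta> * (cmod (f \<zeta> - l))\<^sup>2) \<partial>\<sigma>)"
    by (rule circle_mean_deviation[OF f I p])
  also have "\<dots> \<le> (\<integral>\<^sup>+ \<zeta>. ennreal ((cmod (\<xi> - c) + \<rho>)\<^sup>2) * (abs2 ((f \<zeta> - l) / (\<zeta> - \<xi>)) * indicator I \<zeta>) \<partial>\<sigma>)"
  proof (rule nn_integral_mono_AE, rule eventually_mono[OF AE_circle_neq[of \<xi>]])
    fix \<zeta> assume ne: "\<zeta> \<noteq> \<xi>"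
    show "ennreal (indicator I \<zeta> * (cmod (f \<zeta> - l))\<^sup>2) \<le>
      ennreal ((cmod (\<xi> - c) + \<rho>)\<^sup>2) * (abs2 ((f \<zeta> - l) / (\<zeta> - \<xi>)) * indicator I \<zeta>)"
    proof (cases "\<zeta> \<in> I")
      case True
      have "cmod (\<zeta> - \<xi>) \<le> cmod (\<zeta> - c) + cmod (\<xi> - c)"
        using norm_triangle_ineq4[of "\<zeta> - c" "\<xi> - c"] by simp
      then have d: "(cmod (\<zeta> - \<xi>))\<^sup>2 \<le> (cmod (\<xi> - c) + \<rho>)\<^sup>2"
        using sub[OF True] by (intro power_mono) auto
      have "(cmod (f \<zeta> - l))\<^sup>2 = (cmod (\<zeta> - \<xi>))\<^sup>2 * (cmod ((f \<zeta> - l) / (\<zeta> - \<xi>)))\<^sup>2"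
        using ne by (simp add: norm_divide power_divide)
      also have "\<dots> \<le> (cmod (\<xi> - c) + \<rho>)\<^sup>2 * (cmod ((f \<zeta> - l) / (\<zeta> - \<xi>)))\<^sup>2"
        by (intro mult_right_mono d) auto
      finally show ?thesis using True by (simp add: ennreal_mult[symmetric] ennreal_leI)
    qed simp
  qed
  also have "\<dots> = ennreal ((cmod (\<xi> - c) + \<rho>)\<^sup>2) * dirichlet_on I \<xi> f l"
    unfolding dirichlet_on_def by (rule nn_integral_cmult) measurable
  finally show ?thesis .
qed

text \<open>This function equals \<open>m - \<bar>f\<bar>\<close> on \<open>I\<close>, so it is close to the mean \<open>m\<close> of
  \<open>\<bar>f\<bar>\<close> wherever \<open>f\<close> is small.\<close>
definition mean_cutoff :: "complex \<Rightarrow> real \<Rightarrow> real \<Rightarrow> complex set \<Rightarrow> (complex \<Rightarrow> complex) \<Rightarrow> complex \<Rightarrow> complex" where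
  "mean_cutoff c \<rho> d I f \<zeta> = of_real (cutoff c \<rho> d \<zeta> * (circle_mean I f - cmod (f \<zeta>)))"

text \<open>The bracket contains 1 for the variation of the modulus of \<open>f\<close> and a second
  term for the variation of the cutoff; the 2 in front comes from squaring a sum. It is homogeneous
  of degree 0 in \<open>\<rho>\<close>, \<open>d\<close>, \<open>p\<close>, hence invariant under
  scaling of the arc.\<close>

definition local_const :: "real \<Rightarrow> real \<Rightarrow> real \<Rightarrow> real" where
  "local_const \<rho> d p = 2 * (1 + 16 * (\<rho> + d) ^ 3 / d\<^sup>2 / p)"

text \<open>\<open>I\<close> lies within chordal distance \<open>\<rho>\<close> of \<open>c\<close>,
  and \<open>d\<close> is the width of the collar in which the cutoff falls to 0. The range
  \<open>d \<le> 1\<close> is that of the parameter in the chord integrals.\<close>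

locale arc_setting =
  fixes c :: complex and \<rho> d :: real and I :: "complex set"
  assumes c: "cmod c = 1" and \<rho>: "0 < \<rho>" and d: "0 < d" "d \<le> 1"
    and I: "I \<in> sets \<sigma>" and p: "measure \<sigma> I > 0"
    and sub: "\<And>\<zeta>. \<zeta> \<in> I \<Longrightarrow> cmod (\<zeta> - c) \<le> \<rho>"
begin

abbreviation "K \<equiv> local_const \<rho> d (measure \<sigma> I)"

lemma I_subset: "I \<subseteq> arc_nhd c (\<rho> + d)"
  using sub d by (fastforce simp: arc_nhd_def)

text \<open>The increment splits into \<open>\<phi> \<zeta> * (|l| - |f \<zeta>|)\<close>, supported
  near the arc and dominated by the increment of \<open>f\<close>, and
  \<open>\<kappa> * (\<phi> \<zeta> - \<phi> \<xi>)\<close>, where \<open>\<kappa>\<close> is the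
  deviation of the mean from \<open>|l|\<close>. The second part becomes local energy because the
  weight in the bound for \<open>\<kappa>\<close> is the one that the energy of the cutoff
  absorbs.\<close>

lemma mean_cutoff_dirichlet:
  assumes f: "integrable \<sigma> f" and \<xi>: "cmod \<xi> = 1"
  shows "dirichlet_at \<xi> (mean_cutoff c \<rho> d I f) (of_real (cutoff c \<rho> d \<xi> * (circle_mean I f - cmod l)))
    \<le> ennreal K * dirichlet_on (arc_nhd c (\<rho> + d)) \<xi> f l"
proof -
  define p where "p = measure \<sigma> I"
  have p0: "p > 0" using p by (simp add: p_def)
  define \<phi> where "\<phi> = cutoff c \<rho> d"
  define \<kappa> where "\<kappa> = circle_mean I f - cmod l"
  define B where "B = arc_nhd c (\<rho> + d)"
  define D\<phi> where "D\<phi> = dirichlet_at \<xi> (\<lambda>\<zeta>. of_real (\<phi> \<zeta>)) (of_real (\<phi> \<xi>))"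
  define M where "M = 16 * (\<rho> + d) ^ 3 / d\<^sup>2"
  have M0: "M \<ge> 0" using \<rho> d by (simp add: M_def)
  have [measurable]: "f \<in> borel_measurable \<sigma>" using f by auto
  have [measurable]: "\<phi> \<in> borel_measurable \<sigma>" by (simp add: \<phi>_def)
  have [measurable]: "B \<in> sets borel" by (simp add: B_def)
  define F1 where "F1 \<zeta> = of_real (\<phi> \<zeta> * (cmod l - cmod (f \<zeta>))) / (\<zeta> - \<xi>)" for \<zeta>
  define F2 where "F2 \<zeta> = of_real \<kappa> * ((of_real (\<phi> \<zeta>) - of_real (\<phi> \<xi>)) / (\<zeta> - \<xi>))" for \<zeta>
  have [measurable]: "F1 \<in> borel_measurable \<sigma>" "F2 \<in> borel_measurable \<sigma>"
    unfolding F1_def F2_def by measurable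
  have "(mean_cutoff c \<rho> d I f \<zeta> - of_real (\<phi> \<xi> * \<kappa>)) / (\<zeta> - \<xi>) = F1 \<zeta> + F2 \<zeta>" for \<zeta>
    unfolding F1_def F2_def mean_cutoff_def \<phi>_def[symmetric] times_divide_eq_right add_divide_distrib[symmetric]
    by (simp add: \<kappa>_def algebra_simps)
  then have "dirichlet_at \<xi> (mean_cutoff c \<rho> d I f) (of_real (\<phi> \<xi> * \<kappa>)) =
     (\<integral>\<^sup>+ \<zeta>. abs2 (F1 \<zeta> + F2 \<zeta>) \<partial>\<sigma>)"
    unfolding dirichlet_at_eq by simp
  also have "\<dots> \<le> 2 * ((\<integral>\<^sup>+ \<zeta>. abs2 (F1 \<zeta>) \<partial>\<sigma>) + (\<integral>\<^sup>+ \<zeta>. abs2 (F2 \<zeta>) \<partial>\<sigma>))"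
    by (rule nn_integral_add_sq_le) auto
  also have "\<dots> \<le> 2 * (dirichlet_on B \<xi> f l + ennreal (M / p) * dirichlet_on B \<xi> f l)"
  proof (intro mult_left_mono add_mono)
    show "(\<integral>\<^sup>+ \<zeta>. abs2 (F1 \<zeta>) \<partial>\<sigma>) \<le> dirichlet_on B \<xi> f l"
      unfolding dirichlet_on_def
    proof (rule nn_integral_mono)
      fix \<zeta>
      show "abs2 (F1 \<zeta>) \<le> abs2 ((f \<zeta> - l) / (\<zeta> - \<xi>)) * indicator B \<zeta>"
      proof (cases "\<zeta> \<in> B")
        case True
        have "cmod (F1 \<zeta>) = \<phi> \<zeta> * \<bar>cmod l - cmod (f \<zeta>)\<bar> / cmod (\<zeta> - \<xi>)"
          unfolding F1_def norm_divide norm_of_real abs_mult using cutoff_bounds[of c \<rho> d \<zeta>] by (simp add: \<phi>_def)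
        also have "\<dots> \<le> 1 * cmod (f \<zeta> - l) / cmod (\<zeta> - \<xi>)"
          using cutoff_bounds[of c \<rho> d \<zeta>] norm_triangle_ineq3[of l "f \<zeta>"]
          by (intro divide_right_mono mult_mono) (auto simp: \<phi>_def norm_minus_commute)
        finally have "cmod (F1 \<zeta>) \<le> cmod ((f \<zeta> - l) / (\<zeta> - \<xi>))" by (simp add: norm_divide)
        then show ?thesis using True by (simp add: ennreal_leI power_mono)
      next
        case False
        then have "\<phi> \<zeta> = 0" unfolding \<phi>_def using d by (intro cutoff_eq_0) (auto simp: B_def arc_nhd_def)
        then show ?thesis by (simp add: F1_def)
      qed
    qed
    have "(\<integral>\<^sup>+ \<zeta>. abs2 (F2 \<zeta>) \<partial>\<sigma>) =
      (\<integral>\<^sup>+ \<zeta>. ennreal (\<kappa>\<^sup>2) * abs2 ((of_real (\<phi> \<zeta>) - of_real (\<phi> \<xi>)) / (\<zeta> - \<xi>)) \<partial>\<sigma>)"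
      unfolding F2_def norm_mult power_mult_distrib by (simp add: ennreal_mult)
    also have "\<dots> = ennreal (\<kappa>\<^sup>2) * D\<phi>"
      unfolding D\<phi>_def dirichlet_at_eq by (rule nn_integral_cmult) measurable
    \<comment> \<open>Multiplying and dividing by \<open>p\<close> prepares the mean deviation
      estimate, which trades \<open>\<kappa>\<close> for an energy over \<open>I\<close>; its weight
      is then paired with \<open>D\<phi>\<close>.\<close>
    also have "ennreal (\<kappa>\<^sup>2) = ennreal (1 / p) * ennreal (p * \<kappa>\<^sup>2)"
      using p0 by (subst ennreal_mult[symmetric]) auto
    also have "\<dots> * D\<phi> \<le> ennreal (1 / p) * (ennreal ((cmod (\<xi> - c) + \<rho>)\<^sup>2) * dirichlet_on I \<xi> f l) * D\<phi>"
      unfolding p_def \<kappa>_def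
      by (intro mult_right_mono mult_left_mono circle_mean_deviation_dirichlet[OF f I p sub]) auto
    also have "\<dots> = ennreal (1 / p) * (ennreal ((cmod (\<xi> - c) + \<rho>)\<^sup>2) * D\<phi>) * dirichlet_on I \<xi> f l"
      by (simp add: mult_ac)
    also have "\<dots> \<le> ennreal (1 / p) * ennreal M * dirichlet_on B \<xi> f l"
      unfolding D\<phi>_def \<phi>_def M_def B_def
      by (intro mult_mono order_refl dirichlet_at_cutoff_weighted[OF c \<xi> d \<rho>] dirichlet_on_mono I_subset) auto
    also have "ennreal (1 / p) * ennreal M = ennreal (M / p)"
      using p0 M0 by (subst ennreal_mult[symmetric]) auto
    finally show "(\<integral>\<^sup>+ \<zeta>. abs2 (F2 \<zeta>) \<partial>\<sigma>) \<le> ennreal (M / p) * dirichlet_on B \<xi> f l" .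
  qed auto
  also have "\<dots> = ennreal K * dirichlet_on B \<xi> f l"
  proof -
    have "ennreal (2 * (1 + M / p)) = ennreal 2 * ennreal (1 + M / p)" using M0 p0 by (intro ennreal_mult) auto
    also have "ennreal (1 + M / p) = ennreal 1 + ennreal (M / p)" using M0 p0 by (intro ennreal_plus) auto
    finally have e: "ennreal K = 2 * (1 + ennreal (M / p))"
      by (simp add: local_const_def M_def p_def)
    show ?thesis unfolding e mult.assoc by (simp add: distrib_right)
  qed
  finally show ?thesis by (simp add: \<phi>_def \<kappa>_def B_def)
qed

text \<open>The constant \<open>m\<close> costs \<open>m^2\<close> times the measure of the
  supporting arc, while \<open>p * m^2\<close> is at most the integral of \<open>|f|^2\<close> over
  \<open>I\<close>, by the mean deviation estimate with \<open>l = 0\<close>. The ratio of the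
  measures is absorbed by the constant because \<open>4 * (\<rho> + d) \<le> M\<close>.\<close>

lemma mean_cutoff_L2:
  assumes f: "integrable \<sigma> f"
  shows "(\<integral>\<^sup>+ \<zeta>. abs2 (mean_cutoff c \<rho> d I f \<zeta>) \<partial>\<sigma>)
    \<le> ennreal K * (\<integral>\<^sup>+ \<zeta>. abs2 (f \<zeta>) * indicator (arc_nhd c (\<rho> + d)) \<zeta> \<partial>\<sigma>)"
proof -
  define p where "p = measure \<sigma> I"
  have p0: "p > 0" using p by (simp add: p_def)
  define m where "m = circle_mean I f"
  define B where "B = arc_nhd c (\<rho> + d)"
  define M where "M = 16 * (\<rho> + d) ^ 3 / d\<^sup>2"
  have M0: "M \<ge> 0" using \<rho> d by (simp add: M_def)
  have [measurable]: "f \<in> borel_measurable \<sigma>" using f by auto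
  have [measurable]: "(\<lambda>\<zeta>. indicator B \<zeta> :: ennreal) \<in> borel_measurable \<sigma>" by (simp add: B_def indicator_arc_nhd_measurable)
  define Y where "Y = (\<integral>\<^sup>+ \<zeta>. abs2 (f \<zeta>) * indicator B \<zeta> \<partial>\<sigma>)"
  have "(\<integral>\<^sup>+ \<zeta>. abs2 (mean_cutoff c \<rho> d I f \<zeta>) \<partial>\<sigma>)
    \<le> (\<integral>\<^sup>+ \<zeta>. ennreal (2 * m\<^sup>2) * indicator B \<zeta> + 2 * (abs2 (f \<zeta>) * indicator B \<zeta>) \<partial>\<sigma>)"
  proof (rule nn_integral_mono)
    fix \<zeta>
    show "abs2 (mean_cutoff c \<rho> d I f \<zeta>)
      \<le> ennreal (2 * m\<^sup>2) * indicator B \<zeta> + 2 * (abs2 (f \<zeta>) * indicator B \<zeta>)"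
    proof (cases "\<zeta> \<in> B")
      case True
      have "cmod (mean_cutoff c \<rho> d I f \<zeta>) = cutoff c \<rho> d \<zeta> * \<bar>m - cmod (f \<zeta>)\<bar>"
        unfolding mean_cutoff_def norm_of_real abs_mult using cutoff_bounds[of c \<rho> d \<zeta>] by (simp add: m_def)
      also have "\<dots> \<le> 1 * \<bar>m - cmod (f \<zeta>)\<bar>" using cutoff_bounds[of c \<rho> d \<zeta>] by (intro mult_right_mono) auto
      finally have "(cmod (mean_cutoff c \<rho> d I f \<zeta>))\<^sup>2 \<le> \<bar>m - cmod (f \<zeta>)\<bar>\<^sup>2" by (intro power_mono) auto
      also have "\<dots> \<le> 2 * m\<^sup>2 + 2 * (cmod (f \<zeta>))\<^sup>2"
        using sum_squares_bound[of m "- cmod (f \<zeta>)"] by (simp add: power2_diff)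
      finally have "abs2 (mean_cutoff c \<rho> d I f \<zeta>) \<le> ennreal (2 * m\<^sup>2 + 2 * (cmod (f \<zeta>))\<^sup>2)" by (rule ennreal_leI)
      also have "\<dots> = ennreal (2 * m\<^sup>2) + ennreal (2 * (cmod (f \<zeta>))\<^sup>2)" by (intro ennreal_plus) auto
      also have "ennreal (2 * (cmod (f \<zeta>))\<^sup>2) = ennreal 2 * abs2 (f \<zeta>)" by (intro ennreal_mult) auto
      finally show ?thesis using True by simp
    next
      case False
      then have "cutoff c \<rho> d \<zeta> = 0" using d by (intro cutoff_eq_0) (auto simp: B_def arc_nhd_def)
      then show ?thesis by (simp add: mean_cutoff_def)
    qed
  qed
  also have "\<dots> = ennreal (2 * m\<^sup>2) * (\<integral>\<^sup>+ \<zeta>. indicator B \<zeta> \<partial>\<sigma>) + 2 * Y"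
    unfolding Y_def by (subst nn_integral_add; (subst nn_integral_cmult)?; (subst nn_integral_cmult)?) auto
  also have "\<dots> \<le> ennreal (2 * M / p) * Y + 2 * Y"
  proof (rule add_right_mono)
    have "ennreal (2 * m\<^sup>2) * (\<integral>\<^sup>+ \<zeta>. indicator B \<zeta> \<partial>\<sigma>) \<le> ennreal (2 * m\<^sup>2) * ennreal (4 * (\<rho> + d))"
      unfolding B_def using \<rho> d by (intro mult_left_mono nn_integral_arc_nhd_le c) auto
    also have "\<dots> = ennreal (2 * m\<^sup>2 * (4 * (\<rho> + d)))" using \<rho> d by (intro ennreal_mult[symmetric]) auto
    also have "\<dots> \<le> ennreal (2 * M / p * (p * m\<^sup>2))"
    proof (rule ennreal_leI)
      have "4 * (\<rho> + d) * d\<^sup>2 \<le> 16 * (\<rho> + d) * (\<rho> + d)\<^sup>2"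
        using \<rho> d by (intro mult_mono power_mono) auto
      then have "4 * (\<rho> + d) \<le> M"
        unfolding M_def using d by (simp add: pos_le_divide_eq power3_eq_cube power2_eq_square algebra_simps)
      then have "2 * m\<^sup>2 * (4 * (\<rho> + d)) \<le> 2 * m\<^sup>2 * M" by (intro mult_left_mono) auto
      then show "2 * m\<^sup>2 * (4 * (\<rho> + d)) \<le> 2 * M / p * (p * m\<^sup>2)" using p0 by (simp add: field_simps)
    qed
    also have "\<dots> = ennreal (2 * M / p) * ennreal (p * m\<^sup>2)" using p0 M0 by (intro ennreal_mult) auto
    also have "ennreal (p * m\<^sup>2) \<le> Y"
    proof -
      have "ennreal (p * m\<^sup>2) \<le> (\<integral>\<^sup>+ \<zeta>. ennreal (indicator I \<zeta> * (cmod (f \<zeta>))\<^sup>2) \<partial>\<sigma>)"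
        using circle_mean_deviation[OF f I p, of 0] by (simp add: p_def m_def)
      also have "\<dots> \<le> Y"
        unfolding Y_def B_def using I_subset by (intro nn_integral_mono) (auto simp: indicator_def)
      finally show ?thesis .
    qed
    finally show "ennreal (2 * m\<^sup>2) * (\<integral>\<^sup>+ \<zeta>. indicator B \<zeta> \<partial>\<sigma>) \<le> ennreal (2 * M / p) * Y"
      by (simp add: mult_left_mono)
  qed
  also have "\<dots> = ennreal K * Y"
  proof -
    have "ennreal K = ennreal (2 * M / p + 2)"
      by (simp add: local_const_def M_def p_def algebra_simps)
    also have "\<dots> = ennreal (2 * M / p) + ennreal 2" using M0 p0 by (intro ennreal_plus) auto
    finally show ?thesis by (simp add: distrib_right)
  qed
  finally show ?thesis by (simp add: Y_def B_def)
qed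

end

text \<open>Only \<zeta> is confined to \<open>S\<close>, and \<xi> is integrated over the entire
  circle. The energies of disjoint sets therefore sum to at most the square of the norm.\<close>

definition local_energy :: "complex measure \<Rightarrow> (complex \<Rightarrow> complex) \<Rightarrow> complex set \<Rightarrow> ennreal" where
  "local_energy \<mu> f S = (\<integral>\<^sup>+ \<zeta>. abs2 (f \<zeta>) * indicator S \<zeta> \<partial>\<sigma>)
     + (\<integral>\<^sup>+ \<xi>. dirichlet_on S \<xi> f (boundary_value f \<xi>) \<partial>\<mu>)"

lemma local_energy_Int_circle: "local_energy \<mu> f (A \<inter> unit_circle) = local_energy \<mu> f A"
proof -
  have "(\<integral>\<^sup>+ \<zeta>. abs2 (f \<zeta>) * indicator (A \<inter> unit_circle) \<zeta> \<partial>\<sigma>)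
    = (\<integral>\<^sup>+ \<zeta>. abs2 (f \<zeta>) * indicator A \<zeta> \<partial>\<sigma>)"
    by (rule nn_integral_cong) (simp add: indicator_def)
  then show ?thesis unfolding local_energy_def dirichlet_on_Int_circle by simp
qed

text \<open>Integration of the pointwise estimate over \<mu>; the candidate value of the cut-off
  function at \<xi> is computed from the boundary value of \<open>f\<close>.\<close>

lemma (in arc_setting) norm_sq_mean_cutoff:
  assumes sets_\<mu>: "sets \<mu> = sets circle_borel" and f: "f \<in> harmonic_dirichlet_space \<mu>"
  shows "norm_sq \<mu> (mean_cutoff c \<rho> d I f) \<le> ennreal K * local_energy \<mu> f (arc_nhd c (\<rho> + d))"
    and "mean_cutoff c \<rho> d I f \<in> harmonic_dirichlet_space \<mu>"
proof -
  let ?B = "arc_nhd c (\<rho> + d)" and ?g = "mean_cutoff c \<rho> d I f"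
  have fL: "f \<in> L2_circle" using f by (simp add: harmonic_dirichlet_space_def)
  note fi = L2_circle_integrable[OF fL]
  have [measurable]: "f \<in> borel_measurable \<sigma>" by fact
  have gm [measurable]: "?g \<in> borel_measurable \<sigma>" unfolding mean_cutoff_def by measurable
  have L2: "(\<integral>\<^sup>+ \<zeta>. abs2 (?g \<zeta>) \<partial>\<sigma>)
    \<le> ennreal K * (\<integral>\<^sup>+ \<zeta>. abs2 (f \<zeta>) * indicator ?B \<zeta> \<partial>\<sigma>)"
    by (rule mean_cutoff_L2[OF fi(1)])
  also have "\<dots> \<le> ennreal K * (\<integral>\<^sup>+ \<zeta>. abs2 (f \<zeta>) \<partial>\<sigma>)"
    by (intro mult_left_mono nn_integral_mono) (auto simp: indicator_def)
  also have "\<dots> < \<infinity>" using fL by (simp add: L2_circle_iff ennreal_mult_less_top)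
  finally have gL: "?g \<in> L2_circle" using gm by (simp add: L2_circle_iff)
  note gi = L2_circle_integrable(1)[OF gL]
  have bm: "boundary_value f \<in> borel_measurable \<sigma>" by (rule boundary_value_measurable) measurable
  have Dm: "(\<lambda>\<xi>. dirichlet_on ?B \<xi> f (boundary_value f \<xi>)) \<in> borel_measurable \<mu>"
  proof -
    note [measurable] = bm
    show ?thesis unfolding measurable_mu_iff[OF sets_\<mu>] dirichlet_on_def by measurable
  qed
  have "dirichlet_integral \<mu> ?g \<le> (\<integral>\<^sup>+ \<xi>. dirichlet_at \<xi> ?g (of_real (cutoff c \<rho> d \<xi> * (circle_mean I f - cmod (boundary_value f \<xi>)))) \<partial>\<mu>)"
    by (rule dirichlet_integral_le[OF sets_\<mu> gi])
  also have "\<dots> \<le> (\<integral>\<^sup>+ \<xi>. ennreal K * dirichlet_on ?B \<xi> f (boundary_value f \<xi>) \<partial>\<mu>)"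
    by (intro nn_integral_mono mean_cutoff_dirichlet fi) (auto simp: space_mu[OF sets_\<mu>])
  also have "\<dots> = ennreal K * (\<integral>\<^sup>+ \<xi>. dirichlet_on ?B \<xi> f (boundary_value f \<xi>) \<partial>\<mu>)"
    by (rule nn_integral_cmult[OF Dm])
  finally have D: "dirichlet_integral \<mu> ?g \<le> \<dots>" .
  show "norm_sq \<mu> ?g \<le> ennreal K * local_energy \<mu> f ?B"
    unfolding norm_sq_def local_energy_def distrib_left by (intro add_mono L2 D)
  note D
  also have "ennreal K * (\<integral>\<^sup>+ \<xi>. dirichlet_on ?B \<xi> f (boundary_value f \<xi>) \<partial>\<mu>)
    \<le> ennreal K * (\<integral>\<^sup>+ \<xi>. dirichlet_at \<xi> f (boundary_value f \<xi>) \<partial>\<mu>)"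
    by (intro mult_left_mono nn_integral_mono dirichlet_on_mono) auto
  also have "\<dots> = ennreal K * dirichlet_integral \<mu> f" by (simp add: dirichlet_integral_eq[OF sets_\<mu> fi(1)])
  also have "\<dots> < \<infinity>" using f by (simp add: harmonic_dirichlet_space_def ennreal_mult_less_top)
  finally show "?g \<in> harmonic_dirichlet_space \<mu>" using gL by (simp add: harmonic_dirichlet_space_def)
qed

lemma sum_local_energy_le:
  assumes sets_\<mu>: "sets \<mu> = sets circle_borel" and f: "integrable \<sigma> f"
    and S: "\<And>n. S n \<in> sets borel" "disjoint_family S"
  shows "(\<Sum>n<(k::nat). local_energy \<mu> f (S n)) \<le> norm_sq \<mu> f"
proof -
  have [measurable]: "f \<in> borel_measurable \<sigma>" using f by auto
  have [measurable]: "(\<lambda>\<zeta>. indicator (S n) \<zeta> :: ennreal) \<in> borel_measurable \<sigma>" for n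
    by (rule borel_measurable_circle) (use S(1) in measurable)
  have bm [measurable]: "boundary_value f \<in> borel_measurable \<sigma>"
    by (rule boundary_value_measurable) measurable
  have sum1: "(\<Sum>n<k. indicator (S n) \<zeta> :: ennreal) \<le> 1" for \<zeta>
  proof (cases "\<exists>n<k. \<zeta> \<in> S n")
    case True
    then obtain n where n: "n < k" "\<zeta> \<in> S n" by blast
    have "indicator (S i) \<zeta> = (if i = n then 1 else 0 :: ennreal)" for i
      using S(2) n(2) by (auto simp: disjoint_family_on_def indicator_def)
    then show ?thesis using n(1) by simp
  qed (auto simp: indicator_def)
  have sum2: "(\<Sum>n<k. \<integral>\<^sup>+ \<zeta>. h \<zeta> * indicator (S n) \<zeta> \<partial>\<sigma>) \<le> (\<integral>\<^sup>+ \<zeta>. h \<zeta> \<partial>\<sigma>)"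
    if [measurable]: "h \<in> borel_measurable \<sigma>" for h
  proof -
    have "(\<Sum>n<k. \<integral>\<^sup>+ \<zeta>. h \<zeta> * indicator (S n) \<zeta> \<partial>\<sigma>) = (\<integral>\<^sup>+ \<zeta>. (\<Sum>n<k. h \<zeta> * indicator (S n) \<zeta>) \<partial>\<sigma>)"
      by (rule nn_integral_sum[symmetric]) measurable
    also have "\<dots> \<le> (\<integral>\<^sup>+ \<zeta>. h \<zeta> * 1 \<partial>\<sigma>)"
      unfolding sum_distrib_left[symmetric] by (intro nn_integral_mono mult_left_mono sum1) auto
    finally show ?thesis by simp
  qed
  have Dm: "(\<lambda>\<xi>. dirichlet_on (S n) \<xi> f (boundary_value f \<xi>)) \<in> borel_measurable \<mu>" for n
    unfolding measurable_mu_iff[OF sets_\<mu>] dirichlet_on_def by measurable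
  have "(\<Sum>n<k. \<integral>\<^sup>+ \<xi>. dirichlet_on (S n) \<xi> f (boundary_value f \<xi>) \<partial>\<mu>) =
     (\<integral>\<^sup>+ \<xi>. (\<Sum>n<k. dirichlet_on (S n) \<xi> f (boundary_value f \<xi>)) \<partial>\<mu>)"
    by (rule nn_integral_sum[symmetric]) (rule Dm)
  also have "\<dots> \<le> (\<integral>\<^sup>+ \<xi>. dirichlet_at \<xi> f (boundary_value f \<xi>) \<partial>\<mu>)"
    unfolding dirichlet_at_eq unfolding dirichlet_on_def by (intro nn_integral_mono sum2) measurable
  also have "\<dots> = dirichlet_integral \<mu> f" by (rule dirichlet_integral_eq[OF sets_\<mu> f, symmetric])
  finally have D: "(\<Sum>n<k. \<integral>\<^sup>+ \<xi>. dirichlet_on (S n) \<xi> f (boundary_value f \<xi>) \<partial>\<mu>) \<le> dirichlet_integral \<mu> f" .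
  show ?thesis
    unfolding local_energy_def norm_sq_def sum.distrib by (intro add_mono D sum2) measurable
qed

section \<open>Quasi-everywhere zeros and capacity\<close>

text \<open>Continuity makes the sets where a dilation is small, or where two dilations differ much,
  open in the circle, as neighbourhoods in the definition of capacity must be.\<close>

lemma dilate_continuous:
  assumes f: "integrable \<sigma> f" and r: "0 \<le> r" "r < 1"
  shows "continuous_on unit_circle (dilate r f)"
  unfolding continuous_on_sequentially
proof (intro allI ballI impI)
  fix x a assume a: "a \<in> unit_circle" and x: "(\<forall>n. x n \<in> unit_circle) \<and> x \<longlonglongrightarrow> a"
  have [measurable]: "f \<in> borel_measurable \<sigma>" using f by auto
  have z: "cmod (of_real r * \<zeta>) < 1" "cmod (of_real r * \<zeta>) = r" if "\<zeta> \<in> unit_circle" for \<zeta>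
    using that r by (auto simp: norm_mult)
  have "(\<lambda>n. LINT \<eta>|\<sigma>. of_real (poisson_kernel (of_real r * x n) \<eta>) * f \<eta>)
    \<longlonglongrightarrow> (LINT \<eta>|\<sigma>. of_real (poisson_kernel (of_real r * a) \<eta>) * f \<eta>)"
  proof (rule integral_dominated_convergence[where w="\<lambda>\<eta>. 1 / (1 - r)\<^sup>2 * cmod (f \<eta>)"])
    show "integrable \<sigma> (\<lambda>\<eta>. 1 / (1 - r)\<^sup>2 * cmod (f \<eta>))" using f by auto
    show "AE \<eta> in \<sigma>. (\<lambda>n. of_real (poisson_kernel (of_real r * x n) \<eta>) * f \<eta>)
        \<longlonglongrightarrow> of_real (poisson_kernel (of_real r * a) \<eta>) * f \<eta>"
    proof (rule AE_I2)
      fix \<eta> assume "\<eta> \<in> space \<sigma>"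
      then have "cmod \<eta> = 1" by simp
      then have "\<eta> \<noteq> of_real r * a" using z(2)[OF a] r by auto
      then show "(\<lambda>n. of_real (poisson_kernel (of_real r * x n) \<eta>) * f \<eta>)
        \<longlonglongrightarrow> of_real (poisson_kernel (of_real r * a) \<eta>) * f \<eta>"
        unfolding poisson_kernel_def using x
        by (intro tendsto_mult tendsto_of_real tendsto_divide tendsto_diff tendsto_power tendsto_norm tendsto_const) auto
    qed
    show "AE \<eta> in \<sigma>. norm (of_real (poisson_kernel (of_real r * x n) \<eta>) * f \<eta>) \<le> 1 / (1 - r)\<^sup>2 * cmod (f \<eta>)" for n
    proof (rule AE_I2)
      fix \<eta> assume "\<eta> \<in> space \<sigma>"
      then have \<eta>: "cmod \<eta> = 1" by simp
      have xn: "x n \<in> unit_circle" using x by blast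
      show "norm (of_real (poisson_kernel (of_real r * x n) \<eta>) * f \<eta>) \<le> 1 / (1 - r)\<^sup>2 * cmod (f \<eta>)"
        unfolding norm_mult norm_of_real
        using poisson_kernel_bound[OF z(1)[OF xn] \<eta>] poisson_kernel_nonneg[OF z(1)[OF xn], of \<eta>] z(2)[OF xn]
        by (intro mult_right_mono) auto
    qed
  qed measurable
  then show "(dilate r f \<circ> x) \<longlonglongrightarrow> dilate r f a"
    by (simp add: dilate_def poisson_ext_eq comp_def)
qed

lemma dirichlet_at_cmult:
  assumes [measurable]: "f \<in> borel_measurable \<sigma>"
  shows "dirichlet_at \<xi> (\<lambda>\<zeta>. of_real a * f \<zeta>) (of_real a * l) = ennreal (a\<^sup>2) * dirichlet_at \<xi> f l"
proof -
  have "abs2 ((of_real a * f \<zeta> - of_real a * l) / (\<zeta> - \<xi>)) =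
    ennreal (a\<^sup>2) * abs2 ((f \<zeta> - l) / (\<zeta> - \<xi>))" for \<zeta>
  proof -
    have "(of_real a * f \<zeta> - of_real a * l) / (\<zeta> - \<xi>) = of_real a * ((f \<zeta> - l) / (\<zeta> - \<xi>))"
      by (simp add: right_diff_distrib)
    then show ?thesis by (simp only: norm_mult norm_of_real power_mult_distrib power2_abs) (simp add: ennreal_mult)
  qed
  then show ?thesis unfolding dirichlet_at_eq by (simp add: nn_integral_cmult)
qed

section \<open>Linear operations and dilations in the harmonically weighted space\<close>

context
  fixes \<mu> :: "complex measure"
  assumes sets_\<mu>: "sets \<mu> = sets circle_borel"
begin

lemma norm_sq_cmult:
  assumes f: "f \<in> harmonic_dirichlet_space \<mu>"
  shows "norm_sq \<mu> (\<lambda>\<zeta>. of_real a * f \<zeta>) \<le> ennreal (a\<^sup>2) * norm_sq \<mu> f"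
    and "(\<lambda>\<zeta>. of_real a * f \<zeta>) \<in> harmonic_dirichlet_space \<mu>"
proof -
  let ?g = "\<lambda>\<zeta>. of_real a * f \<zeta>"
  have fL: "f \<in> L2_circle" and fD: "dirichlet_integral \<mu> f < \<infinity>" using f by (auto simp: harmonic_dirichlet_space_def)
  note fi = L2_circle_integrable[OF fL]
  have [measurable]: "f \<in> borel_measurable \<sigma>" by fact
  have L: "(\<integral>\<^sup>+ \<zeta>. abs2 (?g \<zeta>) \<partial>\<sigma>) = ennreal (a\<^sup>2) * (\<integral>\<^sup>+ \<zeta>. abs2 (f \<zeta>) \<partial>\<sigma>)"
  proof -
    have "abs2 (?g \<zeta>) = ennreal (a\<^sup>2) * abs2 (f \<zeta>)" for \<zeta>
      by (simp add: norm_mult power_mult_distrib ennreal_mult)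
    then show ?thesis by (simp add: nn_integral_cmult)
  qed
  have gi: "integrable \<sigma> ?g" using fi(1) by simp
  have "dirichlet_integral \<mu> ?g \<le> (\<integral>\<^sup>+ \<xi>. dirichlet_at \<xi> ?g (of_real a * boundary_value f \<xi>) \<partial>\<mu>)"
    by (rule dirichlet_integral_le[OF sets_\<mu> gi])
  also have "\<dots> = (\<integral>\<^sup>+ \<xi>. ennreal (a\<^sup>2) * dirichlet_at \<xi> f (boundary_value f \<xi>) \<partial>\<mu>)"
    by (simp add: dirichlet_at_cmult)
  also have "\<dots> = ennreal (a\<^sup>2) * dirichlet_integral \<mu> f"
    unfolding dirichlet_integral_eq[OF sets_\<mu> fi(1)]
    by (rule nn_integral_cmult)
       (use dirichlet_at_measurable[OF fi(2) boundary_value_measurable[OF fi(2)]] in \<open>simp add: measurable_mu_iff[OF sets_\<mu>]\<close>)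
  finally have D: "dirichlet_integral \<mu> ?g \<le> ennreal (a\<^sup>2) * dirichlet_integral \<mu> f" .
  show "norm_sq \<mu> ?g \<le> ennreal (a\<^sup>2) * norm_sq \<mu> f"
    unfolding norm_sq_def distrib_left L by (intro add_left_mono D)
  have "?g \<in> L2_circle"
    using L fL fi(2) by (auto simp: L2_circle_iff ennreal_mult_less_top)
  moreover have "ennreal (a\<^sup>2) * dirichlet_integral \<mu> f < \<infinity>" using fD by (simp add: ennreal_mult_less_top)
  ultimately show "?g \<in> harmonic_dirichlet_space \<mu>"
    using D by (auto simp: harmonic_dirichlet_space_def)
qed

text \<open>A quasi-triangle inequality for the squared norm; the factor 2 is harmless on the
  geometrically small terms where the bound is applied. The candidate value at \<xi> is the
  difference of the boundary values.\<close>

lemma norm_sq_diff: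
  assumes f: "f \<in> harmonic_dirichlet_space \<mu>" and g: "g \<in> harmonic_dirichlet_space \<mu>"
  shows "norm_sq \<mu> (\<lambda>\<zeta>. f \<zeta> - g \<zeta>) \<le> 2 * (norm_sq \<mu> f + norm_sq \<mu> g)"
    and "(\<lambda>\<zeta>. f \<zeta> - g \<zeta>) \<in> harmonic_dirichlet_space \<mu>"
proof -
  let ?h = "\<lambda>\<zeta>. f \<zeta> - g \<zeta>"
  have fL: "f \<in> L2_circle" "g \<in> L2_circle" and fD: "dirichlet_integral \<mu> f < \<infinity>" "dirichlet_integral \<mu> g < \<infinity>"
    using f g by (auto simp: harmonic_dirichlet_space_def)
  note fi = L2_circle_integrable[OF fL(1)] and gi = L2_circle_integrable[OF fL(2)]
  have [measurable]: "f \<in> borel_measurable \<sigma>" "g \<in> borel_measurable \<sigma>" by fact+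
  have hL: "?h \<in> L2_circle" by (rule L2_circle_diff[OF fL])
  have L: "(\<integral>\<^sup>+ \<zeta>. abs2 (?h \<zeta>) \<partial>\<sigma>)
    \<le> 2 * ((\<integral>\<^sup>+ \<zeta>. abs2 (f \<zeta>) \<partial>\<sigma>) + (\<integral>\<^sup>+ \<zeta>. abs2 (g \<zeta>) \<partial>\<sigma>))"
    using nn_integral_add_sq_le[of f \<sigma> "\<lambda>\<zeta>. - g \<zeta>"] by simp
  have m: "(\<lambda>\<xi>. dirichlet_at \<xi> f (boundary_value f \<xi>)) \<in> borel_measurable \<mu>"
          "(\<lambda>\<xi>. dirichlet_at \<xi> g (boundary_value g \<xi>)) \<in> borel_measurable \<mu>"
    using dirichlet_at_measurable[OF fi(2) boundary_value_measurable[OF fi(2)]]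
      dirichlet_at_measurable[OF gi(2) boundary_value_measurable[OF gi(2)]]
    by (simp_all add: measurable_mu_iff[OF sets_\<mu>])
  have "dirichlet_integral \<mu> ?h \<le> (\<integral>\<^sup>+ \<xi>. dirichlet_at \<xi> ?h (boundary_value f \<xi> - boundary_value g \<xi>) \<partial>\<mu>)"
    by (rule dirichlet_integral_le[OF sets_\<mu> L2_circle_integrable(1)[OF hL]])
  also have "\<dots> \<le> (\<integral>\<^sup>+ \<xi>. 2 * (dirichlet_at \<xi> f (boundary_value f \<xi>) + dirichlet_at \<xi> g (boundary_value g \<xi>)) \<partial>\<mu>)"
    by (intro nn_integral_mono dirichlet_at_diff_le) measurable
  also have "\<dots> = 2 * (dirichlet_integral \<mu> f + dirichlet_integral \<mu> g)"
    unfolding dirichlet_integral_eq[OF sets_\<mu> fi(1)] dirichlet_integral_eq[OF sets_\<mu> gi(1)]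
    using m by (subst nn_integral_cmult; (subst nn_integral_add)?) auto
  finally have D: "dirichlet_integral \<mu> ?h \<le> 2 * (dirichlet_integral \<mu> f + dirichlet_integral \<mu> g)" .
  have "norm_sq \<mu> ?h \<le> 2 * ((\<integral>\<^sup>+ \<zeta>. abs2 (f \<zeta>) \<partial>\<sigma>) + (\<integral>\<^sup>+ \<zeta>. abs2 (g \<zeta>) \<partial>\<sigma>))
     + 2 * (dirichlet_integral \<mu> f + dirichlet_integral \<mu> g)"
    unfolding norm_sq_def by (intro add_mono L D)
  also have "\<dots> = 2 * (norm_sq \<mu> f + norm_sq \<mu> g)"
    unfolding norm_sq_def distrib_left by (simp add: add_ac)
  finally show "norm_sq \<mu> ?h \<le> 2 * (norm_sq \<mu> f + norm_sq \<mu> g)" .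
  have "2 * (dirichlet_integral \<mu> f + dirichlet_integral \<mu> g) < \<infinity>" using fD by (simp add: ennreal_mult_less_top)
  from order_le_less_trans[OF D this] show "?h \<in> harmonic_dirichlet_space \<mu>"
    using hL by (simp add: harmonic_dirichlet_space_def)
qed

lemma dilate_harmonic_dirichlet_space:
  assumes f: "f \<in> harmonic_dirichlet_space \<mu>" and r: "0 \<le> r" "r < 1"
  shows "dilate r f \<in> harmonic_dirichlet_space \<mu>"
proof -
  have fL: "f \<in> L2_circle" and fD: "dirichlet_integral \<mu> f < \<infinity>" using f by (auto simp: harmonic_dirichlet_space_def)
  note fi = L2_circle_integrable[OF fL]
  have gL: "dilate r f \<in> L2_circle" by (rule dilate_L2[OF fL r])
  have "dirichlet_integral \<mu> (dilate r f) \<le> (\<integral>\<^sup>+ \<xi>. dirichlet_at \<xi> (dilate r f) (dilate r f \<xi>) \<partial>\<mu>)"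
    by (rule dirichlet_integral_le[OF sets_\<mu> L2_circle_integrable(1)[OF gL]])
  also have "\<dots> \<le> (\<integral>\<^sup>+ \<xi>. 16 * dirichlet_at \<xi> f (boundary_value f \<xi>) \<partial>\<mu>)"
    by (intro nn_integral_mono dirichlet_at_dilate_le[OF fi(1) r]) (simp add: space_mu[OF sets_\<mu>])
  also have "\<dots> = 16 * dirichlet_integral \<mu> f"
    unfolding dirichlet_integral_eq[OF sets_\<mu> fi(1)]
    by (rule nn_integral_cmult)
       (use dirichlet_at_measurable[OF fi(2) boundary_value_measurable[OF fi(2)]] in \<open>simp add: measurable_mu_iff[OF sets_\<mu>]\<close>)
  also have "\<dots> < \<infinity>" using fD by (simp add: ennreal_mult_less_top)
  finally show ?thesis using gL by (simp add: harmonic_dirichlet_space_def)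
qed

text \<open>A subsequence with a prescribed rate of convergence in norm; choosing
  \<open>k j \<ge> j\<close> keeps the radii tending to 1.\<close>

lemma fast_dilations:
  assumes f: "f \<in> harmonic_dirichlet_space \<mu>" and e: "\<And>j. (0::real) < e j"
  obtains s where "\<And>j. 0 \<le> s j" "\<And>j. s j < 1" "s \<longlonglongrightarrow> 1"
    "\<And>j. norm_sq \<mu> (\<lambda>\<zeta>. dilate (s j) f \<zeta> - f \<zeta>) \<le> ennreal (e j)"
proof -
  have lim: "(\<lambda>k. norm_sq \<mu> (\<lambda>\<zeta>. dilate (radius_seq k) f \<zeta> - f \<zeta>)) \<longlonglongrightarrow> 0"
    by (rule dilate_tendsto_norm_sq[OF sets_\<mu> f radius_seq])
  have "\<exists>k\<ge>j. norm_sq \<mu> (\<lambda>\<zeta>. dilate (radius_seq k) f \<zeta> - f \<zeta>) \<le> ennreal (e j)" for j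
  proof -
    have "\<forall>\<^sub>F k in sequentially. norm_sq \<mu> (\<lambda>\<zeta>. dilate (radius_seq k) f \<zeta> - f \<zeta>) < ennreal (e j)"
      using e[of j] by (intro order_tendstoD(2)[OF lim]) (simp add: ennreal_less_zero_iff)
    then obtain M where "\<forall>k\<ge>M. norm_sq \<mu> (\<lambda>\<zeta>. dilate (radius_seq k) f \<zeta> - f \<zeta>) < ennreal (e j)"
      by (auto simp: eventually_sequentially)
    then show ?thesis by (intro exI[of _ "max j M"]) (auto intro: less_imp_le)
  qed
  then obtain k where k: "\<And>j. j \<le> k j" "\<And>j. norm_sq \<mu> (\<lambda>\<zeta>. dilate (radius_seq (k j)) f \<zeta> - f \<zeta>) \<le> ennreal (e j)"
    by metis
  have mono: "radius_seq j \<le> radius_seq (k j)" for j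
    using k(1)[of j] by (simp add: radius_seq_def field_simps)
  have "(\<lambda>j. radius_seq (k j)) \<longlonglongrightarrow> 1"
    by (rule tendsto_sandwich[OF _ _ radius_seq(3) tendsto_const])
       (auto intro!: always_eventually mono less_imp_le[OF radius_seq(2)])
  then show ?thesis
    using that[of "\<lambda>j. radius_seq (k j)"] radius_seq(1,2) k(2) by blast
qed

text \<open>An Egorov argument: the dilations \<open>v\<^sub>j\<close> are continuous, converge to \<open>f\<close> in norm and to \<open>0\<close>
  on \<open>E - N\<close>. Away from the open sets where \<open>\<bar>v\<^sub>j\<^sub>+\<^sub>1 - v\<^sub>j\<bar>\<close> exceeds a geometric sequence, \<open>v\<^sub>0\<close>
  is small on a neighbourhood of \<open>E \<inter> I\<close>.\<close>
lemma capacity_mean_le: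
  assumes arc: "arc_setting c \<rho> d I" and f: "f \<in> harmonic_dirichlet_space \<mu>"
    and Iop: "openin (top_of_set unit_circle) I"
    and E: "E \<subseteq> unit_circle"
    and qe: "qe_on \<mu> E (\<lambda>\<zeta>. has_nt_limit (poisson_ext f) \<zeta> 0)"
  shows "ennreal ((circle_mean I f)\<^sup>2) * capacity \<mu> (E \<inter> I)
    \<le> ennreal (9 * local_const \<rho> d (measure \<sigma> I)) * local_energy \<mu> f (arc_nhd c (\<rho> + d))"
proof (cases "circle_mean I f = 0")
  case False
  interpret arc_setting c \<rho> d I by (rule arc)
  define m where "m = circle_mean I f"
  have m: "m > 0" using False circle_mean_nonneg[of I f] by (simp add: m_def)
  define LE where "LE = local_energy \<mu> f (arc_nhd c (\<rho> + d))"
  obtain N where N: "N \<subseteq> unit_circle" "capacity \<mu> N = 0" "\<And>\<zeta>. \<zeta> \<in> E - N \<Longrightarrow> has_nt_limit (poisson_ext f) \<zeta> 0"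
    using qe unfolding qe_on_def by blast
  have fL: "f \<in> L2_circle" using f by (auto simp: harmonic_dirichlet_space_def)
  note fi = L2_circle_integrable[OF fL]
  define g where "g = mean_cutoff c \<rho> d I f"
  note g = norm_sq_mean_cutoff[OF sets_\<mu> f, folded g_def]
  have K0: "K \<ge> 0" using \<rho> d p by (simp add: local_const_def)
  \<comment> \<open>The three thirds of \<open>\<delta>\<close> pay for \<open>q\<close>, which
    covers the exceptional set, for \<open>w 0\<close>, the error of the first dilation, and for all
    the \<open>h j\<close> together.\<close>
  have main: "capacity \<mu> (E \<inter> I) \<le> ennreal (9 / m\<^sup>2 * K) * LE + ennreal \<delta>" if \<delta>: "\<delta> > 0" for \<delta> :: real
  proof -
    define \<delta>' where "\<delta>' = \<delta> / 3"
    have \<delta>': "\<delta>' > 0" using \<delta> by (simp add: \<delta>'_def)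
    have "capacity \<mu> N < ennreal \<delta>'" using N(2) \<delta>' by (simp add: ennreal_less_zero_iff)
    then obtain q W where q: "q \<in> harmonic_dirichlet_space \<mu>" "norm_sq \<mu> q < ennreal \<delta>'"
      and W: "openin (top_of_set unit_circle) W" "N \<subseteq> W" "AE \<zeta> in \<sigma>. \<zeta> \<in> W \<longrightarrow> cmod (q \<zeta>) \<ge> 1"
      unfolding capacity_def Inf_less_iff by blast
    \<comment> \<open>The rate 1/8 beats the growth \<open>4 ^ j\<close> of \<open>(a j)^2\<close>
      and leaves \<open>(1/2) ^ j\<close>. With 1152 = 4 * 288 the coefficient becomes 81/288, below
      1/2.\<close>
    define e where "e j = m\<^sup>2 * \<delta>' / 1152 * (1/8) ^ j" for j
    have e0: "e j > 0" for j using m \<delta>' by (simp add: e_def)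
    obtain s where s: "\<And>j. 0 \<le> s j" "\<And>j. s j < 1" "s \<longlonglongrightarrow> 1"
      "\<And>j. norm_sq \<mu> (\<lambda>\<zeta>. dilate (s j) f \<zeta> - f \<zeta>) \<le> ennreal (e j)"
      by (rule fast_dilations[OF f e0], rule that)
    define v where "v j = dilate (s j) f" for j
    define w where "w j \<zeta> = v j \<zeta> - f \<zeta>" for j \<zeta>
    have vH: "v j \<in> harmonic_dirichlet_space \<mu>" for j
      unfolding v_def by (rule dilate_harmonic_dirichlet_space[OF f s(1,2)])
    have wH: "w j \<in> harmonic_dirichlet_space \<mu>" for j
      unfolding w_def[abs_def] by (rule norm_sq_diff(2)[OF vH f])
    have we: "norm_sq \<mu> (w j) \<le> ennreal (e j)" for j using s(4)[of j] by (simp add: w_def[abs_def] v_def)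
    have vc: "continuous_on unit_circle (v j)" for j
      unfolding v_def by (rule dilate_continuous[OF fi(1) s(1,2)])
    \<comment> \<open>\<open>1 / a j = m/6 * (1/2) ^ Suc j\<close> is the threshold for the jump
      between consecutive dilations. The thresholds sum to \<open>m/6\<close>, safely below
      \<open>m/3\<close>.\<close>
    define a where "a j = 6 * 2 ^ Suc j / m" for j :: nat
    have a0: "a j > 0" for j using m by (simp add: a_def)
    define h where "h j \<zeta> = of_real (a j) * (w (Suc j) \<zeta> - w j \<zeta>)" for j \<zeta>
    note hH0 = norm_sq_diff(2)[OF wH wH]
    have hH: "h j \<in> harmonic_dirichlet_space \<mu>" for j
      unfolding h_def[abs_def] by (rule norm_sq_cmult(2)[OF hH0])
    have hn: "norm_sq \<mu> (h j) \<le> ennreal (\<delta>' * (1/2) ^ Suc j)" for j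
    proof -
      have "norm_sq \<mu> (h j) \<le> ennreal ((a j)\<^sup>2) * norm_sq \<mu> (\<lambda>\<zeta>. w (Suc j) \<zeta> - w j \<zeta>)"
        unfolding h_def[abs_def] by (rule norm_sq_cmult(1)[OF hH0])
      also have "\<dots> \<le> ennreal ((a j)\<^sup>2) * (2 * (norm_sq \<mu> (w (Suc j)) + norm_sq \<mu> (w j)))"
        by (intro mult_left_mono norm_sq_diff(1)[OF wH wH]) auto
      also have "\<dots> \<le> ennreal ((a j)\<^sup>2) * (2 * (ennreal (e (Suc j)) + ennreal (e j)))"
        by (intro mult_left_mono add_mono we) auto
      also have "\<dots> = ennreal ((a j)\<^sup>2 * (2 * (e (Suc j) + e j)))"
      proof -
        have "ennreal ((a j)\<^sup>2 * (2 * (e (Suc j) + e j))) = ennreal ((a j)\<^sup>2) * ennreal (2 * (e (Suc j) + e j))"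
          using less_imp_le[OF e0[of j]] less_imp_le[OF e0[of "Suc j"]] by (intro ennreal_mult) auto
        also have "ennreal (2 * (e (Suc j) + e j)) = ennreal 2 * ennreal (e (Suc j) + e j)"
          using less_imp_le[OF e0[of j]] less_imp_le[OF e0[of "Suc j"]] by (intro ennreal_mult) auto
        also have "ennreal (e (Suc j) + e j) = ennreal (e (Suc j)) + ennreal (e j)"
          using e0 by (intro ennreal_plus) (auto intro: less_imp_le)
        finally show ?thesis by simp
      qed
      also have "\<dots> \<le> ennreal (\<delta>' * (1/2) ^ Suc j)"
      proof (rule ennreal_leI)
        define x :: real where "x = (1/8) ^ j"
        define y :: real where "y = 2 ^ j"
        have yx: "y\<^sup>2 * x = (1/2) ^ j"
          unfolding x_def y_def power2_eq_square power_mult_distrib[symmetric] by simp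
        have ae: "a j = 12 * y / m" "e j = m\<^sup>2 * \<delta>' / 1152 * x" "e (Suc j) = m\<^sup>2 * \<delta>' / 1152 * (x / 8)"
          by (simp_all add: a_def e_def x_def y_def)
        have "(a j)\<^sup>2 * (2 * (e (Suc j) + e j)) = (81/288) * \<delta>' * (y\<^sup>2 * x)"
          unfolding ae using m by (simp add: divide_simps power2_eq_square)
        also have "\<dots> \<le> (1/2) * \<delta>' * (1/2) ^ j"
          unfolding yx using \<delta>' by (intro mult_right_mono) auto
        finally show "(a j)\<^sup>2 * (2 * (e (Suc j) + e j)) \<le> \<delta>' * (1/2) ^ Suc j" by (simp add: mult_ac)
      qed
      finally show ?thesis .
    qed
    \<comment> \<open>\<open>q\<close> is at least 1 on \<open>W\<close>, and \<open>h j\<close>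
      where a jump exceeds its threshold. On \<open>I\<close>, where \<open>v 0\<close> is below
      \<open>m/3\<close>, either \<open>w 0\<close> is at least \<open>m/3\<close>, or
      \<open>|f| < 2 * m / 3\<close> and then \<open>g = m - |f|\<close> exceeds \<open>m/3\<close>;
      hence the factor \<open>3 / m\<close>.\<close>
    define F where "F k = (case k of 0 \<Rightarrow> q | Suc k \<Rightarrow> (case k of 0 \<Rightarrow> (\<lambda>\<zeta>. of_real (3 / m) * g \<zeta>) |
      Suc k \<Rightarrow> (case k of 0 \<Rightarrow> (\<lambda>\<zeta>. of_real (3 / m) * w 0 \<zeta>) | Suc j \<Rightarrow> h j)))" for k :: nat
    have F: "F 0 = q" "F (Suc 0) = (\<lambda>\<zeta>. of_real (3 / m) * g \<zeta>)" "F (Suc (Suc 0)) = (\<lambda>\<zeta>. of_real (3 / m) * w 0 \<zeta>)"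
      "F (Suc (Suc (Suc j))) = h j" for j
      by (simp_all add: F_def)
    have FH: "F k \<in> harmonic_dirichlet_space \<mu>" for k
      using norm_sq_cmult(2)[OF g(2)] norm_sq_cmult(2)[OF wH[of 0]] q(1) hH
      by (auto simp: F_def simp del: of_real_divide split: nat.split)
    define U where "U = W \<union> (I \<inter> (unit_circle \<inter> v 0 -` {z. cmod z < m/3})) \<union>
      (\<Union>j. unit_circle \<inter> (\<lambda>\<zeta>. v (Suc j) \<zeta> - v j \<zeta>) -` {z. 1 / a j < cmod z})"
    have U1: "openin (top_of_set unit_circle) (unit_circle \<inter> v 0 -` {z. cmod z < m/3})"
      by (intro continuous_openin_preimage_gen vc open_Collect_less continuous_intros)
    have U2: "openin (top_of_set unit_circle) (unit_circle \<inter> (\<lambda>\<zeta>. v (Suc j) \<zeta> - v j \<zeta>) -` {z. 1 / a j < cmod z})" for j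
      by (intro continuous_openin_preimage_gen continuous_on_diff vc open_Collect_less continuous_intros)
    have "openin (top_of_set unit_circle)
        (\<Union>j. unit_circle \<inter> (\<lambda>\<zeta>. v (Suc j) \<zeta> - v j \<zeta>) -` {z. 1 / a j < cmod z})"
      by (rule openin_Union) (use U2 in blast)
    then have U: "openin (top_of_set unit_circle) U"
      unfolding U_def by (intro openin_Un openin_Int[OF Iop U1] W(1))
    have "E \<inter> I \<subseteq> U"
    proof
      fix \<xi> assume \<xi>: "\<xi> \<in> E \<inter> I"
      then have \<xi>1: "\<xi> \<in> unit_circle" using E by blast
      show "\<xi> \<in> U"
      proof (rule ccontr)
        assume nU: "\<xi> \<notin> U"
        then have "\<xi> \<notin> N" using W(2) by (auto simp: U_def)
        then have nt: "has_nt_limit (poisson_ext f) \<xi> 0" using N(3) \<xi> by blast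
        have lim: "(\<lambda>j. v j \<xi>) \<longlonglongrightarrow> 0"
          using has_nt_limit_radial[OF nt _ s(1,2,3)] \<xi>1 by (simp add: v_def dilate_def)
        have step: "cmod (v (Suc j) \<xi> - v j \<xi>) \<le> m/6 * (1/2) ^ Suc j" for j
        proof -
          have "\<not> 1 / a j < cmod (v (Suc j) \<xi> - v j \<xi>)" using nU \<xi>1 by (auto simp: U_def)
          moreover have "1 / a j = m/6 * (1/2) ^ Suc j" using m by (simp add: a_def power_divide)
          ultimately show ?thesis by simp
        qed
        \<comment> \<open>Telescoping: outside \<open>U\<close> no jump exceeds its threshold. As
          \<open>v n \<xi>\<close> tends to 0, the limit gives
          \<open>cmod (v 0 \<xi>) \<le> m/6\<close>, which contradicts \<xi> being outside
          \<open>U\<close>.\<close>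
        have bnd: "cmod (v 0 \<xi>) \<le> cmod (v n \<xi>) + m/6 * (1 - (1/2) ^ n)" for n
        proof (induction n)
          case (Suc n)
          have "cmod (v n \<xi>) \<le> cmod (v (Suc n) \<xi>) + cmod (v (Suc n) \<xi> - v n \<xi>)"
            using norm_triangle_ineq4[of "v (Suc n) \<xi>" "v (Suc n) \<xi> - v n \<xi>"] by simp
          then show ?case using Suc step[of n] by (simp add: algebra_simps)
        qed simp
        have "(\<lambda>n. cmod (v n \<xi>) + m/6 * (1 - (1/2) ^ n)) \<longlonglongrightarrow> cmod 0 + m/6 * (1 - 0)"
          by (intro tendsto_add tendsto_norm lim tendsto_mult tendsto_const tendsto_diff LIMSEQ_realpow_zero) auto
        then have "cmod (v 0 \<xi>) \<le> cmod 0 + m/6 * (1 - 0)"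
          by (rule tendsto_lowerbound) (use bnd in \<open>auto intro: always_eventually\<close>)
        then have "cmod (v 0 \<xi>) < m/3" using m by simp
        then show False using nU \<xi> \<xi>1 by (auto simp: U_def)
      qed
    qed
    moreover have "AE \<zeta> in \<sigma>. \<zeta> \<in> U \<longrightarrow> (\<exists>k. 1 \<le> cmod (F k \<zeta>))"
      using W(3)
    proof eventually_elim
      case (elim \<zeta>)
      show ?case
      proof
        assume "\<zeta> \<in> U"
        then consider "\<zeta> \<in> W" | "\<zeta> \<in> I" "cmod (v 0 \<zeta>) < m/3" | j where "1 / a j < cmod (v (Suc j) \<zeta> - v j \<zeta>)"
          by (auto simp: U_def)
        then show "\<exists>k. 1 \<le> cmod (F k \<zeta>)"
        proof cases
          case 1
          then show ?thesis using elim F(1) by metis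
        next
          case 2
          show ?thesis
          proof (cases "cmod (w 0 \<zeta>) \<ge> m/3")
            case True
            then have "1 \<le> cmod (F (Suc (Suc 0)) \<zeta>)" using m by (simp add: F norm_mult norm_divide field_simps)
            then show ?thesis by blast
          next
            case False
            have "cmod (f \<zeta>) \<le> cmod (v 0 \<zeta>) + cmod (w 0 \<zeta>)"
              using norm_triangle_ineq4[of "v 0 \<zeta>" "w 0 \<zeta>"] by (simp add: w_def)
            then have fs: "cmod (f \<zeta>) < 2 * m / 3" using 2(2) False by linarith
            have "g \<zeta> = of_real (m - cmod (f \<zeta>))"
              unfolding g_def mean_cutoff_def using cutoff_eq_1[OF d(1) sub[OF 2(1)]] by (simp add: m_def)
            then have "cmod (g \<zeta>) \<ge> m/3" using fs by (simp only: norm_of_real)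
            then have "1 \<le> cmod (F (Suc 0) \<zeta>)" using m by (simp add: F norm_mult norm_divide field_simps)
            then show ?thesis by blast
          qed
        next
          case 3
          have "w (Suc j) \<zeta> - w j \<zeta> = v (Suc j) \<zeta> - v j \<zeta>" by (simp add: w_def)
          then have "cmod (h j \<zeta>) = a j * cmod (v (Suc j) \<zeta> - v j \<zeta>)"
            using a0[of j] by (simp add: h_def norm_mult)
          then have "1 \<le> cmod (F (Suc (Suc (Suc j))) \<zeta>)" unfolding F using 3 a0[of j] by (simp add: field_simps)
          then show ?thesis by blast
        qed
      qed
    qed
    ultimately have "capacity \<mu> (E \<inter> I) \<le> (\<Sum>k. norm_sq \<mu> (F k))"
      by (intro capacity_le_suminf[OF sets_\<mu> FH U])
    also have "(\<Sum>k. norm_sq \<mu> (F k)) = (\<Sum>j. norm_sq \<mu> (h j)) + norm_sq \<mu> (F (Suc (Suc 0))) + norm_sq \<mu> (F (Suc 0)) + norm_sq \<mu> (F 0)"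
    proof -
      have "(\<lambda>j. norm_sq \<mu> (F (Suc (Suc (Suc j))))) sums (\<Sum>j. norm_sq \<mu> (h j))"
        unfolding F by (rule summable_sums) simp
      then have "(\<lambda>k. norm_sq \<mu> (F k)) sums ((\<Sum>j. norm_sq \<mu> (h j)) + norm_sq \<mu> (F (Suc (Suc 0))) + norm_sq \<mu> (F (Suc 0)) + norm_sq \<mu> (F 0))"
        by (intro sums_Suc)
      then show ?thesis by (rule sums_unique[symmetric])
    qed
    also have "\<dots> \<le> ennreal \<delta>' + ennreal \<delta>' + ennreal (9 / m\<^sup>2 * K) * LE + ennreal \<delta>'"
    proof (intro add_mono)
      have "(\<Sum>j. norm_sq \<mu> (h j)) \<le> (\<Sum>j. ennreal (\<delta>' * (1/2) ^ Suc j))"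
        by (intro suminf_le hn) auto
      also have "\<dots> = ennreal \<delta>'"
      proof -
        have "(\<lambda>j. \<delta>' * (1/2) ^ Suc j) sums \<delta>'" using sums_mult[OF power_half_series, of \<delta>'] by simp
        then show ?thesis using \<delta>' by (intro suminf_ennreal_eq) auto
      qed
      finally show "(\<Sum>j. norm_sq \<mu> (h j)) \<le> ennreal \<delta>'" .
      have "norm_sq \<mu> (F (Suc (Suc 0))) \<le> ennreal ((3/m)\<^sup>2) * ennreal (e 0)"
        unfolding F using norm_sq_cmult(1)[OF wH] by (rule order_trans) (intro mult_left_mono we, simp)
      also have "\<dots> = ennreal ((3/m)\<^sup>2 * e 0)" using e0[of 0] by (intro ennreal_mult[symmetric]) auto
      also have "\<dots> \<le> ennreal \<delta>'" using m \<delta>' by (intro ennreal_leI) (simp add: e_def power_divide field_simps)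
      finally show "norm_sq \<mu> (F (Suc (Suc 0))) \<le> ennreal \<delta>'" .
      have "norm_sq \<mu> (F (Suc 0)) \<le> ennreal ((3/m)\<^sup>2) * (ennreal K * LE)"
        unfolding F LE_def using norm_sq_cmult(1)[OF g(2)] by (rule order_trans) (intro mult_left_mono g(1), simp)
      also have "\<dots> = ennreal ((3/m)\<^sup>2 * K) * LE"
        using K0 by (simp add: ennreal_mult mult.assoc)
      also have "(3/m)\<^sup>2 * K = 9 / m\<^sup>2 * K" by (simp add: power_divide)
      finally show "norm_sq \<mu> (F (Suc 0)) \<le> ennreal (9 / m\<^sup>2 * K) * LE" .
      show "norm_sq \<mu> (F 0) \<le> ennreal \<delta>'" using q(2) by (simp add: F)
    qed
    also have "\<dots> = ennreal (9 / m\<^sup>2 * K) * LE + (ennreal \<delta>' + ennreal \<delta>' + ennreal \<delta>')"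
      by (simp add: add_ac)
    also have "ennreal \<delta>' + ennreal \<delta>' + ennreal \<delta>' = ennreal \<delta>"
      using \<delta>' by (simp add: \<delta>'_def flip: ennreal_plus)
    finally show ?thesis .
  qed
  have "capacity \<mu> (E \<inter> I) \<le> ennreal (9 / m\<^sup>2 * K) * LE"
    by (rule ennreal_le_epsilon) (use main in auto)
  then have "ennreal (m\<^sup>2) * capacity \<mu> (E \<inter> I) \<le> ennreal (m\<^sup>2) * (ennreal (9 / m\<^sup>2 * K) * LE)"
    by (rule mult_left_mono) simp
  also have "\<dots> = ennreal (m\<^sup>2 * (9 / m\<^sup>2 * K)) * LE"
    unfolding mult.assoc[symmetric, where c=LE] using K0 m
    by (intro arg_cong2[where f=times] ennreal_mult[symmetric] refl) auto
  also have "m\<^sup>2 * (9 / m\<^sup>2 * K) = 9 * K" using m by simp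
  finally show ?thesis by (simp add: m_def LE_def)
qed simp

end

section \<open>A Jensen-type inequality\<close>

text \<open>\<open>ortho\<close> says that the Fourier coefficients of negative index vanish, so
  each power of positive degree in the Taylor series of \<open>F\<close> integrates to 0 against
  \<open>f\<close>. The radius \<open>R > 1\<close> makes the Taylor coefficients absolutely
  summable and justifies termwise integration.\<close>

lemma integral_holomorphic_mult:
  assumes F: "F holomorphic_on ball 0 R" and R: "R > 1" and f: "integrable \<sigma> f"
    and ortho: "\<And>n. (LINT \<zeta>|\<sigma>. \<zeta> ^ Suc n * f \<zeta>) = 0"
  shows "(LINT \<zeta>|\<sigma>. F \<zeta> * f \<zeta>) = F 0 * (LINT \<zeta>|\<sigma>. f \<zeta>)"
proof -
  define a where "a n = (deriv ^^ n) F 0 / fact n" for n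
  have sums: "(\<lambda>n. a n * z ^ n) sums F z" if "cmod z < R" for z
    using holomorphic_power_series[OF F, of z] that by (simp add: a_def)
  obtain R' where R': "1 < R'" "R' < R" using R dense by blast
  have "summable (\<lambda>n. a n * (of_real R') ^ n)"
    using sums[of "of_real R'"] R' by (auto simp: sums_iff)
  then have sa: "summable (\<lambda>n. cmod (a n))"
    using powser_insidea[of a "of_real R'" 1] R' by simp
  have fm [measurable]: "f \<in> borel_measurable \<sigma>" using f by auto
  have norm_term: "cmod (a n * \<zeta> ^ n * f \<zeta>) = cmod (a n) * cmod (f \<zeta>)" if "cmod \<zeta> = 1" for n \<zeta>
    using that by (simp add: norm_mult norm_power)
  have int: "integrable \<sigma> (\<lambda>\<zeta>. a n * \<zeta> ^ n * f \<zeta>)" for n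
    by (rule integrable_circle_bounded_mult[OF f, where C="cmod (a n)"]) (auto simp: norm_mult norm_power)
  have "(\<lambda>n. LINT \<zeta>|\<sigma>. a n * \<zeta> ^ n * f \<zeta>) sums (LINT \<zeta>|\<sigma>. (\<Sum>n. a n * \<zeta> ^ n * f \<zeta>))"
  proof (rule sums_integral[OF int])
    show "AE \<zeta> in \<sigma>. summable (\<lambda>n. norm (a n * \<zeta> ^ n * f \<zeta>))"
      using norm_term by (intro AE_I2) (simp add: summable_mult2[OF sa])
    have "(LINT \<zeta>|\<sigma>. norm (a n * \<zeta> ^ n * f \<zeta>)) = cmod (a n) * (LINT \<zeta>|\<sigma>. cmod (f \<zeta>))" for n
    proof -
      have "(LINT \<zeta>|\<sigma>. norm (a n * \<zeta> ^ n * f \<zeta>)) = (LINT \<zeta>|\<sigma>. cmod (a n) * cmod (f \<zeta>))"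
        using norm_term by (intro Bochner_Integration.integral_cong) auto
      then show ?thesis by simp
    qed
    then show "summable (\<lambda>n. LINT \<zeta>|\<sigma>. norm (a n * \<zeta> ^ n * f \<zeta>))"
      by (simp add: summable_mult2[OF sa])
  qed
  also have "(LINT \<zeta>|\<sigma>. (\<Sum>n. a n * \<zeta> ^ n * f \<zeta>)) = (LINT \<zeta>|\<sigma>. F \<zeta> * f \<zeta>)"
  proof (intro Bochner_Integration.integral_cong refl)
    fix \<zeta> assume "\<zeta> \<in> space \<sigma>"
    then have "cmod \<zeta> < R" using R by simp
    from sums_mult2[OF sums[OF this], of "f \<zeta>"] show "(\<Sum>n. a n * \<zeta> ^ n * f \<zeta>) = F \<zeta> * f \<zeta>"
      by (simp add: sums_iff)
  qed
  finally have 1: "(\<lambda>n. LINT \<zeta>|\<sigma>. a n * \<zeta> ^ n * f \<zeta>) sums (LINT \<zeta>|\<sigma>. F \<zeta> * f \<zeta>)" .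
  have "(LINT \<zeta>|\<sigma>. a n * \<zeta> ^ n * f \<zeta>) = (if n = 0 then a 0 * (LINT \<zeta>|\<sigma>. f \<zeta>) else 0)" for n
  proof (cases n)
    case (Suc k)
    have "(LINT \<zeta>|\<sigma>. a n * \<zeta> ^ n * f \<zeta>) = (LINT \<zeta>|\<sigma>. a n * (\<zeta> ^ Suc k * f \<zeta>))"
      by (simp add: Suc mult.assoc)
    also have "\<dots> = a n * (LINT \<zeta>|\<sigma>. \<zeta> ^ Suc k * f \<zeta>)" by (rule integral_mult_right_zero)
    finally show ?thesis unfolding ortho using Suc by simp
  qed simp
  then have "(\<lambda>n. if n = 0 then a 0 * (LINT \<zeta>|\<sigma>. f \<zeta>) else 0) sums (LINT \<zeta>|\<sigma>. F \<zeta> * f \<zeta>)"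
    using 1 by simp
  moreover have "(\<lambda>n. if n = 0 then a 0 * (LINT \<zeta>|\<sigma>. f \<zeta>) else 0) sums (a 0 * (LINT \<zeta>|\<sigma>. f \<zeta>))"
    using sums_single[of 0 "\<lambda>_. a 0 * (LINT \<zeta>|\<sigma>. f \<zeta>)"] by simp
  ultimately have "(LINT \<zeta>|\<sigma>. F \<zeta> * f \<zeta>) = a 0 * (LINT \<zeta>|\<sigma>. f \<zeta>)"
    by (rule sums_unique2)
  then show ?thesis by (simp add: a_def)
qed

text \<open>For real \<open>v\<close> opposite Fourier coefficients are conjugate, so the Poisson
  series is the real part of a power series with the coefficients of positive index doubled. The
  factors \<open>r ^ n\<close> enlarge the disc of convergence to radius \<open>1 / r\<close>,
  beyond the circle.\<close>

lemma poisson_analytic_completion: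
  fixes v :: "complex \<Rightarrow> real"
  assumes [measurable]: "v \<in> borel_measurable \<sigma>" and v: "\<And>\<zeta>. cmod \<zeta> = 1 \<Longrightarrow> \<bar>v \<zeta>\<bar> \<le> M"
    and r: "0 < r" "r < 1"
  obtains Q where "Q holomorphic_on ball 0 (1 / r)" "Q 0 = of_real (LINT \<zeta>|\<sigma>. v \<zeta>)"
    "\<And>\<zeta>. cmod \<zeta> = 1 \<Longrightarrow> Re (Q \<zeta>) = Re (dilate r (\<lambda>\<zeta>. of_real (v \<zeta>)) \<zeta>)"
proof -
  have vi: "integrable \<sigma> v"
    by (rule circle.integrable_const_bound[where B=M]) (use v in auto)
  have vi': "integrable \<sigma> (\<lambda>\<zeta>. complex_of_real (v \<zeta>))" using vi by simp
  define b where "b n = (LINT \<zeta>|\<sigma>. cnj \<zeta> ^ Suc n * complex_of_real (v \<zeta>))" for n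
  define a where "a n = (case n of 0 \<Rightarrow> of_real (LINT \<zeta>|\<sigma>. v \<zeta>) | Suc n \<Rightarrow> 2 * of_real r ^ Suc n * b n)" for n
  have M0: "M \<ge> 0" using v[of 1] by simp
  have bM: "cmod (b n) \<le> M" for n
  proof -
    have "cmod (b n) \<le> (LINT \<zeta>|\<sigma>. cmod (cnj \<zeta> ^ Suc n * complex_of_real (v \<zeta>)))"
      unfolding b_def by (rule integral_norm_bound)
    also have "\<dots> \<le> (LINT \<zeta>|\<sigma>. M)"
    proof (rule integral_mono)
      show "integrable \<sigma> (\<lambda>\<zeta>. cmod (cnj \<zeta> ^ Suc n * complex_of_real (v \<zeta>)))"
        by (intro integrable_norm integrable_circle_bounded_mult[OF vi', where C=1]) (auto simp: norm_mult norm_power)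
    qed (use v in \<open>auto simp: norm_mult norm_power\<close>)
    also have "\<dots> = M" using circle.prob_space by simp
    finally show ?thesis .
  qed
  have sm: "summable (\<lambda>n. a n * z ^ n)" if z: "cmod z < 1 / r" for z
  proof -
    have "summable (\<lambda>n. a (Suc n) * z ^ Suc n)"
    proof (rule summable_comparison_test')
      show "summable (\<lambda>n. 2 * M * (r * cmod z) ^ Suc n)"
        using z r by (intro summable_mult summable_Suc_iff[THEN iffD2] summable_geometric) (auto simp: field_simps)
      fix n
      have "norm (a (Suc n) * z ^ Suc n) = 2 * cmod (b n) * (r * cmod z) ^ Suc n"
        using r by (simp add: a_def norm_mult norm_power power_mult_distrib mult_ac)
      also have "\<dots> \<le> 2 * M * (r * cmod z) ^ Suc n"
        using bM r by (intro mult_right_mono mult_left_mono) auto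
      finally show "norm (a (Suc n) * z ^ Suc n) \<le> 2 * M * (r * cmod z) ^ Suc n" .
    qed
    then show ?thesis by (rule summable_Suc_iff[THEN iffD1])
  qed
  define Q where "Q z = (\<Sum>n. a n * z ^ n)" for z
  have Qs: "(\<lambda>n. a n * z ^ n) sums Q z" if "cmod z < 1 / r" for z
    unfolding Q_def by (rule summable_sums[OF sm[OF that]])
  have "Q holomorphic_on ball 0 (1 / r)"
    by (rule power_series_holomorphic[where a=a]) (use Qs in simp)
  moreover have "Q 0 = of_real (LINT \<zeta>|\<sigma>. v \<zeta>)"
    using powser_sums_zero[of a] Qs[of 0] r sums_unique2[of "\<lambda>n. a n * 0 ^ n" "Q 0" "a 0"] by (simp add: a_def)
  moreover have "Re (Q \<zeta>) = Re (dilate r (\<lambda>\<zeta>. of_real (v \<zeta>)) \<zeta>)" if \<zeta>: "cmod \<zeta> = 1" for \<zeta>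
  proof -
    have "cmod \<zeta> < 1 / r" using \<zeta> r by simp
    from Qs[OF this] have "(\<lambda>n. a (Suc n) * \<zeta> ^ Suc n) sums (Q \<zeta> - a 0)"
      using sums_Suc_iff[of "\<lambda>n. a n * \<zeta> ^ n" "Q \<zeta> - a 0"] by simp
    then have s1: "(\<lambda>n. Re (a (Suc n) * \<zeta> ^ Suc n)) sums Re (Q \<zeta> - a 0)" by (rule sums_Re)
    have z: "cmod (of_real r * \<zeta>) < 1" using \<zeta> r by (simp add: norm_mult)
    have cb: "(LINT \<eta>|\<sigma>. \<eta> ^ Suc n * complex_of_real (v \<eta>)) = cnj (b n)" for n
      unfolding b_def Bochner_Integration.integral_cnj[symmetric] by simp
    have s2: "(\<lambda>n. Re ((of_real r * \<zeta>) ^ Suc n * b n + cnj (of_real r * \<zeta>) ^ Suc n * cnj (b n)))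
       sums Re (dilate r (\<lambda>\<zeta>. of_real (v \<zeta>)) \<zeta> - a 0)"
      using sums_Re[OF poisson_ext_sums[OF vi' z]] unfolding cb b_def[symmetric] by (simp add: a_def dilate_def)
    have terms: "Re ((of_real r * \<zeta>) ^ Suc n * b n + cnj (of_real r * \<zeta>) ^ Suc n * cnj (b n)) = Re (a (Suc n) * \<zeta> ^ Suc n)" for n
    proof -
      define W where "W = (of_real r * \<zeta>) ^ Suc n * b n"
      have "cnj (of_real r * \<zeta>) ^ Suc n * cnj (b n) = cnj W" by (simp add: W_def)
      then have "Re ((of_real r * \<zeta>) ^ Suc n * b n + cnj (of_real r * \<zeta>) ^ Suc n * cnj (b n)) = Re (W + cnj W)"
        by (simp only: W_def)
      also have "\<dots> = Re (2 * W)" by simp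
      also have "2 * W = 2 * ((of_real r * \<zeta>) ^ Suc n * b n)" by (simp only: W_def)
      also have "2 * ((of_real r * \<zeta>) ^ Suc n * b n) = a (Suc n) * \<zeta> ^ Suc n"
        by (simp add: a_def power_mult_distrib mult_ac)
      finally show ?thesis .
    qed
    have "Re (Q \<zeta> - a 0) = Re (dilate r (\<lambda>\<zeta>. of_real (v \<zeta>)) \<zeta> - a 0)"
      by (rule sums_unique2[OF s1 s2[unfolded terms]])
    then show ?thesis by simp
  qed
  ultimately show ?thesis by (rule that)
qed

text \<open>For \<open>v = log \<bar>f\<bar>\<close> the right-hand side is \<open>exp (\<integral> log \<bar>f\<bar>)\<close>; it is
  proved by pairing \<open>f\<close> with the outer function \<open>exp (- Q)\<close>, where \<open>Re Q\<close> is a Poisson integral of \<open>v\<close>.\<close>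
lemma norm_integral_le_exp:
  fixes v :: "complex \<Rightarrow> real"
  assumes f: "integrable \<sigma> f"
    and ortho: "\<And>n. (LINT \<zeta>|\<sigma>. \<zeta> ^ Suc n * f \<zeta>) = 0"
    and vm [measurable]: "v \<in> borel_measurable \<sigma>" and v: "\<And>\<zeta>. cmod \<zeta> = 1 \<Longrightarrow> \<bar>v \<zeta>\<bar> \<le> M"
  shows "cmod (LINT \<zeta>|\<sigma>. f \<zeta>)
    \<le> exp (LINT \<zeta>|\<sigma>. v \<zeta>) * (LINT \<zeta>|\<sigma>. cmod (f \<zeta>) * exp (- v \<zeta>))"
proof -
  define V where "V \<zeta> = complex_of_real (v \<zeta>)" for \<zeta>
  have [measurable]: "V \<in> borel_measurable \<sigma>" unfolding V_def by measurable
  have fm [measurable]: "f \<in> borel_measurable \<sigma>" using f by auto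
  have Vb: "cmod (V \<zeta>) \<le> M" if "cmod \<zeta> = 1" for \<zeta> using v[OF that] by (simp add: V_def)
  have M0: "M \<ge> 0" using v[of 1] by simp
  have Vi: "integrable \<sigma> V"
    by (rule circle.integrable_const_bound[where B=M]) (use Vb in auto)
  have VL: "V \<in> L2_circle"
    unfolding L2_circle_def
    by (auto intro!: circle.integrable_const_bound[where B="M\<^sup>2"] AE_I2 power_mono Vb)
  \<comment> \<open>The index is shifted because \<open>radius_seq 0 = 0\<close>, while the
    completion needs a positive radius.\<close>
  define s where "s k = radius_seq (Suc k)" for k
  have s12: "0 < s k" "s k < 1" for k
    by (simp_all add: s_def radius_seq_def field_simps)
  have s3: "s \<longlonglongrightarrow> 1"
    using LIMSEQ_Suc[OF radius_seq(3)] by (simp add: s_def[abs_def])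
  note s = s12 s3
  have s0: "0 \<le> s k" for k using s(1)[of k] by simp
  have Db: "cmod (dilate (s k) V \<zeta>) \<le> M" if "cmod \<zeta> = 1" for k \<zeta>
    by (rule norm_dilate_le[OF Vi Vb s0 s(2) that])
  note [measurable] = dilate_measurable
  have Di: "integrable \<sigma> (\<lambda>\<zeta>. (cmod (dilate (s k) V \<zeta> - V \<zeta>))\<^sup>2)" for k
    using L2_circle_diff[OF dilate_L2[OF VL s0 s(2)] VL] by (rule L2_circle_integrable(3))
  have "(\<lambda>k. LINT \<zeta>|\<sigma>. norm ((cmod (dilate (s k) V \<zeta> - V \<zeta>))\<^sup>2)) \<longlonglongrightarrow> 0"
  proof -
    have "(\<lambda>k. ennreal (LINT \<zeta>|\<sigma>. (cmod (dilate (s k) V \<zeta> - V \<zeta>))\<^sup>2)) \<longlonglongrightarrow> ennreal 0"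
      using dilate_tendsto_L2[OF VL s0 s(2) s(3)] nn_integral_eq_integral[OF Di] by simp
    then show ?thesis by (subst (asm) tendsto_ennreal_iff) (auto intro: Bochner_Integration.integral_nonneg)
  qed
  \<comment> \<open>L2 convergence of the dilations gives almost everywhere convergence along a
    subsequence, enough for dominated convergence of the exponentials.\<close>
  from tendsto_L1_AE_subseq[OF Di this] obtain \<tau> where \<tau>: "strict_mono \<tau>"
    "AE \<zeta> in \<sigma>. (\<lambda>k. (cmod (dilate (s (\<tau> k)) V \<zeta> - V \<zeta>))\<^sup>2) \<longlonglongrightarrow> 0" by blast
  define I where "I k = (LINT \<zeta>|\<sigma>. cmod (f \<zeta>) * exp (- Re (dilate (s (\<tau> k)) V \<zeta>)))" for k
  have dom: "\<bar>cmod (f \<zeta>) * exp (- Re (dilate (s k) V \<zeta>))\<bar> \<le> exp M * cmod (f \<zeta>)" if "cmod \<zeta> = 1" for \<zeta> k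
  proof -
    have "- Re (dilate (s k) V \<zeta>) \<le> M" using Db[OF that, of k] abs_Re_le_cmod[of "dilate (s k) V \<zeta>"] by linarith
    then show ?thesis by (simp add: abs_mult mult.commute[of "cmod _"] mult_right_mono)
  qed
  have le: "cmod (LINT \<zeta>|\<sigma>. f \<zeta>) \<le> exp (LINT \<zeta>|\<sigma>. v \<zeta>) * I k" for k
  proof -
    obtain Q where Q: "Q holomorphic_on ball 0 (1 / s (\<tau> k))" "Q 0 = of_real (LINT \<zeta>|\<sigma>. v \<zeta>)"
      and Q': "\<And>\<zeta>. cmod \<zeta> = 1 \<Longrightarrow> Re (Q \<zeta>) = Re (dilate (s (\<tau> k)) (\<lambda>\<zeta>. complex_of_real (v \<zeta>)) \<zeta>)"
      by (rule poisson_analytic_completion[OF vm v s(1) s(2)], assumption, rule that)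
    have Q3: "Re (Q \<zeta>) = Re (dilate (s (\<tau> k)) V \<zeta>)" if "cmod \<zeta> = 1" for \<zeta>
      using Q'[OF that] by (simp only: V_def[abs_def])
    have "(\<lambda>z. exp (- Q z)) holomorphic_on ball 0 (1 / s (\<tau> k))" by (intro holomorphic_intros Q(1))
    \<comment> \<open>\<open>exp (- Q)\<close> is holomorphic beyond the circle, so pairing it with
      \<open>f\<close> isolates the mean of \<open>f\<close>, multiplied by the value at 0; the
      modulus of that value is \<open>exp\<close> of minus the mean of \<open>v\<close>.\<close>
    then have eq: "(LINT \<zeta>|\<sigma>. exp (- Q \<zeta>) * f \<zeta>) = exp (- Q 0) * (LINT \<zeta>|\<sigma>. f \<zeta>)"
      using s(1,2)[of "\<tau> k"] by (intro integral_holomorphic_mult[OF _ _ f ortho]) auto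
    have "exp (- (LINT \<zeta>|\<sigma>. v \<zeta>)) * cmod (LINT \<zeta>|\<sigma>. f \<zeta>) = cmod (LINT \<zeta>|\<sigma>. exp (- Q \<zeta>) * f \<zeta>)"
      unfolding eq by (simp add: norm_mult Q(2))
    also have "\<dots> \<le> (LINT \<zeta>|\<sigma>. cmod (exp (- Q \<zeta>) * f \<zeta>))" by (rule integral_norm_bound)
    also have "\<dots> = I k"
      unfolding I_def using Q3 by (intro Bochner_Integration.integral_cong refl) (simp add: norm_mult mult.commute)
    finally have "exp (LINT \<zeta>|\<sigma>. v \<zeta>) * (exp (- (LINT \<zeta>|\<sigma>. v \<zeta>)) * cmod (LINT \<zeta>|\<sigma>. f \<zeta>))
       \<le> exp (LINT \<zeta>|\<sigma>. v \<zeta>) * I k" by (rule mult_left_mono) simp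
    then show ?thesis by (simp add: mult.assoc[symmetric] exp_add[symmetric])
  qed
  have "I \<longlonglongrightarrow> (LINT \<zeta>|\<sigma>. cmod (f \<zeta>) * exp (- v \<zeta>))"
    unfolding I_def
  proof (rule integral_dominated_convergence[where w="\<lambda>\<zeta>. exp M * cmod (f \<zeta>)"])
    show "AE \<zeta> in \<sigma>. (\<lambda>k. cmod (f \<zeta>) * exp (- Re (dilate (s (\<tau> k)) V \<zeta>))) \<longlonglongrightarrow> cmod (f \<zeta>) * exp (- v \<zeta>)"
      using \<tau>(2)
    proof eventually_elim
      case (elim \<zeta>)
      have "(\<lambda>k. cmod (dilate (s (\<tau> k)) V \<zeta> - V \<zeta>)) \<longlonglongrightarrow> 0"
        using tendsto_real_sqrt[OF elim] by simp
      then have "(\<lambda>k. dilate (s (\<tau> k)) V \<zeta>) \<longlonglongrightarrow> V \<zeta>"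
        by (simp add: tendsto_norm_zero_iff LIM_zero_iff)
      then have "(\<lambda>k. cmod (f \<zeta>) * exp (- Re (dilate (s (\<tau> k)) V \<zeta>))) \<longlonglongrightarrow> cmod (f \<zeta>) * exp (- Re (V \<zeta>))"
        by (intro tendsto_mult tendsto_const tendsto_exp tendsto_minus tendsto_Re)
      then show ?case by (simp add: V_def)
    qed
    show "AE \<zeta> in \<sigma>. norm (cmod (f \<zeta>) * exp (- Re (dilate (s (\<tau> k)) V \<zeta>))) \<le> exp M * cmod (f \<zeta>)" for k
      using dom by (intro AE_I2) auto
    show "integrable \<sigma> (\<lambda>\<zeta>. exp M * cmod (f \<zeta>))" using f by auto
  qed measurable
  then have "(\<lambda>k. exp (LINT \<zeta>|\<sigma>. v \<zeta>) * I k) \<longlonglongrightarrow>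
    exp (LINT \<zeta>|\<sigma>. v \<zeta>) * (LINT \<zeta>|\<sigma>. cmod (f \<zeta>) * exp (- v \<zeta>))"
    by (intro tendsto_mult tendsto_const)
  then show ?thesis
    by (rule tendsto_lowerbound) (use le in \<open>auto intro: always_eventually\<close>)
qed

text \<open>The Poisson extension vanishes by its series, hence so does every dilation, and the
  dilations converge to \<open>f\<close> in L2.\<close>

lemma AE_zero_if_coeffs_zero:
  assumes f: "f \<in> L2_circle"
    and c: "\<And>n. (LINT \<zeta>|\<sigma>. \<zeta> ^ Suc n * f \<zeta>) = 0"
      "\<And>n. (LINT \<zeta>|\<sigma>. cnj \<zeta> ^ n * f \<zeta>) = 0"
  shows "AE \<zeta> in \<sigma>. f \<zeta> = 0"
proof -
  note fi = L2_circle_integrable[OF f]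
  have [measurable]: "f \<in> borel_measurable \<sigma>" by fact
  have f0: "(LINT \<zeta>|\<sigma>. f \<zeta>) = 0" using c(2)[of 0] by simp
  have "poisson_ext f z = 0" if "cmod z < 1" for z
  proof -
    have "(\<lambda>n. 0) sums poisson_ext f z"
      using poisson_ext_sums[OF fi(1) that] unfolding c f0 by simp
    then show ?thesis using sums_zero by (rule sums_unique2)
  qed
  then have d0: "dilate (radius_seq k) f \<zeta> = 0" if "cmod \<zeta> = 1" for k \<zeta>
    using that radius_seq(1,2)[of k] by (simp add: dilate_def norm_mult)
  have "(\<integral>\<^sup>+ \<zeta>. abs2 (dilate (radius_seq k) f \<zeta> - f \<zeta>) \<partial>\<sigma>) = (\<integral>\<^sup>+ \<zeta>. abs2 (f \<zeta>) \<partial>\<sigma>)" for k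
    by (intro nn_integral_cong) (simp add: d0)
  then have "(\<lambda>k::nat. (\<integral>\<^sup>+ \<zeta>. abs2 (f \<zeta>) \<partial>\<sigma>)) \<longlonglongrightarrow> 0"
    using dilate_tendsto_L2[OF f radius_seq] by simp
  then have "(\<integral>\<^sup>+ \<zeta>. abs2 (f \<zeta>) \<partial>\<sigma>) = 0"
    by (rule LIMSEQ_unique[OF tendsto_const])
  then have "AE \<zeta> in \<sigma>. abs2 (f \<zeta>) = 0"
    by (subst (asm) nn_integral_0_iff_AE) auto
  then show ?thesis by eventually_elim (simp add: ennreal_eq_0_iff)
qed

section \<open>Arcs\<close>

lemma cis_periodic: "cis (t + 2 * pi * of_int n) = cis t"
  using sin_cos_eq_iff[of "t + 2 * pi * of_int n" t] by (auto simp: complex_eq_iff)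

lemma norm_cis_diff: "cmod (cis s - cis t) = 2 * \<bar>sin ((s - t) / 2)\<bar>"
proof -
  have "(cmod (cis s - cis t))\<^sup>2 = (cos s - cos t)\<^sup>2 + (sin s - sin t)\<^sup>2"
    by (simp add: cmod_power2)
  also have "\<dots> = 2 - 2 * cos (s - t)"
    using sin_cos_squared_add[of s] sin_cos_squared_add[of t]
    by (simp add: cos_diff power2_diff algebra_simps)
  also have "cos (s - t) = 1 - 2 * (sin ((s - t) / 2))\<^sup>2"
  proof -
    have "2 * ((s - t) / 2) = s - t" by simp
    then show ?thesis using cos_double_sin[of "(s - t) / 2"] by metis
  qed
  finally have "(cmod (cis s - cis t))\<^sup>2 = (2 * \<bar>sin ((s - t) / 2)\<bar>)\<^sup>2"
    by (simp add: power_mult_distrib)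
  then show ?thesis by (rule power2_eq_imp_eq) auto
qed

lemma circle_cis_around:
  assumes "cmod \<zeta> = 1"
  obtains \<theta> where "\<zeta> = cis (m + \<theta>)" "\<bar>\<theta>\<bar> \<le> pi"
proof -
  define w where "w = \<zeta> / cis m"
  have "cmod w = 1" using assms by (simp add: w_def norm_divide)
  then have "w = cis (Arg w)" using rcis_cmod_Arg[of w] by (simp add: rcis_def)
  then have "\<zeta> = cis (m + Arg w)" by (simp add: w_def cis_mult[symmetric] field_simps)
  moreover have "\<bar>Arg w\<bar> \<le> pi" using Arg_bounded[of w] by auto
  ultimately show ?thesis by (rule that)
qed

text \<open>The chord from the midpoint to an endpoint has length
  \<open>2 * sin ((b - a) / 4)\<close>. Monotonicity of the sine turns angular into chordal
  distance; \<open>b \<le> a + 2 * pi\<close> keeps \<open>(b - a) / 4\<close> at most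
  \<open>pi / 2\<close>.\<close>

lemma open_arc_eq:
  assumes ab: "a < b" "b \<le> a + 2 * pi"
  shows "open_arc a b = arc_nhd (cis ((a + b) / 2)) (2 * sin ((b - a) / 4)) \<inter> unit_circle"
proof (intro equalityI subsetI)
  fix \<zeta> assume "\<zeta> \<in> open_arc a b"
  then obtain t where t: "a < t" "t < b" "\<zeta> = cis t" by (auto simp: open_arc_def)
  define x where "x = (t - (a + b) / 2) / 2"
  have "x < (b - a) / 4" "- x < (b - a) / 4" using t by (simp_all add: x_def field_simps)
  then have x: "\<bar>x\<bar> < (b - a) / 4" by linarith
  have "sin \<bar>x\<bar> \<ge> 0" using x ab by (intro sin_ge_zero) auto
  then have "\<bar>sin x\<bar> = sin \<bar>x\<bar>" by (cases "x \<ge> 0") auto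
  also have "\<dots> < sin ((b - a) / 4)"
    using x ab by (intro sin_monotone_2pi) auto
  finally show "\<zeta> \<in> arc_nhd (cis ((a + b) / 2)) (2 * sin ((b - a) / 4)) \<inter> unit_circle"
    using t by (simp add: arc_nhd_def norm_cis_diff x_def)
next
  fix \<zeta> assume \<zeta>: "\<zeta> \<in> arc_nhd (cis ((a + b) / 2)) (2 * sin ((b - a) / 4)) \<inter> unit_circle"
  then have "cmod \<zeta> = 1" by simp
  then obtain \<theta> where \<theta>: "\<zeta> = cis ((a + b) / 2 + \<theta>)" "\<bar>\<theta>\<bar> \<le> pi" by (rule circle_cis_around)
  have "\<bar>sin (\<theta> / 2)\<bar> < sin ((b - a) / 4)"
    using \<zeta> by (simp add: \<theta>(1) arc_nhd_def norm_cis_diff)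
  moreover have "\<bar>sin (\<theta> / 2)\<bar> = sin (\<bar>\<theta>\<bar> / 2)"
  proof -
    have "sin (\<bar>\<theta>\<bar> / 2) \<ge> 0" using \<theta>(2) by (intro sin_ge_zero) auto
    then show ?thesis by (cases "\<theta> \<ge> 0") auto
  qed
  ultimately have s: "sin (\<bar>\<theta>\<bar> / 2) < sin ((b - a) / 4)" by simp
  have "\<bar>\<theta>\<bar> / 2 < (b - a) / 4"
  proof (rule ccontr)
    assume "\<not> ?thesis"
    then have "sin ((b - a) / 4) \<le> sin (\<bar>\<theta>\<bar> / 2)"
      using \<theta>(2) ab by (intro sin_monotone_2pi_le) auto
    with s show False by simp
  qed
  then have "a < (a + b) / 2 + \<theta>" "(a + b) / 2 + \<theta> < b" by (auto simp: abs_if field_simps split: if_splits)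
  then show "\<zeta> \<in> open_arc a b" unfolding open_arc_def \<theta>(1) by auto
qed

lemma arc_nhd_circle_openin: "openin (top_of_set unit_circle) (arc_nhd c t \<inter> unit_circle)"
proof -
  have "open (arc_nhd c t)" unfolding arc_nhd_def by (intro open_Collect_less continuous_intros)
  then show ?thesis by (simp add: openin_open Int_commute) (metis Int_commute)
qed

lemma arc_nhd_circle_sets: "arc_nhd c t \<inter> unit_circle \<in> sets \<sigma>" "arc_nhd c t \<inter> unit_circle \<in> sets borel"
proof -
  show "arc_nhd c t \<inter> unit_circle \<in> sets borel" by (intro sets.Int arc_nhd_measurable borel_closed) auto
  then show "arc_nhd c t \<inter> unit_circle \<in> sets \<sigma>" by (simp add: sets_restrict_space_iff)
qed

lemma open_arc_shift: "open_arc (a + 2 * pi * of_int n) (b + 2 * pi * of_int n) = open_arc a b"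
proof -
  have "{a + 2 * pi * of_int n<..<b + 2 * pi * of_int n} = (\<lambda>t. t + 2 * pi * of_int n) ` {a<..<b}"
  proof (intro equalityI subsetI)
    fix t assume "t \<in> {a + 2 * pi * of_int n<..<b + 2 * pi * of_int n}"
    then show "t \<in> (\<lambda>t. t + 2 * pi * of_int n) ` {a<..<b}"
      by (intro image_eqI[of _ _ "t - 2 * pi * of_int n"]) auto
  qed auto
  then show ?thesis unfolding open_arc_def by (simp add: image_image cis_periodic)
qed

text \<open>After a shift by a multiple of \<open>2 * pi\<close> the arc starts in
  \<open>[0, 2 * pi)\<close> and passes \<open>2 * pi\<close> at most once; the part beyond
  reappears as an initial interval.\<close>

lemma measure_open_arc:
  assumes ab: "a < b" "b \<le> a + 2 * pi"
  shows "measure \<sigma> (open_arc a b) = (b - a) / (2 * pi)"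
proof -
  define n where "n = \<lfloor>a / (2 * pi)\<rfloor>"
  define a' where "a' = a - 2 * pi * of_int n"
  define b' where "b' = b - 2 * pi * of_int n"
  have "of_int n \<le> a / (2 * pi)" "a / (2 * pi) < of_int n + 1" by (auto simp: n_def)
  then have a': "0 \<le> a'" "a' < 2 * pi" by (auto simp: a'_def field_simps)
  have b': "a' < b'" "b' \<le> a' + 2 * pi" using ab by (auto simp: a'_def b'_def)
  have arc: "open_arc a b = open_arc a' b'" using open_arc_shift[of a' n b'] by (simp add: a'_def b'_def)
  have S: "{0..2*pi} \<inter> cis -` open_arc a' b' = {0..2*pi} \<inter> ({a'<..<b'} \<union> {..<b' - 2*pi})"
  proof (intro equalityI subsetI)
    fix t assume t: "t \<in> {0..2*pi} \<inter> cis -` open_arc a' b'"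
    then obtain s where s: "a' < s" "s < b'" "cis t = cis s" by (auto simp: open_arc_def)
    then have "sin s = sin t \<and> cos s = cos t" by (auto simp: complex_eq_iff)
    then obtain j :: int where j: "s = t + 2 * pi * of_int j" using sin_cos_eq_iff[of s t] by auto
    have t01: "0 \<le> t" "t \<le> 2 * pi" using t by auto
    have "2 * pi * of_int j = s - t" using j by simp
    then have "2 * pi * of_int j > 2 * pi * (-1)" "2 * pi * of_int j < 2 * pi * 2"
      using s a' b' t01 by linarith+
    then have "(of_int j :: real) > -1" "(of_int j :: real) < 2"
      by (simp_all only: mult_less_cancel_left_pos pi_gt_zero mult_pos_pos zero_less_numeral)
    then have "j = 0 \<or> j = 1" by linarith
    then show "t \<in> {0..2*pi} \<inter> ({a'<..<b'} \<union> {..<b' - 2*pi})" using t s j by auto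
  next
    fix t assume t: "t \<in> {0..2*pi} \<inter> ({a'<..<b'} \<union> {..<b' - 2*pi})"
    show "t \<in> {0..2*pi} \<inter> cis -` open_arc a' b'"
    proof (cases "t \<in> {a'<..<b'}")
      case False
      then have "t + 2 * pi \<in> {a'<..<b'}" using t a' by auto
      moreover have "cis (t + 2 * pi) = cis t" using cis_periodic[of t 1] by simp
      ultimately show ?thesis using t unfolding open_arc_def by (metis IntD1 IntI imageI vimageI)
    qed (use t in \<open>auto simp: open_arc_def\<close>)
  qed
  have "emeasure lborel ({0..2*pi} \<inter> cis -` open_arc a' b') = ennreal (b' - a')"
  proof (cases "b' \<le> 2 * pi")
    case True
    then have "{0..2*pi} \<inter> cis -` open_arc a' b' = {a'<..<b'}" unfolding S using a' b' by auto
    then show ?thesis using b' by simp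
  next
    case False
    then have e: "{0..2*pi} \<inter> cis -` open_arc a' b' = {a'<..2*pi} \<union> {0..<b' - 2*pi}" unfolding S using a' b' by auto
    have "emeasure lborel ({a'<..2*pi} \<union> {0..<b' - 2*pi}) = emeasure lborel {a'<..2*pi} + emeasure lborel {0..<b' - 2*pi}"
      using b' by (intro plus_emeasure[symmetric]) auto
    also have "\<dots> = ennreal (2 * pi - a') + ennreal (b' - 2 * pi)" using a' False by simp
    also have "\<dots> = ennreal (b' - a')" using a' False by (subst ennreal_plus[symmetric]) auto
    finally show ?thesis unfolding e .
  qed
  moreover have "open_arc a' b' \<in> sets \<sigma>"
    unfolding open_arc_eq[OF b'] by (rule arc_nhd_circle_sets)
  ultimately have "emeasure \<sigma> (open_arc a' b') = ennreal (b' - a') / ennreal (2 * pi)"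
    by (simp add: emeasure_circle)
  also have "\<dots> = ennreal ((b' - a') / (2 * pi))" using b' by (intro divide_ennreal) auto
  finally have "measure \<sigma> (open_arc a' b') = (b' - a') / (2 * pi)"
    using b' by (intro measure_eq_emeasure_eq_ennreal) auto
  then show ?thesis unfolding arc by (simp add: a'_def b'_def)
qed

text \<open>The chordal radii of an arc and of its dilation differ by at least a fixed multiple of
  \<open>L\<close>. Since \<open>cos\<close> vanishes at \<open>\<gamma> * x = pi / 2\<close>, the
  mean value theorem is used only up to the intermediate factor \<open>\<beta>\<close>, where
  \<open>cos\<close> stays above \<open>c0\<close>; monotonicity of the sine covers the
  rest.\<close>

lemma sin_dilate_gap:
  assumes \<gamma>: "\<gamma> > (1::real)"
  obtains \<delta> where "\<delta> > 0"
    "\<And>L. 0 < L \<Longrightarrow> \<gamma> * L \<le> 2 * pi \<Longrightarrow> \<delta> * L \<le> 1 \<and> 2 * sin (L / 4) + \<delta> * L \<le> 2 * sin (\<gamma> * L / 4)"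
proof -
  define \<beta> where "\<beta> = (1 + \<gamma>) / 2"
  have \<beta>: "1 < \<beta>" "\<beta> < \<gamma>" using \<gamma> by (auto simp: \<beta>_def)
  define z0 where "z0 = \<beta> * pi / (2 * \<gamma>)"
  have z0: "0 < z0" "z0 < pi / 2" using \<beta> \<gamma> by (auto simp: z0_def field_simps)
  define c0 where "c0 = cos z0"
  have c0: "c0 > 0" unfolding c0_def using z0 by (intro cos_gt_zero) auto
  \<comment> \<open>The 4 converts \<open>x = L / 4\<close>; the factor 2 in front of the sines
    leaves slack.\<close>
  define \<delta> where "\<delta> = (\<beta> - 1) * c0 / 4"
  have \<delta>: "\<delta> > 0" using \<beta> c0 by (simp add: \<delta>_def)
  show ?thesis
  proof (rule that[OF \<delta>])
    fix L assume L: "0 < L" "\<gamma> * L \<le> 2 * pi"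
    define x where "x = L / 4"
    have "\<gamma> * x = \<gamma> * L / 4" by (simp add: x_def)
    then have x: "0 < x" "\<gamma> * x \<le> pi / 2" using L by (simp add: x_def) (use L \<open>\<gamma> * x = \<gamma> * L / 4\<close> in linarith)
    have bx: "\<beta> * x \<le> z0"
    proof -
      have "x \<le> pi / (2 * \<gamma>)" using x \<gamma> by (simp add: field_simps)
      then have "\<beta> * x \<le> \<beta> * (pi / (2 * \<gamma>))" using \<beta> by (intro mult_left_mono) auto
      then show ?thesis by (simp add: z0_def)
    qed
    have xb: "x < \<beta> * x" "\<beta> * x < \<gamma> * x" using x(1) \<beta> by auto
    obtain z where z: "x < z" "z < \<beta> * x" "sin (\<beta> * x) - sin x = (\<beta> * x - x) * cos z"
      using MVT2[OF xb(1), of sin cos] by (auto intro: derivative_intros)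
    have "cos z \<ge> c0" unfolding c0_def using z x bx z0 by (intro cos_monotone_0_pi_le) auto
    then have "(\<beta> * x - x) * c0 \<le> sin (\<beta> * x) - sin x"
      unfolding z(3) using xb by (intro mult_left_mono) auto
    moreover have "sin (\<beta> * x) \<le> sin (\<gamma> * x)"
    proof (rule sin_monotone_2pi_le)
      have "0 < \<beta> * x" using x(1) \<beta> by simp
      then show "- (pi / 2) \<le> \<beta> * x" using pi_gt_zero by linarith
    qed (use xb x in auto)
    moreover have "(\<beta> * x - x) * c0 = \<delta> * L" by (simp add: \<delta>_def x_def field_simps)
    ultimately have gap: "\<delta> * L \<le> sin (\<gamma> * x) - sin x" by linarith
    have "x \<le> pi" using xb x(2) pi_gt_zero by linarith
    then have "sin x \<ge> 0" using x(1) by (intro sin_ge_zero) auto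
    then have "\<delta> * L \<le> 1" using gap sin_le_one[of "\<gamma> * x"] by linarith
    moreover have "2 * sin x + \<delta> * L \<le> 2 * sin (\<gamma> * x)"
      using gap mult_pos_pos[OF \<delta> L(1)] by linarith
    ultimately show "\<delta> * L \<le> 1 \<and> 2 * sin (L / 4) + \<delta> * L \<le> 2 * sin (\<gamma> * L / 4)"
      by (simp add: x_def)
  qed
qed

text \<open>With \<open>d = \<delta> * L\<close> and \<open>p = L / (2 * pi)\<close> all powers of
  \<open>L\<close> cancel; 32 * pi is 16 times 2 * pi.\<close>

lemma local_const_le:
  assumes "0 < L" "0 \<le> \<rho>" "\<rho> \<le> L / 2" "0 < \<delta>"
  shows "local_const \<rho> (\<delta> * L) (L / (2 * pi)) \<le> 2 * (1 + 32 * pi * (1/2 + \<delta>) ^ 3 / \<delta>\<^sup>2)"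
proof -
  have "(\<rho> + \<delta> * L) ^ 3 \<le> (L * (1/2 + \<delta>)) ^ 3"
    using assms by (intro power_mono) (auto simp: algebra_simps)
  then have "16 * (\<rho> + \<delta> * L) ^ 3 / (\<delta> * L)\<^sup>2 / (L / (2 * pi)) \<le> 16 * (L * (1/2 + \<delta>)) ^ 3 / (\<delta> * L)\<^sup>2 / (L / (2 * pi))"
    using assms by (intro divide_right_mono mult_left_mono) auto
  also have "\<dots> = 32 * pi * (1/2 + \<delta>) ^ 3 / \<delta>\<^sup>2"
    unfolding power_mult_distrib using assms by (simp add: power2_eq_square power3_eq_cube field_simps)
  finally show ?thesis by (simp add: local_const_def)
qed

section \<open>The uniqueness theorem\<close>

lemma capacity_le_1:
  assumes sets_\<mu>: "sets \<mu> = sets circle_borel" and E: "E \<subseteq> unit_circle"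
  shows "capacity \<mu> E \<le> 1"
proof -
  let ?f = "\<lambda>_::complex. 1::complex"
  have fL: "?f \<in> L2_circle" by (simp add: L2_circle_iff emeasure_circle_measure_space)
  have "dirichlet_integral \<mu> ?f \<le> (\<integral>\<^sup>+ \<xi>. dirichlet_at \<xi> ?f 1 \<partial>\<mu>)"
    by (rule dirichlet_integral_le[OF sets_\<mu> L2_circle_integrable(1)[OF fL]])
  also have "\<dots> = 0" by (simp add: dirichlet_at_eq)
  finally have D: "dirichlet_integral \<mu> ?f = 0" by simp
  then have n: "norm_sq \<mu> ?f = 1" by (simp add: norm_sq_def emeasure_circle_measure_space)
  have "?f \<in> harmonic_dirichlet_space \<mu>" using fL D by (simp add: harmonic_dirichlet_space_def)
  moreover have "openin (top_of_set unit_circle) unit_circle" by simp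
  ultimately have "capacity \<mu> E \<le> norm_sq \<mu> ?f"
    unfolding capacity_def using E by (intro Inf_lower) (auto intro!: exI[of _ unit_circle])
  then show ?thesis by (simp add: n)
qed

lemma dilated_arc_eq:
  assumes "a < b" "0 < \<gamma>" "\<gamma> * (b - a) \<le> 2 * pi"
  shows "dilated_arc \<gamma> a b = arc_nhd (cis ((a + b) / 2)) (2 * sin (\<gamma> * (b - a) / 4)) \<inter> unit_circle"
proof -
  define a' where "a' = a - (\<gamma> - 1) * ((b - a) / 2)"
  define b' where "b' = b + (\<gamma> - 1) * ((b - a) / 2)"
  have d: "b' - a' = \<gamma> * (b - a)" and m: "a' + b' = a + b" by (auto simp: a'_def b'_def field_simps)
  have "0 < \<gamma> * (b - a)" using assms by simp
  then have "a' < b'" "b' \<le> a' + 2 * pi" using d assms(3) by linarith+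
  from open_arc_eq[OF this] show ?thesis
    unfolding d m by (simp add: dilated_arc_def a'_def b'_def)
qed

lemma dilated_arc_full:
  assumes "\<gamma> * (b - a) > 2 * pi"
  shows "unit_circle \<subseteq> dilated_arc \<gamma> a b"
proof
  fix \<zeta> :: complex assume "\<zeta> \<in> unit_circle"
  then have "cmod \<zeta> = 1" by simp
  then obtain \<theta> where \<theta>: "\<zeta> = cis ((a + b) / 2 + \<theta>)" "\<bar>\<theta>\<bar> \<le> pi" by (rule circle_cis_around)
  have "a - (\<gamma> - 1) * ((b - a) / 2) = (a + b) / 2 - \<gamma> * (b - a) / 2"
    "b + (\<gamma> - 1) * ((b - a) / 2) = (a + b) / 2 + \<gamma> * (b - a) / 2" by (simp_all add: field_simps)
  then show "\<zeta> \<in> dilated_arc \<gamma> a b"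
    unfolding dilated_arc_def open_arc_def \<theta>(1) using \<theta>(2) assms by (intro imageI) auto
qed

text \<open>A dilated arc of length more than \<open>2 * pi\<close> would cover the circle and so
  contain the midpoint of the arc of index \<open>Suc n\<close>, which lies in its own dilated
  arc.\<close>

lemma disjoint_dilated_arcs_length:
  fixes a b :: "nat \<Rightarrow> real"
  assumes ab: "\<And>n. a n < b n" and \<gamma>: "\<gamma> > 1"
    and disj: "disjoint_family (\<lambda>n. dilated_arc \<gamma> (a n) (b n))"
  shows "\<gamma> * (b n - a n) \<le> 2 * pi"
proof (rule ccontr)
  assume "\<not> ?thesis"
  then have full: "unit_circle \<subseteq> dilated_arc \<gamma> (a n) (b n)" by (intro dilated_arc_full) simp
  let ?m = "Suc n"
  have "0 < (\<gamma> - 1) * ((b ?m - a ?m) / 2)" using \<gamma> ab[of ?m] by simp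
  then have "(a ?m + b ?m) / 2 \<in> {a ?m - (\<gamma> - 1) * ((b ?m - a ?m) / 2)<..<b ?m + (\<gamma> - 1) * ((b ?m - a ?m) / 2)}"
    using ab[of ?m] by (simp only: greaterThanLessThan_iff) (auto simp: field_simps)
  then have "cis ((a ?m + b ?m) / 2) \<in> dilated_arc \<gamma> (a ?m) (b ?m)"
    unfolding dilated_arc_def open_arc_def by (rule imageI)
  moreover have "cis ((a ?m + b ?m) / 2) \<in> dilated_arc \<gamma> (a n) (b n)" using full by auto
  moreover have "dilated_arc \<gamma> (a n) (b n) \<inter> dilated_arc \<gamma> (a ?m) (b ?m) = {}"
    using disj by (simp add: disjoint_family_on_def)
  ultimately show False by blast
qed

lemma open_arc_subset_dilated: "a < b \<Longrightarrow> \<gamma> > 1 \<Longrightarrow> open_arc a b \<subseteq> dilated_arc \<gamma> a b"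
proof -
  assume "a < b" "\<gamma> > 1"
  then have "0 < (\<gamma> - 1) * ((b - a) / 2)" by simp
  then show ?thesis unfolding dilated_arc_def open_arc_def by (intro image_mono) auto
qed

text \<open>The step function \<open>v = \<Sum> 1\<^bsub>I n\<^esub> log (t n)\<close> is used in place of \<open>log \<bar>f\<bar>\<close>.\<close>
lemma norm_integral_le_step:
  fixes I :: "nat \<Rightarrow> complex set" and t :: "nat \<Rightarrow> real"
  assumes f: "integrable \<sigma> f"
    and ortho: "\<And>n. (LINT \<zeta>|\<sigma>. \<zeta> ^ Suc n * f \<zeta>) = 0"
    and I: "\<And>n. I n \<in> sets \<sigma>" "disjoint_family I" and p: "\<And>n. measure \<sigma> (I n) > 0"
    and t: "\<And>n. t n > 0" "\<And>n. circle_mean (I n) f \<le> t n"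
  shows "cmod (LINT \<zeta>|\<sigma>. f \<zeta>)
    \<le> exp (\<Sum>n<k. measure \<sigma> (I n) * ln (t n)) * ((LINT \<zeta>|\<sigma>. cmod (f \<zeta>)) + 1)"
proof -
  define v where "v \<zeta> = (\<Sum>n<k. indicator (I n) \<zeta> * ln (t n))" for \<zeta>
  have [measurable]: "(\<lambda>\<zeta>. indicator (I n) \<zeta> :: real) \<in> borel_measurable \<sigma>" for n
    by (rule borel_measurable_indicator[OF I(1)])
  have vm [measurable]: "v \<in> borel_measurable \<sigma>" unfolding v_def by measurable
  have fm [measurable]: "f \<in> borel_measurable \<sigma>" using f by auto
  have vb: "\<bar>v \<zeta>\<bar> \<le> (\<Sum>n<k. \<bar>ln (t n)\<bar>)" for \<zeta>
    unfolding v_def by (rule order_trans[OF sum_abs]) (intro sum_mono, auto simp: indicator_def)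
  have ii: "integrable \<sigma> (\<lambda>\<zeta>. indicator (I n) \<zeta> :: real)" for n
    by (rule circle.integrable_const_bound[where B=1]) auto
  have Iu: "I n \<inter> unit_circle = I n" for n
    using sets.sets_into_space[OF I(1)[of n]] by (simp add: Int_absorb2)
  have intv: "(LINT \<zeta>|\<sigma>. v \<zeta>) = (\<Sum>n<k. measure \<sigma> (I n) * ln (t n))"
    unfolding v_def using ii by (subst Bochner_Integration.integral_sum) (auto simp: Iu)
  have jf: "integrable \<sigma> (\<lambda>\<zeta>. indicator (I n) \<zeta> * cmod (f \<zeta>))" for n
    by (rule integrable_indicator_norm[OF f I(1)])
  \<comment> \<open>Off the arcs \<open>v = 0\<close>. On \<open>I n\<close> the exponential is
    \<open>1 / t n\<close>, and since \<open>t n\<close> dominates the mean of \<open>|f|\<close>,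
    the arc contributes at most its measure; disjointness bounds the sum of the measures by
    1.\<close>
  have "(LINT \<zeta>|\<sigma>. cmod (f \<zeta>) * exp (- v \<zeta>))
    \<le> (LINT \<zeta>|\<sigma>. cmod (f \<zeta>) + (\<Sum>n<k. indicator (I n) \<zeta> * cmod (f \<zeta>) / t n))"
  proof (rule integral_mono)
    show "integrable \<sigma> (\<lambda>\<zeta>. cmod (f \<zeta>) * exp (- v \<zeta>))"
    proof (rule Bochner_Integration.integrable_bound)
      show "integrable \<sigma> (\<lambda>\<zeta>. exp (\<Sum>n<k. \<bar>ln (t n)\<bar>) *\<^sub>R f \<zeta>)" using f by simp
      have "exp (- v \<zeta>) \<le> exp (\<Sum>n<k. \<bar>ln (t n)\<bar>)" for \<zeta> using vb[of \<zeta>] by (simp add: abs_le_iff)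
      then show "AE \<zeta> in \<sigma>. norm (cmod (f \<zeta>) * exp (- v \<zeta>)) \<le> norm (exp (\<Sum>n<k. \<bar>ln (t n)\<bar>) *\<^sub>R f \<zeta>)"
        by (intro AE_I2) (simp add: mult.commute[of "cmod _"] mult_right_mono)
    qed measurable
    show "integrable \<sigma> (\<lambda>\<zeta>. cmod (f \<zeta>) + (\<Sum>n<k. indicator (I n) \<zeta> * cmod (f \<zeta>) / t n))"
      using f jf by auto
    fix \<zeta>
    show "cmod (f \<zeta>) * exp (- v \<zeta>) \<le> cmod (f \<zeta>) + (\<Sum>n<k. indicator (I n) \<zeta> * cmod (f \<zeta>) / t n)"
    proof (cases "\<exists>n<k. \<zeta> \<in> I n")
      case True
      then obtain n where n: "n < k" "\<zeta> \<in> I n" by blast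
      have ind: "indicator (I i) \<zeta> = (if i = n then 1 else 0 :: real)" for i
        using I(2) n(2) by (auto simp: disjoint_family_on_def indicator_def)
      have "v \<zeta> = ln (t n)" unfolding v_def ind using n(1) by (simp add: if_distrib[of "\<lambda>x. x * _"] sum.delta cong: if_cong)
      then have "exp (- v \<zeta>) = 1 / t n" using t(1)[of n] by (simp add: exp_minus inverse_eq_divide)
      moreover have "(\<Sum>n<k. indicator (I n) \<zeta> * cmod (f \<zeta>) / t n) = cmod (f \<zeta>) / t n"
      proof -
        have "(\<Sum>i<k. indicator (I i) \<zeta> * cmod (f \<zeta>) / t i) = (\<Sum>i<k. if i = n then cmod (f \<zeta>) / t i else 0)"
          by (intro sum.cong) (auto simp: ind)
        then show ?thesis using n(1) by simp
      qed
      ultimately show ?thesis by simp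
    next
      case False
      then have "v \<zeta> = 0" unfolding v_def by (intro sum.neutral) (auto simp: indicator_def)
      moreover have "0 \<le> (\<Sum>n<k. indicator (I n) \<zeta> * cmod (f \<zeta>) / t n)"
        using t(1) by (intro sum_nonneg divide_nonneg_nonneg) (auto intro: less_imp_le)
      ultimately show ?thesis by simp
    qed
  qed
  also have "\<dots> = (LINT \<zeta>|\<sigma>. cmod (f \<zeta>)) + (\<Sum>n<k. (LINT \<zeta>|\<sigma>. indicator (I n) \<zeta> * cmod (f \<zeta>)) / t n)"
    using f jf by (subst Bochner_Integration.integral_add; (subst Bochner_Integration.integral_sum)?) auto
  also have "(\<Sum>n<k. (LINT \<zeta>|\<sigma>. indicator (I n) \<zeta> * cmod (f \<zeta>)) / t n) \<le> (\<Sum>n<k. measure \<sigma> (I n))"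
  proof (rule sum_mono)
    fix n
    have "(LINT \<zeta>|\<sigma>. indicator (I n) \<zeta> * cmod (f \<zeta>)) = circle_mean (I n) f * measure \<sigma> (I n)"
      using p[of n] by (simp add: circle_mean_def)
    also have "\<dots> \<le> t n * measure \<sigma> (I n)" by (intro mult_right_mono t) auto
    finally show "(LINT \<zeta>|\<sigma>. indicator (I n) \<zeta> * cmod (f \<zeta>)) / t n \<le> measure \<sigma> (I n)"
      using t(1)[of n] by (simp add: divide_le_eq mult.commute)
  qed
  also have "(\<Sum>n<k. measure \<sigma> (I n)) = measure \<sigma> (\<Union>n<k. I n)"
    using I by (intro circle.finite_measure_finite_Union[symmetric]) (auto simp: disjoint_family_on_def)
  also have "\<dots> \<le> 1" by (rule circle.prob_le_1)
  finally have "(LINT \<zeta>|\<sigma>. cmod (f \<zeta>) * exp (- v \<zeta>)) \<le> (LINT \<zeta>|\<sigma>. cmod (f \<zeta>)) + 1" by simp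
  then have "exp (LINT \<zeta>|\<sigma>. v \<zeta>) * (LINT \<zeta>|\<sigma>. cmod (f \<zeta>) * exp (- v \<zeta>))
      \<le> exp (LINT \<zeta>|\<sigma>. v \<zeta>) * ((LINT \<zeta>|\<sigma>. cmod (f \<zeta>)) + 1)"
    by (rule mult_left_mono) simp
  with norm_integral_le_exp[OF f ortho vm vb] show ?thesis unfolding intv by linarith
qed

text \<open>If some \<open>c n\<close> were 0, its term would be \<open>\<infinity>\<close>, and in
  \<open>ereal\<close> every finite sum with such a term is \<open>\<infinity>\<close>, so the
  partial sums could not tend to \<open>-\<infinity>\<close>. Positive and at most 1, all
  \<open>c n\<close> are then real numbers, and the divergence is one of real series.\<close>

lemma log_series_diverges:
  fixes L :: "nat \<Rightarrow> real" and c :: "nat \<Rightarrow> ennreal"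
  assumes L: "\<And>n. 0 < L n" and c: "\<And>n. c n \<le> 1"
    and sums: "(\<lambda>n. ereal (L n) * ext_ln (ennreal (L n) / c n)) sums (-\<infinity>)"
  shows "0 < enn2real (c n)" and "filterlim (\<lambda>k. \<Sum>n<k. L n * ln (L n / enn2real (c n))) at_bot sequentially"
proof -
  let ?T = "\<lambda>n. ereal (L n) * ext_ln (ennreal (L n) / c n)"
  have lim: "(\<lambda>k. \<Sum>n<k. ?T n) \<longlonglongrightarrow> -\<infinity>" using sums by (simp add: sums_def)
  have c0: "c n \<noteq> 0" for n
  proof
    assume 0: "c n = 0"
    have "?T n = \<infinity>" using L[of n] by (simp add: 0 ext_ln_def ennreal_divide_zero ennreal_zero_divide)
    then have "(\<Sum>i<k. ?T i) = \<infinity>" if "n < k" for k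
      unfolding sum_Pinfty using that by auto
    then have "\<forall>\<^sub>F k in sequentially. (\<Sum>i<k. ?T i) = \<infinity>"
      by (rule eventually_mono[OF eventually_gt_at_top[of n]])
    then have "(\<lambda>k. \<Sum>n<k. ?T n) \<longlonglongrightarrow> \<infinity>" by (rule tendsto_eventually)
    from LIMSEQ_unique[OF lim this] show False by simp
  qed
  have ctop: "c n < top" for n using c[of n] by (rule order_le_less_trans) simp
  show pos: "0 < enn2real (c n)" for n using c0[of n] ctop[of n] by (simp add: enn2real_positive_iff zero_less_iff_neq_zero)
  have T: "?T n = ereal (L n * ln (L n / enn2real (c n)))" for n
  proof -
    have "ennreal (L n) / c n = ennreal (L n) / ennreal (enn2real (c n))" using ctop[of n] by simp
    also have "\<dots> = ennreal (L n / enn2real (c n))" using L[of n] pos[of n] by (intro divide_ennreal) auto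
    finally have e: "ennreal (L n) / c n = ennreal (L n / enn2real (c n))" .
    have q: "0 < L n / enn2real (c n)" using L[of n] pos[of n] by simp
    have "ext_ln (ennreal y) = ereal (ln y)" if "0 < y" for y
      using that by (simp add: ext_ln_def)
    from this[OF q] show ?thesis unfolding e by simp
  qed
  have "(\<lambda>k. ereal (\<Sum>n<k. L n * ln (L n / enn2real (c n)))) \<longlonglongrightarrow> -\<infinity>"
    using lim unfolding T by simp
  then show "filterlim (\<lambda>k. \<Sum>n<k. L n * ln (L n / enn2real (c n))) at_bot sequentially"
    by (simp add: tendsto_MInfty filterlim_at_bot_dense)
qed

theorem theorem1p1:
  fixes \<mu> :: "complex measure" and E :: "complex set"
    and a b :: "nat \<Rightarrow> real" and \<gamma> :: real
  assumes "finite_measure \<mu>" and "sets \<mu> = sets circle_borel"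
    and "E \<in> sets borel" and "E \<subseteq> unit_circle"
    and "\<And>n. a n < b n" and "\<And>n. b n \<le> a n + 2 * pi"
    and "\<gamma> > 1"
    and "disjoint_family (\<lambda>n. dilated_arc \<gamma> (a n) (b n))"
    and "(\<lambda>n. ereal (b n - a n) *
           ext_ln (ennreal (b n - a n) / capacity \<mu> (E \<inter> open_arc (a n) (b n)))) sums (-\<infinity>)"
  shows "uniqueness_set \<mu> E"
  unfolding uniqueness_set_def
proof (intro ballI impI)
  note sets_\<mu> = assms(2) and ab = assms(5) and ab2 = assms(6) and \<gamma> = assms(7) and disj = assms(8)
  fix f assume f: "f \<in> dirichlet_space \<mu>" and qe: "qe_on \<mu> E (\<lambda>\<zeta>. has_nt_limit (poisson_ext f) \<zeta> 0)"
  have fH: "f \<in> harmonic_dirichlet_space \<mu>" and neg: "\<And>n. n < 0 \<Longrightarrow> fourier_coeff f n = 0"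
    using f by (auto simp: dirichlet_space_def)
  have fL: "f \<in> L2_circle" and fD: "dirichlet_integral \<mu> f < \<infinity>" using fH by (auto simp: harmonic_dirichlet_space_def)
  note fi = L2_circle_integrable[OF fL]
  have fm [measurable]: "f \<in> borel_measurable \<sigma>" by fact
  have nf: "norm_sq \<mu> f < \<infinity>" using fL fD by (simp add: norm_sq_def L2_circle_iff)

  define L where "L n = b n - a n" for n
  define c where "c n = cis ((a n + b n) / 2)" for n
  define I where "I n = open_arc (a n) (b n)" for n
  define p where "p n = measure \<sigma> (I n)" for n
  have L0: "0 < L n" for n using ab[of n] by (simp add: L_def)
  have \<gamma>L: "\<gamma> * L n \<le> 2 * pi" for n
    unfolding L_def by (rule disjoint_dilated_arcs_length[OF ab \<gamma> disj])
  \<comment> \<open>\<open>\<delta>\<close> depends on \<gamma> only, and the collar width will be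
    \<open>\<delta> * L n\<close>, proportional to the arc; this makes the constant
    \<open>K0\<close> independent of \<open>n\<close>.\<close>
  obtain \<delta> where \<delta>: "\<delta> > 0" and gap: "\<And>L. 0 < L \<Longrightarrow> \<gamma> * L \<le> 2 * pi \<Longrightarrow>
      \<delta> * L \<le> 1 \<and> 2 * sin (L / 4) + \<delta> * L \<le> 2 * sin (\<gamma> * L / 4)"
    by (rule sin_dilate_gap[OF \<gamma>], rule that)
  define \<rho> where "\<rho> n = 2 * sin (L n / 4)" for n
  define d where "d n = \<delta> * L n" for n
  have L2: "L n \<le> 2 * pi" for n using ab2[of n] by (simp add: L_def)
  have \<rho>0: "0 < \<rho> n" for n
    unfolding \<rho>_def using L0[of n] L2[of n] by (simp add: sin_gt_zero)
  have \<rho>L: "\<rho> n \<le> L n / 2" for n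
    unfolding \<rho>_def using sin_x_le_x[of "L n / 4"] L0[of n] by simp
  have Ieq: "I n = arc_nhd (c n) (\<rho> n) \<inter> unit_circle" for n
    unfolding I_def c_def \<rho>_def L_def by (rule open_arc_eq[OF ab ab2])
  have Is: "I n \<in> sets \<sigma>" for n unfolding Ieq by (rule arc_nhd_circle_sets)
  have p: "p n = L n / (2 * pi)" for n
    unfolding p_def I_def L_def by (rule measure_open_arc[OF ab ab2])
  have p0: "p n > 0" for n using L0[of n] by (simp add: p)
  have arc: "arc_setting (c n) (\<rho> n) (d n) (I n)" for n
  proof
    show "cmod (c n) = 1" by (simp add: c_def)
    show "0 < d n" "d n \<le> 1" using \<delta> L0[of n] gap[OF L0 \<gamma>L, of n] by (auto simp: d_def)
    show "0 < measure \<sigma> (I n)" using p0[of n] by (simp add: p_def)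
    show "cmod (\<zeta> - c n) \<le> \<rho> n" if "\<zeta> \<in> I n" for \<zeta> using that by (simp add: Ieq arc_nhd_def)
  qed (use \<rho>0 Is in auto)
  \<comment> \<open>The trace on the circle of the support of the cutoff. The gap inequality places
    it inside the dilated arc, whence disjointness.\<close>
  define S where "S n = arc_nhd (c n) (\<rho> n + d n) \<inter> unit_circle" for n
  have Ssub: "S n \<subseteq> dilated_arc \<gamma> (a n) (b n)" for n
  proof -
    have "dilated_arc \<gamma> (a n) (b n) = arc_nhd (c n) (2 * sin (\<gamma> * L n / 4)) \<inter> unit_circle"
      unfolding c_def L_def using \<gamma> \<gamma>L[of n] by (intro dilated_arc_eq ab) (auto simp: L_def)
    moreover have "\<rho> n + d n \<le> 2 * sin (\<gamma> * L n / 4)"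
      using gap[OF L0 \<gamma>L, of n] by (simp add: \<rho>_def d_def)
    ultimately show ?thesis by (auto simp: S_def arc_nhd_def)
  qed
  have Sdisj: "disjoint_family S" using disj Ssub unfolding disjoint_family_on_def by blast
  have Idisj: "disjoint_family I"
    using disj open_arc_subset_dilated[OF ab \<gamma>] unfolding disjoint_family_on_def I_def by blast
  define LE where "LE n = local_energy \<mu> f (S n)" for n
  have LEsum: "(\<Sum>n<k. LE n) \<le> norm_sq \<mu> f" for k
    unfolding LE_def by (rule sum_local_energy_le[OF sets_\<mu> fi(1) _ Sdisj]) (simp add: S_def arc_nhd_circle_sets)
  have LEfin: "LE n < \<infinity>" for n
  proof -
    have "LE n \<le> (\<Sum>i<Suc n. LE i)" by simp
    also have "\<dots> < \<infinity>" using LEsum[of "Suc n"] nf by (rule order_le_less_trans)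
    finally show ?thesis .
  qed
  define N where "N n = enn2real (LE n)" for n
  have N: "LE n = ennreal (N n)" "N n \<ge> 0" for n using LEfin[of n] by (simp_all add: N_def)
  define A where "A = enn2real (norm_sq \<mu> f)"
  have Nsum: "(\<Sum>n<k. N n) \<le> A" for k
  proof -
    have "ennreal (\<Sum>n<k. N n) = (\<Sum>n<k. LE n)" unfolding N(1) using N(2) by (simp add: sum_ennreal)
    also have "\<dots> \<le> ennreal A" using LEsum[of k] nf by (simp add: A_def)
    finally show ?thesis by (simp add: A_def ennreal_le_iff)
  qed

  define K0 where "K0 = 2 * (1 + 32 * pi * (1/2 + \<delta>) ^ 3 / \<delta>\<^sup>2)"
  \<comment> \<open>The 9 is the square of the 3 in the factor \<open>3 / m\<close> of the test
    function.\<close>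
  define C where "C = 9 * K0"
  have "K0 \<ge> 2" using \<delta> by (simp add: K0_def)
  then have C1: "C \<ge> 1" by (simp add: C_def)
  have K0: "local_const (\<rho> n) (d n) (p n) \<le> K0" for n
    unfolding K0_def p d_def using \<rho>0[of n] by (intro local_const_le L0 \<rho>L \<delta>) auto
  define cap where "cap n = capacity \<mu> (E \<inter> I n)" for n
  have cap1: "cap n \<le> 1" for n
    unfolding cap_def using assms(4) by (intro capacity_le_1[OF sets_\<mu>]) auto
  have series: "(\<lambda>n. ereal (L n) * ext_ln (ennreal (L n) / cap n)) sums (-\<infinity>)"
    using assms(9) by (simp add: L_def cap_def I_def)
  define q where "q n = enn2real (cap n)" for n
  have q0: "q n > 0" for n unfolding q_def by (rule log_series_diverges(1)[OF L0 cap1 series])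
  have capq: "cap n = ennreal (q n)" for n
    using order_le_less_trans[OF cap1[of n]] by (simp add: q_def)
  have lim: "filterlim (\<lambda>k. \<Sum>n<k. L n * ln (L n / q n)) at_bot sequentially"
    unfolding q_def by (rule log_series_diverges(2)[OF L0 cap1 series])
  have mean: "(circle_mean (I n) f)\<^sup>2 * q n \<le> C * N n" for n
  proof -
    have Iop: "openin (top_of_set unit_circle) (I n)" unfolding Ieq by (rule arc_nhd_circle_openin)
    have "ennreal ((circle_mean (I n) f)\<^sup>2) * cap n
      \<le> ennreal (9 * local_const (\<rho> n) (d n) (p n)) * local_energy \<mu> f (arc_nhd (c n) (\<rho> n + d n))"
      unfolding cap_def p_def by (rule capacity_mean_le[OF sets_\<mu> arc fH Iop assms(4) qe])
    also have "\<dots> \<le> ennreal C * LE n"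
      unfolding LE_def S_def local_energy_Int_circle C_def using K0[of n] by (intro mult_right_mono ennreal_leI) auto
    finally have "ennreal ((circle_mean (I n) f)\<^sup>2 * q n) \<le> ennreal (C * N n)"
      using N[of n] q0[of n] C1 by (simp add: capq ennreal_mult)
    then show ?thesis using N(2)[of n] C1 by (simp add: ennreal_le_iff)
  qed

  \<comment> \<open>Adding \<open>L n\<close> keeps \<open>t n\<close> positive when the local
    energy vanishes, and leads to \<open>ln (1 + N n / L n) \<le> N n / L n\<close>, whose product
    with \<open>L n\<close> has bounded partial sums.\<close>
  define t where "t n = sqrt (C * (N n + L n) / q n)" for n
  have t0: "t n > 0" for n unfolding t_def using C1 N(2)[of n] L0[of n] q0[of n] by (simp add: add_nonneg_pos)
  have tm: "circle_mean (I n) f \<le> t n" for n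
    unfolding t_def
  proof (rule real_le_rsqrt)
    have "C * N n \<le> C * (N n + L n)" using C1 L0[of n] by (intro mult_left_mono) auto
    then show "(circle_mean (I n) f)\<^sup>2 \<le> C * (N n + L n) / q n"
      using mean[of n] q0[of n] by (simp add: pos_le_divide_eq)
  qed
  have psum: "(\<Sum>n<k. p n) \<le> 1" for k
  proof -
    have "(\<Sum>n<k. p n) = measure \<sigma> (\<Union>n<k. I n)"
      unfolding p_def using Is Idisj
      by (intro circle.finite_measure_finite_Union[symmetric]) (auto simp: disjoint_family_on_def)
    then show ?thesis using circle.prob_le_1 by simp
  qed
  \<comment> \<open>The denominator \<open>4 * pi\<close> combines
    \<open>p n = L n / (2 * pi)\<close> with the 1/2 from the square root.\<close>
  have lnt: "p n * ln (t n) \<le> (p n * (2 * pi) * ln C + N n + L n * ln (L n / q n)) / (4 * pi)" for n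
  proof -
    have "2 * ln (t n) = ln (C * (N n + L n) / q n)"
      unfolding t_def using C1 N(2)[of n] L0[of n] q0[of n] by (simp add: ln_sqrt add_nonneg_pos)
    also have "C * (N n + L n) / q n = C * ((N n + L n) / L n * (L n / q n))" using L0[of n] by simp
    also have "ln \<dots> = ln C + (ln ((N n + L n) / L n) + ln (L n / q n))"
      using C1 N(2)[of n] L0[of n] q0[of n] by (subst ln_mult_pos; (subst ln_mult_pos)?) (auto simp: add_nonneg_pos)
    also have "ln ((N n + L n) / L n) \<le> (N n + L n) / L n - 1"
      using N(2)[of n] L0[of n] by (intro ln_le_minus_one) (auto simp: add_nonneg_pos)
    also have "(N n + L n) / L n - 1 = N n / L n" using L0[of n] by (simp add: add_divide_distrib)
    finally have "2 * ln (t n) \<le> ln C + (N n / L n + ln (L n / q n))" by simp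
    then have "L n * (2 * ln (t n)) \<le> L n * (ln C + (N n / L n + ln (L n / q n)))"
      using L0[of n] by (intro mult_left_mono) auto
    also have "\<dots> = L n * ln C + N n + L n * ln (L n / q n)" using L0[of n] by (simp add: algebra_simps)
    finally have "L n * (2 * ln (t n)) / (4 * pi) \<le> (L n * ln C + N n + L n * ln (L n / q n)) / (4 * pi)"
      by (intro divide_right_mono) auto
    moreover have "p n * ln (t n) = L n * (2 * ln (t n)) / (4 * pi)" by (simp add: p)
    moreover have "p n * (2 * pi) = L n" by (simp add: p)
    ultimately show ?thesis by simp
  qed
  \<comment> \<open>\<open>C \<ge> 1\<close> makes \<open>ln C\<close> nonnegative, so the total
    measure of the arcs may be replaced by 1. What remains is the divergent series, which drives
    \<open>B\<close> to \<open>-\<infinity>\<close>.\<close>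
  define B where "B k = (2 * pi * ln C + A + (\<Sum>n<k. L n * ln (L n / q n))) / (4 * pi)" for k
  have sumB: "(\<Sum>n<k. p n * ln (t n)) \<le> B k" for k
  proof -
    have "(\<Sum>n<k. p n * ln (t n)) \<le> (\<Sum>n<k. (p n * (2 * pi) * ln C + N n + L n * ln (L n / q n)) / (4 * pi))"
      by (intro sum_mono lnt)
    also have "\<dots> = ((\<Sum>n<k. p n) * (2 * pi) * ln C + (\<Sum>n<k. N n) + (\<Sum>n<k. L n * ln (L n / q n))) / (4 * pi)"
      by (simp only: sum_divide_distrib[symmetric] sum.distrib sum_distrib_right[symmetric])
    also have "\<dots> \<le> B k"
    proof -
      have "(\<Sum>n<k. p n) * (2 * pi * ln C) \<le> 1 * (2 * pi * ln C)"
        using C1 by (intro mult_right_mono psum) auto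
      moreover have "(\<Sum>n<k. p n) * (2 * pi) * ln C = (\<Sum>n<k. p n) * (2 * pi * ln C)"
        by (simp only: mult.assoc)
      ultimately have "(\<Sum>n<k. p n) * (2 * pi) * ln C + (\<Sum>n<k. N n) \<le> 2 * pi * ln C + A"
        using Nsum[of k] by linarith
      then show ?thesis unfolding B_def by (intro divide_right_mono add_right_mono) auto
    qed
    finally show ?thesis .
  qed
  have Blim: "(\<lambda>k. exp (B k)) \<longlonglongrightarrow> 0"
  proof -
    have "filterlim B at_bot sequentially"
      unfolding filterlim_at_bot
    proof
      fix Z
      have "\<forall>\<^sub>F k in sequentially. (\<Sum>n<k. L n * ln (L n / q n)) \<le> 4 * pi * Z - (2 * pi * ln C + A)"
        using lim unfolding filterlim_at_bot by blast
      then show "\<forall>\<^sub>F k in sequentially. B k \<le> Z"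
        by eventually_elim (simp add: B_def divide_le_eq mult.commute)
    qed
    then show ?thesis by (rule filterlim_compose[OF exp_at_bot])
  qed

  have circ: "\<zeta> * cnj \<zeta> = 1" if "cmod \<zeta> = 1" for \<zeta>
    using that complex_norm_square[of \<zeta>] by simp
  \<comment> \<open>In the normalization of \<open>fourier_coeff\<close>, positive powers of \<zeta>
    test the coefficients of negative index.\<close>
  have posc: "(LINT \<zeta>|\<sigma>. \<zeta> ^ Suc n * f \<zeta>) = 0" for n
  proof -
    have "fourier_coeff f (- int (Suc n)) = (LINT \<zeta>|\<sigma>. \<zeta> ^ Suc n * f \<zeta>)"
      unfolding fourier_coeff_def minus_minus power_int_of_nat by (simp add: mult.commute)
    then show ?thesis using neg[of "- int (Suc n)"] by simp
  qed
  have "(LINT \<zeta>|\<sigma>. cnj \<zeta> ^ j * f \<zeta>) = 0" for j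
  proof (induction j rule: less_induct)
    case (less j)
    \<comment> \<open>Multiplication by \<open>cnj \<zeta> ^ j\<close> moves coefficient
      \<open>j\<close> to position 0. The coefficients below \<open>j\<close> vanish, by induction
      or because \<open>f\<close> lies in the analytic space, so \<open>g\<close> satisfies the same
      orthogonality; its modulus on the circle, and hence every mean and every bound, is that of
      \<open>f\<close>.\<close>
    define g where "g \<zeta> = cnj \<zeta> ^ j * f \<zeta>" for \<zeta>
    have gi: "integrable \<sigma> g"
      unfolding g_def by (rule integrable_circle_bounded_mult[OF fi(1), where C=1]) (auto simp: norm_power)
    have gf: "cmod (g \<zeta>) = cmod (f \<zeta>)" if "cmod \<zeta> = 1" for \<zeta> using that by (simp add: g_def norm_mult norm_power)
    have ortho: "(LINT \<zeta>|\<sigma>. \<zeta> ^ Suc n * g \<zeta>) = 0" for n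
    proof (cases "Suc n \<le> j")
      case True
      have "(LINT \<zeta>|\<sigma>. \<zeta> ^ Suc n * g \<zeta>) = (LINT \<zeta>|\<sigma>. cnj \<zeta> ^ (j - Suc n) * f \<zeta>)"
      proof (intro Bochner_Integration.integral_cong refl)
        fix \<zeta> :: complex assume "\<zeta> \<in> space \<sigma>"
        then have z: "cmod \<zeta> = 1" by simp
        have "cnj \<zeta> ^ j = cnj \<zeta> ^ Suc n * cnj \<zeta> ^ (j - Suc n)" using True by (simp only: power_add[symmetric] le_add_diff_inverse)
        then have "\<zeta> ^ Suc n * g \<zeta> = (\<zeta> * cnj \<zeta>) ^ Suc n * (cnj \<zeta> ^ (j - Suc n) * f \<zeta>)"
          by (simp only: g_def power_mult_distrib mult_ac)
        then show "\<zeta> ^ Suc n * g \<zeta> = cnj \<zeta> ^ (j - Suc n) * f \<zeta>" unfolding circ[OF z] by simp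
      qed
      then show ?thesis using less[of "j - Suc n"] True by simp
    next
      case False
      have "(LINT \<zeta>|\<sigma>. \<zeta> ^ Suc n * g \<zeta>) = (LINT \<zeta>|\<sigma>. \<zeta> ^ Suc (n - j) * f \<zeta>)"
      proof (intro Bochner_Integration.integral_cong refl)
        fix \<zeta> :: complex assume "\<zeta> \<in> space \<sigma>"
        then have z: "cmod \<zeta> = 1" by simp
        have "Suc n = j + Suc (n - j)" using False by simp
        then have "\<zeta> ^ Suc n = \<zeta> ^ j * \<zeta> ^ Suc (n - j)" by (metis power_add)
        then have "\<zeta> ^ Suc n * g \<zeta> = (\<zeta> * cnj \<zeta>) ^ j * (\<zeta> ^ Suc (n - j) * f \<zeta>)"
          by (simp only: g_def power_mult_distrib mult_ac)
        then show "\<zeta> ^ Suc n * g \<zeta> = \<zeta> ^ Suc (n - j) * f \<zeta>" unfolding circ[OF z] by simp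
      qed
      then show ?thesis using posc by simp
    qed
    have gmean: "circle_mean J g = circle_mean J f" for J
      unfolding circle_mean_def
      by (intro arg_cong2[where f="(/)"] Bochner_Integration.integral_cong refl) (simp add: gf)
    have gn: "(LINT \<zeta>|\<sigma>. cmod (g \<zeta>)) = (LINT \<zeta>|\<sigma>. cmod (f \<zeta>))"
      by (intro Bochner_Integration.integral_cong refl) (simp add: gf)
    have le: "cmod (LINT \<zeta>|\<sigma>. g \<zeta>) \<le> exp (B k) * ((LINT \<zeta>|\<sigma>. cmod (f \<zeta>)) + 1)" for k
    proof -
      have "cmod (LINT \<zeta>|\<sigma>. g \<zeta>) \<le> exp (\<Sum>n<k. p n * ln (t n)) * ((LINT \<zeta>|\<sigma>. cmod (g \<zeta>)) + 1)"
        unfolding p_def by (rule norm_integral_le_step[OF gi ortho Is Idisj _ t0]) (use p0 tm in \<open>auto simp: p_def gmean\<close>)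
      also have "\<dots> \<le> exp (B k) * ((LINT \<zeta>|\<sigma>. cmod (f \<zeta>)) + 1)"
        unfolding gn using sumB[of k] by (intro mult_right_mono) (auto intro!: add_nonneg_nonneg Bochner_Integration.integral_nonneg)
      finally show ?thesis .
    qed
    have "(\<lambda>k. exp (B k) * ((LINT \<zeta>|\<sigma>. cmod (f \<zeta>)) + 1)) \<longlonglongrightarrow> 0 * ((LINT \<zeta>|\<sigma>. cmod (f \<zeta>)) + 1)"
      by (intro tendsto_mult Blim tendsto_const)
    then have "cmod (LINT \<zeta>|\<sigma>. g \<zeta>) \<le> 0 * ((LINT \<zeta>|\<sigma>. cmod (f \<zeta>)) + 1)"
      by (rule tendsto_lowerbound) (use le in \<open>auto intro: always_eventually\<close>)
    then show ?case by (simp add: g_def)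
  qed
  then show "AE \<zeta> in \<sigma>. f \<zeta> = 0"
    by (intro AE_zero_if_coeffs_zero[OF fL posc])
qed

end
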